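(* Let $1<p<\infty$ and let $\mathcal{A}_1,\mathcal{A}_2$ be separable unital Banach algebras, each isomorphic to a subalgebra of $B(l^p)$. Let $\phi$ be an isomorphic extension of $K(l^p)$ by $\mathcal{A}_2$ and for each $t\in[0,1]$ let $\tau_t:\mathcal{A}_1\to\mathcal{A}_2$ be a bounded unital homomorphism. Assume (1) $[\![\phi]\!]$ is invertible in $\mathrm{Ext}^{\sim}_{s,r}(\mathcal{A}_2,K(l^p))$ and (2) for each $a\in\mathcal{A}_1$, $t\mapsto\tau_t(a)$ is continuous from $[0,1]$ to $\mathcal{A}_2$. Then $(\tau_0)_*([\![\phi]\!])=(\tau_1)_*([\![\phi]\!])$.
   Context: $\pi:B(l^p)\to B(l^p)/K(l^p)$ is the quotient map. A homomorphism of Banach algebras is an isomorphism (into) if it is bounded above and below by constant multiples of the norm. An isomorphic extension of $K(l^p)$ by a separable unital Banach algebra $\mathcal{A}$ is a unital isomorphism (into) $\phi:\mathcal{A}\to B(l^p)/K(l^p)$; it is trivial if $\phi=\pi\circ\rho$ for a unital isomorphism (into) $\rho:\mathcal{A}\to B(l^p)$. $\phi_1,\phi_2$ are equivalent if $\phi_2(a)=\pi(S)\phi_1(a)\pi(S)^{-1}$ for some invertible $S\in B(l^p)$; $[\phi]$ is the class. Sum: $[\phi_1]+[\phi_2]$ is the class of $a\mapsto\pi(S_0(T_1\oplus T_2)S_0^{-1})$, where $\pi(T_i)=\phi_i(a)$ and $S_0:l^p\oplus l^p\to l^p$ is any invertible operator. This gives a commutative semigroup $\mathrm{Ext}^{\sim}_s(\mathcal{A},K(l^p))$;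 the classes of trivial extensions form a subsemigroup $G_0$. $\mathrm{Ext}^{\sim}_{s,r}(\mathcal{A},K(l^p))$ is the quotient semigroup where $g_1\equiv g_2$ iff $(g_1+G_0)\cap(g_2+G_0)\neq\emptyset$, with induced operation; it has an identity, and $[\![\phi]\!]$ denotes the image of $[\phi]$. For a bounded unital homomorphism $\tau:\mathcal{A}_1\to\mathcal{A}_2$, $\tau_*:\mathrm{Ext}^{\sim}_{s,r}(\mathcal{A}_2,K(l^p))\to\mathrm{Ext}^{\sim}_{s,r}(\mathcal{A}_1,K(l^p))$ is the (well defined) homomorphism $[\![\phi]\!]\mapsto[\![\omega]\!]$, where $\omega(a)=\pi(S_0(T_1\oplus T_2)S_0^{-1})$ with $\pi(T_1)=\phi(\tau(a))$, $\pi(T_2)=\theta(a)$, $\theta$ any trivial isomorphic extension of $K(l^p)$ by $\mathcal{A}_1$, and $S_0:l^p\oplus l^p\to l^p$ any invertible operator. *)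

theory Defs
  imports Complex_Main "HOL-Library.Countable_Set" "HOL-Library.Function_Algebras"
begin

record 'a cbalg =
  ba_carrier :: "'a set"
  ba_add :: "'a \<Rightarrow> 'a \<Rightarrow> 'a"
  ba_zero :: 'a
  ba_scale :: "complex \<Rightarrow> 'a \<Rightarrow> 'a"
  ba_mult :: "'a \<Rightarrow> 'a \<Rightarrow> 'a"
  ba_one :: 'a
  ba_norm :: "'a \<Rightarrow> real"

definition ba_diff :: "'a cbalg \<Rightarrow> 'a \<Rightarrow> 'a \<Rightarrow> 'a" where
  "ba_diff A x y = ba_add A x (ba_scale A (-1) y)"

definition unital_cbanach_algebra :: "'a cbalg \<Rightarrow> bool" where
  "unital_cbanach_algebra A \<longleftrightarrow>
     (let C = ba_carrier A; add = ba_add A; sc = ba_scale A; mul = ba_mult A;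
          z = ba_zero A; e = ba_one A; nm = ba_norm A in
     z \<in> C \<and> e \<in> C \<and>
     (\<forall>x\<in>C. \<forall>y\<in>C. add x y \<in> C \<and> mul x y \<in> C) \<and>
     (\<forall>c. \<forall>x\<in>C. sc c x \<in> C) \<and>
     \<comment> \<open>complex vector space\<close>
     (\<forall>x\<in>C. \<forall>y\<in>C. \<forall>w\<in>C. add (add x y) w = add x (add y w)) \<and>
     (\<forall>x\<in>C. \<forall>y\<in>C. add x y = add y x) \<and>
     (\<forall>x\<in>C. add z x = x) \<and>
     (\<forall>x\<in>C. add x (sc (-1) x) = z) \<and>
     (\<forall>c. \<forall>x\<in>C. \<forall>y\<in>C. sc c (add x y) = add (sc c x) (sc c y)) \<and>
     (\<forall>c d. \<forall>x\<in>C. sc (c + d) x = add (sc c x) (sc d x)) \<and>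
     (\<forall>c d. \<forall>x\<in>C. sc c (sc d x) = sc (c * d) x) \<and>
     (\<forall>x\<in>C. sc 1 x = x) \<and>
     \<comment> \<open>unital associative algebra\<close>
     (\<forall>x\<in>C. \<forall>y\<in>C. \<forall>w\<in>C. mul (mul x y) w = mul x (mul y w)) \<and>
     (\<forall>x\<in>C. \<forall>y\<in>C. \<forall>w\<in>C. mul (add x y) w = add (mul x w) (mul y w)) \<and>
     (\<forall>x\<in>C. \<forall>y\<in>C. \<forall>w\<in>C. mul x (add y w) = add (mul x y) (mul x w)) \<and>
     (\<forall>c. \<forall>x\<in>C. \<forall>y\<in>C. mul (sc c x) y = sc c (mul x y) \<and> mul x (sc c y) = sc c (mul x y)) \<and>
     (\<forall>x\<in>C. mul e x = x \<and> mul x e = x) \<and>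
     \<comment> \<open>submultiplicative norm\<close>
     (\<forall>x\<in>C. nm x = 0 \<longleftrightarrow> x = z) \<and>
     (\<forall>x\<in>C. \<forall>y\<in>C. nm (add x y) \<le> nm x + nm y) \<and>
     (\<forall>c. \<forall>x\<in>C. nm (sc c x) = cmod c * nm x) \<and>
     (\<forall>x\<in>C. \<forall>y\<in>C. nm (mul x y) \<le> nm x * nm y) \<and>
     \<comment> \<open>completeness\<close>
     (\<forall>xs. (\<forall>n. xs n \<in> C) \<longrightarrow>
        (\<forall>\<epsilon>>0. \<exists>N. \<forall>m\<ge>N. \<forall>n\<ge>N. nm (ba_diff A (xs m) (xs n)) < \<epsilon>) \<longrightarrow>
        (\<exists>x\<in>C. (\<lambda>n. nm (ba_diff A (xs n) x)) \<longlonglongrightarrow> 0)))"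

definition ba_separable :: "'a cbalg \<Rightarrow> bool" where
  "ba_separable A \<longleftrightarrow> (\<exists>D. D \<subseteq> ba_carrier A \<and> countable D \<and>
      (\<forall>x\<in>ba_carrier A. \<forall>\<epsilon>>0. \<exists>d\<in>D. ba_norm A (ba_diff A x d) < \<epsilon>))"

definition ba_hom :: "'a cbalg \<Rightarrow> 'b cbalg \<Rightarrow> ('a \<Rightarrow> 'b) \<Rightarrow> bool" where
  "ba_hom A B f \<longleftrightarrow>
     (\<forall>x\<in>ba_carrier A. f x \<in> ba_carrier B) \<and>
     (\<forall>x\<in>ba_carrier A. \<forall>y\<in>ba_carrier A. f (ba_add A x y) = ba_add B (f x) (f y)) \<and>
     (\<forall>c. \<forall>x\<in>ba_carrier A. f (ba_scale A c x) = ba_scale B c (f x)) \<and>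
     (\<forall>x\<in>ba_carrier A. \<forall>y\<in>ba_carrier A. f (ba_mult A x y) = ba_mult B (f x) (f y))"

definition bounded_hom :: "'a cbalg \<Rightarrow> 'b cbalg \<Rightarrow> ('a \<Rightarrow> 'b) \<Rightarrow> bool" where
  "bounded_hom A B f \<longleftrightarrow> ba_hom A B f \<and>
     (\<exists>K. \<forall>x\<in>ba_carrier A. ba_norm B (f x) \<le> K * ba_norm A x)"

definition unital_bounded_hom :: "'a cbalg \<Rightarrow> 'b cbalg \<Rightarrow> ('a \<Rightarrow> 'b) \<Rightarrow> bool" where
  "unital_bounded_hom A B f \<longleftrightarrow> bounded_hom A B f \<and> f (ba_one A) = ba_one B"

definition iso_into :: "'a cbalg \<Rightarrow> 'b cbalg \<Rightarrow> ('a \<Rightarrow> 'b) \<Rightarrow> bool" where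
  "iso_into A B f \<longleftrightarrow> bounded_hom A B f \<and>
     (\<exists>c>0. \<forall>x\<in>ba_carrier A. c * ba_norm A x \<le> ba_norm B (f x))"

definition unital_iso_into :: "'a cbalg \<Rightarrow> 'b cbalg \<Rightarrow> ('a \<Rightarrow> 'b) \<Rightarrow> bool" where
  "unital_iso_into A B f \<longleftrightarrow> iso_into A B f \<and> f (ba_one A) = ba_one B"

type_synonym lpvec = "nat \<Rightarrow> complex"
type_synonym lpop = "lpvec \<Rightarrow> lpvec"

definition lp :: "real \<Rightarrow> lpvec set" where
  "lp p = {x. summable (\<lambda>n. cmod (x n) powr p)}"

definition lp_norm :: "real \<Rightarrow> lpvec \<Rightarrow> real" where
  "lp_norm p x = (\<Sum>n. cmod (x n) powr p) powr (1 / p)"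

definition vscale :: "complex \<Rightarrow> lpvec \<Rightarrow> lpvec" where
  "vscale c x = (\<lambda>n. c * x n)"

text \<open>Bounded linear operators on l^p; represented extensionally (value 0 off l^p).\<close>
definition bop :: "real \<Rightarrow> lpop set" where
  "bop p = {T. (\<forall>x. x \<notin> lp p \<longrightarrow> T x = 0) \<and>
              (\<forall>x\<in>lp p. T x \<in> lp p) \<and>
              (\<forall>x\<in>lp p. \<forall>y\<in>lp p. T (x + y) = T x + T y) \<and>
              (\<forall>c. \<forall>x\<in>lp p. T (vscale c x) = vscale c (T x)) \<and>
              (\<exists>K. \<forall>x\<in>lp p. lp_norm p (T x) \<le> K * lp_norm p x)}"

definition op_norm :: "real \<Rightarrow> lpop \<Rightarrow> real" where
  "op_norm p T = Sup {lp_norm p (T x) | x. x \<in> lp p \<and> lp_norm p x \<le> 1}"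

definition op_add :: "lpop \<Rightarrow> lpop \<Rightarrow> lpop" where
  "op_add T S = (\<lambda>x. T x + S x)"

definition op_scale :: "complex \<Rightarrow> lpop \<Rightarrow> lpop" where
  "op_scale c T = (\<lambda>x. vscale c (T x))"

definition op_one :: "real \<Rightarrow> lpop" where
  "op_one p = (\<lambda>x. if x \<in> lp p then x else 0)"

definition bops :: "real \<Rightarrow> lpop cbalg" where
  "bops p = \<lparr> ba_carrier = bop p, ba_add = op_add, ba_zero = (\<lambda>x. 0),
              ba_scale = op_scale, ba_mult = (\<circ>), ba_one = op_one p,
              ba_norm = op_norm p \<rparr>"

definition kop :: "real \<Rightarrow> lpop set" where
  "kop p = {T \<in> bop p. \<forall>xs :: nat \<Rightarrow> lpvec. (\<forall>n. xs n \<in> lp p \<and> lp_norm p (xs n) \<le> 1) \<longrightarrow>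
              (\<exists>r y. strict_mono r \<and> y \<in> lp p \<and>
                     (\<lambda>n. lp_norm p (T (xs (r n)) - y)) \<longlonglongrightarrow> 0)}"

definition calk_pi :: "real \<Rightarrow> lpop \<Rightarrow> lpop set" where
  "calk_pi p T = {S \<in> bop p. op_add S (op_scale (-1) T) \<in> kop p}"

definition calk_rep :: "real \<Rightarrow> lpop set \<Rightarrow> lpop" where
  "calk_rep p X = (SOME T. T \<in> bop p \<and> calk_pi p T = X)"

definition calkin :: "real \<Rightarrow> lpop set cbalg" where
  "calkin p = \<lparr> ba_carrier = calk_pi p ` bop p,
     ba_add = (\<lambda>X Y. calk_pi p (op_add (calk_rep p X) (calk_rep p Y))),
     ba_zero = calk_pi p (\<lambda>x. 0),
     ba_scale = (\<lambda>c X. calk_pi p (op_scale c (calk_rep p X))),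
     ba_mult = (\<lambda>X Y. calk_pi p (calk_rep p X \<circ> calk_rep p Y)),
     ba_one = calk_pi p (op_one p),
     ba_norm = (\<lambda>X. Inf (op_norm p ` X)) \<rparr>"

definition iso_ext :: "real \<Rightarrow> 'a cbalg \<Rightarrow> ('a \<Rightarrow> lpop set) \<Rightarrow> bool" where
  "iso_ext p A \<phi> \<longleftrightarrow> unital_iso_into A (calkin p) \<phi>"

definition trivial_ext :: "real \<Rightarrow> 'a cbalg \<Rightarrow> ('a \<Rightarrow> lpop set) \<Rightarrow> bool" where
  "trivial_ext p A \<phi> \<longleftrightarrow> iso_ext p A \<phi> \<and>
     (\<exists>\<rho>. unital_iso_into A (bops p) \<rho> \<and> (\<forall>a\<in>ba_carrier A. \<phi> a = calk_pi p (\<rho> a)))"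

definition ext_equiv :: "real \<Rightarrow> 'a cbalg \<Rightarrow> ('a \<Rightarrow> lpop set) \<Rightarrow> ('a \<Rightarrow> lpop set) \<Rightarrow> bool" where
  "ext_equiv p A \<phi>1 \<phi>2 \<longleftrightarrow>
     (\<exists>S\<in>bop p. \<exists>S'\<in>bop p. S \<circ> S' = op_one p \<and> S' \<circ> S = op_one p \<and>
        (\<forall>a\<in>ba_carrier A. \<phi>2 a =
           ba_mult (calkin p) (ba_mult (calkin p) (calk_pi p S) (\<phi>1 a)) (calk_pi p S')))"

definition S0 :: "lpvec \<times> lpvec \<Rightarrow> lpvec" where
  "S0 = (\<lambda>(x, y) n. if even n then x (n div 2) else y (n div 2))"

definition S0_inv :: "real \<Rightarrow> lpvec \<Rightarrow> lpvec \<times> lpvec" where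
  "S0_inv p z = (if z \<in> lp p then (\<lambda>n. z (2 * n), \<lambda>n. z (2 * n + 1)) else (0, 0))"

definition op_dsum :: "lpop \<Rightarrow> lpop \<Rightarrow> lpvec \<times> lpvec \<Rightarrow> lpvec \<times> lpvec" where
  "op_dsum T1 T2 = (\<lambda>(x, y). (T1 x, T2 y))"

definition ext_sum :: "real \<Rightarrow> ('a \<Rightarrow> lpop set) \<Rightarrow> ('a \<Rightarrow> lpop set) \<Rightarrow> 'a \<Rightarrow> lpop set" where
  "ext_sum p \<phi>1 \<phi>2 = (\<lambda>a. calk_pi p
      (S0 \<circ> op_dsum (calk_rep p (\<phi>1 a)) (calk_rep p (\<phi>2 a)) \<circ> S0_inv p))"

text \<open>Equality in Ext~_{s,r}: (g1 + G0) meets (g2 + G0).\<close>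
definition red_equiv :: "real \<Rightarrow> 'a cbalg \<Rightarrow> ('a \<Rightarrow> lpop set) \<Rightarrow> ('a \<Rightarrow> lpop set) \<Rightarrow> bool" where
  "red_equiv p A \<psi>1 \<psi>2 \<longleftrightarrow>
     (\<exists>\<theta>1 \<theta>2. trivial_ext p A \<theta>1 \<and> trivial_ext p A \<theta>2 \<and>
        ext_equiv p A (ext_sum p \<psi>1 \<theta>1) (ext_sum p \<psi>2 \<theta>2))"

text \<open>[[phi]] is invertible in Ext~_{s,r}(A, K(l^p)); the identity is the class of any trivial extension.\<close>
definition red_invertible :: "real \<Rightarrow> 'a cbalg \<Rightarrow> ('a \<Rightarrow> lpop set) \<Rightarrow> bool" where
  "red_invertible p A \<phi> \<longleftrightarrow>
     (\<exists>\<psi>. iso_ext p A \<psi> \<and>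
        (\<exists>\<theta>. trivial_ext p A \<theta> \<and> red_equiv p A (ext_sum p \<phi> \<psi>) \<theta>))"

text \<open>tau_*([[phi]]) is represented by ext_sum p (phi o tau) theta, theta any trivial extension of A1.\<close>
definition pushforward_rep ::
  "real \<Rightarrow> 'a cbalg \<Rightarrow> ('a \<Rightarrow> 'b) \<Rightarrow> ('b \<Rightarrow> lpop set) \<Rightarrow> ('a \<Rightarrow> lpop set) \<Rightarrow> bool" where
  "pushforward_rep p A1 \<tau> \<phi> \<omega> \<longleftrightarrow>
     (\<exists>\<theta>. trivial_ext p A1 \<theta> \<and> \<omega> = ext_sum p (\<phi> \<circ> \<tau>) \<theta>)"

end

theory Submission
  imports Defs "HOL-Complex_Analysis.Great_Picard"
begin

text \<open>Invertibility of the class of \<open>\<phi>\<close> yields a bounded unital homomorphism \<open>\<rho>\<close> of \<open>A2\<close> into the bounded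
  operators and a coordinate projection \<open>P\<close> commuting with it modulo compacts such that \<open>\<phi> b\<close> is the class of the
  compression of \<open>\<rho> b\<close> to the range of \<open>P\<close>. Put \<open>T t a = \<rho> (\<tau> t a)\<close>.

  Take countably many further copies of the sequence space, with the representation \<open>T s\<close> on the copy with
  parameter \<open>s\<close>, for dyadic \<open>s\<close>. Think of every copy as a pair consisting of the range of \<open>P\<close> and its complement. If
  the range of \<open>P\<close> in the copy with parameter \<open>s\<close> is moved to the copy with parameter \<open>s + 1/2^j\<close>, then the
  representation changes by an error that is small for large \<open>j\<close>, and a full cycle through the dyadic points of
  level \<open>j\<close> replaces \<open>\<phi> \<circ> \<tau> 0\<close> by \<open>\<phi> \<circ> \<tau> 1\<close> on the first summand. To make the error compact, the cycle is taken finer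
  and finer along the coordinates: level \<open>j\<close> is used in the \<open>j\<close>-th window, and inside a window the permutation of
  level \<open>j\<close> is deformed into the one of level \<open>j + 1\<close>, which differs from it by an involution, with coefficients that
  commute with the representation up to \<open>2^-j\<close>. Such coefficients exist because for \<open>p > 1\<close> every countable set of
  operators is almost block tridiagonal. All permutations act on coordinates, so the resulting operator is
  invertible and not merely Fredholm, and it intertwines \<open>\<phi> \<circ> \<tau> 0\<close> plus the representation with \<open>\<phi> \<circ> \<tau> 1\<close> plus
  the representation modulo compacts.\<close>

text \<open>Continuity of \<tau> is only pointwise, and this shapes the estimates. The errors made
  by moving the range of P one dyadic step tend to 0 without a rate, so they cannot be summed; they
  are confined to coordinate windows that are disjoint for levels of equal parity, where the norm of
  a sum is a maximum. The commutators with the cutoffs are not localised in this way, but they can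
  be prescribed to be summable. Each level controls finitely many members of a dense sequence only;
  all other elements follow because the compact operators are norm closed and the homomorphisms are
  uniformly bounded, by Banach-Steinhaus. The first copy has parameter 0 in the source and 1 in the
  target, so the step of the cycle that returns to it from 1 costs nothing. Only the range of P is
  kept there; its complement is removed at the end by a compression to coordinates whose projection
  commutes with the twist. The auxiliary representation need not be bounded below. It therefore
  enters a trivial extension only together with a summand that is.\<close>

section \<open>Sequence spaces\<close>

text \<open>Jensen's inequality for \<open>t powr p\<close> at the points u/a and v/b with weights
  a/(a + b) and b/(a + b). With a and b bounding two norms, summation over the coordinates gives
  Minkowski's inequality.\<close>

lemma powr_add_le_weighted:
  fixes u v a b p :: real
  assumes "0 \<le> u" "0 \<le> v" "0 < a" "0 < b" "1 \<le> p"
  shows "(u + v) powr p \<le> (a + b) powr p * (a / (a + b) * (u / a) powr p + b / (a + b) * (v / b) powr p)"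
proof -
  define s t where "s = u / a" and "t = v / b"
  have st: "0 \<le> s" "0 \<le> t" "u = a * s" "v = b * t"
    using assms by (auto simp: s_def t_def)
  define \<mu> where "\<mu> = b / (a + b)"
  have \<mu>: "0 < \<mu>" "\<mu> < 1" "1 - \<mu> = a / (a + b)"
    using assms by (auto simp: \<mu>_def field_simps)
  have conv: "((1 - \<mu>) * s + \<mu> * t) powr p \<le> (1 - \<mu>) * s powr p + \<mu> * t powr p"
  proof (cases "s = 0 \<or> t = 0")
    case False
    with st have "s \<in> {0<..}" "t \<in> {0<..}" by auto
    from convex_onD[OF powr_convex[OF assms(5)] _ _ this, of \<mu>] \<mu> show ?thesis by simp
  next
    case True
    \<comment> \<open>\<open>powr_convex\<close> covers the open half line; if s or t is 0,
      convexity reduces to \<open>\<mu> powr p \<le> \<mu>\<close> for a weight below 1.\<close>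
    have *: "x powr p \<le> x" if "0 < x" "x < 1" for x :: real
      using powr_mono'[of 1 p x] that assms(5) by simp
    show ?thesis
    proof (cases "s = 0")
      case s0: True
      have "(\<mu> * t) powr p = \<mu> powr p * t powr p" using \<mu> st by (simp add: powr_mult)
      also have "\<dots> \<le> \<mu> * t powr p" using *[of \<mu>] \<mu> by (intro mult_right_mono) auto
      finally show ?thesis using s0 assms by simp
    next
      case s0: False
      then have t0: "t = 0" using True by simp
      have "((1-\<mu>) * s) powr p = (1-\<mu>) powr p * s powr p" by (rule powr_mult)
      also have "\<dots> \<le> (1-\<mu>) * s powr p" using *[of "1-\<mu>"] \<mu> by (intro mult_right_mono) auto
      finally show ?thesis using t0 assms by simp
    qed
  qed
  have eq: "u + v = (a + b) * ((1 - \<mu>) * s + \<mu> * t)"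
  proof -
    have "(a + b) * (1 - \<mu>) = a" "(a + b) * \<mu> = b" using assms \<mu>(3) by (simp_all add: \<mu>_def)
    then have "(a + b) * ((1 - \<mu>) * s + \<mu> * t) = a * s + b * t"
      by (metis distrib_left mult.assoc)
    then show ?thesis using st by simp
  qed
  have "(u + v) powr p = (a + b) powr p * ((1 - \<mu>) * s + \<mu> * t) powr p"
    unfolding eq by (rule powr_mult)
  also have "\<dots> \<le> (a + b) powr p * ((1 - \<mu>) * s powr p + \<mu> * t powr p)"
    by (intro mult_left_mono conv) auto
  finally show ?thesis unfolding \<mu>(3) by (simp add: s_def t_def \<mu>_def)
qed

lemma sum_fun_at: "sum y I n = (\<Sum>i\<in>I. y i n)"
  for y :: "'i \<Rightarrow> 'a \<Rightarrow> 'b::comm_monoid_add"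
  by (induction I rule: infinite_finite_induct) auto

locale lp_space =
  fixes p :: real
  assumes p_gt_1: "1 < p"
begin

abbreviation L where "L \<equiv> lp p"
abbreviation nm where "nm \<equiv> lp_norm p"

lemma p_pos [simp]: "0 < p" "0 \<le> p" "p \<noteq> 0" "1 \<le> p"
  using p_gt_1 by auto

lemma powr_le_powrD: "0 \<le> b \<Longrightarrow> a powr p \<le> b powr p \<Longrightarrow> a \<le> b" for a b :: real
  using powr_less_mono2[of p b a] p_pos by (meson not_le)

lemma nm_nonneg [simp]: "0 \<le> nm x"
  by (simp add: lp_norm_def)

lemma nm_powr: "x \<in> L \<Longrightarrow> nm x powr p = (\<Sum>n. cmod (x n) powr p)"
  by (simp add: lp_norm_def lp_def powr_powr suminf_nonneg)

text \<open>Membership and norm bound become one statement about finite sums, so most later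
  estimates need no summability argument.\<close>

lemma lp_bound_iff:
  assumes "0 \<le> c"
  shows "x \<in> L \<and> nm x \<le> c \<longleftrightarrow> (\<forall>S. finite S \<longrightarrow> (\<Sum>n\<in>S. cmod (x n) powr p) \<le> c powr p)"
proof
  assume x: "x \<in> L \<and> nm x \<le> c"
  show "\<forall>S. finite S \<longrightarrow> (\<Sum>n\<in>S. cmod (x n) powr p) \<le> c powr p"
  proof (intro allI impI)
    fix S :: "nat set" assume "finite S"
    then have "(\<Sum>n\<in>S. cmod (x n) powr p) \<le> nm x powr p"
      using x by (subst nm_powr) (auto simp: lp_def intro: sum_le_suminf)
    also have "\<dots> \<le> c powr p" using x by (intro powr_mono2) auto
    finally show "(\<Sum>n\<in>S. cmod (x n) powr p) \<le> c powr p" .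
  qed
next
  assume b: "\<forall>S. finite S \<longrightarrow> (\<Sum>n\<in>S. cmod (x n) powr p) \<le> c powr p"
  have s: "summable (\<lambda>n. cmod (x n) powr p)"
    by (rule summableI_nonneg_bounded[of _ "c powr p"]) (use b in auto)
  have "(\<Sum>n. cmod (x n) powr p) \<le> c powr p"
    by (rule suminf_le_const[OF s]) (use b in auto)
  then have "nm x \<le> (c powr p) powr (1 / p)"
    unfolding lp_norm_def using s by (intro powr_mono2) (auto intro: suminf_nonneg)
  with s assms show "x \<in> L \<and> nm x \<le> c" by (simp add: lp_def powr_powr)
qed

lemma lp_boundI:
  assumes "0 \<le> c" "\<And>S. finite S \<Longrightarrow> (\<Sum>n\<in>S. cmod (x n) powr p) \<le> c powr p"
  shows "x \<in> L" "nm x \<le> c"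
  using lp_bound_iff[OF assms(1), of x] assms(2) by auto

lemma sum_powr_le_nm: "x \<in> L \<Longrightarrow> finite S \<Longrightarrow> (\<Sum>n\<in>S. cmod (x n) powr p) \<le> nm x powr p"
  using lp_bound_iff[of "nm x" x] by auto

lemma cmod_le_nm:
  assumes "x \<in> L" shows "cmod (x n) \<le> nm x"
proof -
  have "cmod (x n) powr p \<le> nm x powr p" using sum_powr_le_nm[OF assms, of "{n}"] by simp
  then show ?thesis by (rule powr_le_powrD[rotated]) simp
qed

lemma zero_lp [simp]: "0 \<in> L" "nm 0 = 0"
  using lp_boundI[of 0 0] by (auto intro: antisym)

lemma nm_eq_0: "x \<in> L \<Longrightarrow> nm x = 0 \<Longrightarrow> x = 0"
  using cmod_le_nm[of x] by (intro ext) auto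

lemma lp_dominated:
  assumes "x \<in> L" "\<And>n. cmod (y n) \<le> c * cmod (x n)" "0 \<le> c"
  shows "y \<in> L" "nm y \<le> c * nm x"
proof -
  have "(\<Sum>n\<in>S. cmod (y n) powr p) \<le> (c * nm x) powr p" if "finite S" for S
  proof -
    have "(\<Sum>n\<in>S. cmod (y n) powr p) \<le> (\<Sum>n\<in>S. c powr p * cmod (x n) powr p)"
    proof (rule sum_mono)
      fix n
      have "cmod (y n) powr p \<le> (c * cmod (x n)) powr p" using assms by (intro powr_mono2) auto
      then show "cmod (y n) powr p \<le> c powr p * cmod (x n) powr p" using assms by (simp add: powr_mult)
    qed
    also have "\<dots> \<le> c powr p * nm x powr p"
      unfolding sum_distrib_left[symmetric] by (intro mult_left_mono sum_powr_le_nm assms that) auto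
    finally show ?thesis using assms by (simp add: powr_mult)
  qed
  from lp_boundI[OF _ this] assms(3) show "y \<in> L" "nm y \<le> c * nm x" by auto
qed

lemma lp_scale:
  assumes "x \<in> L" shows "vscale c x \<in> L" "nm (vscale c x) = cmod c * nm x"
proof -
  show v: "vscale c x \<in> L" using lp_dominated(1)[OF assms, of "vscale c x" "cmod c"] by (simp add: vscale_def norm_mult)
  have 1: "nm (vscale c x) \<le> cmod c * nm x" using lp_dominated(2)[OF assms, of "vscale c x" "cmod c"] by (simp add: vscale_def norm_mult)
  show "nm (vscale c x) = cmod c * nm x"
  proof (cases "c = 0")
    case True then show ?thesis using 1 nm_nonneg[of "vscale c x"] by (simp only: norm_zero mult_zero_left antisym)
  next
    case False
    have "nm x \<le> (1 / cmod c) * nm (vscale c x)"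
      using lp_dominated(2)[OF v, of x "1 / cmod c"] False by (simp add: vscale_def norm_mult)
    with 1 False show ?thesis by (simp add: field_simps)
  qed
qed

lemma lp_uminus: "x \<in> L \<Longrightarrow> - x \<in> L" "x \<in> L \<Longrightarrow> nm (- x) = nm x"
  using lp_scale[of x "-1"] by (auto simp: vscale_def fun_Compl_def)

lemma lp_add:
  assumes x: "x \<in> L" and y: "y \<in> L"
  shows "x + y \<in> L" "nm (x + y) \<le> nm x + nm y"
proof -
  \<comment> \<open>Strictly positive bounds stand in for the norms because the weights divide by
    them; the norms return at the end up to an arbitrary e.\<close>
  have *: "x + y \<in> L \<and> nm (x + y) \<le> a + b" if ab: "nm x \<le> a" "nm y \<le> b" "0 < a" "0 < b" for a b
  proof -
    have "(\<Sum>n\<in>S. cmod ((x + y) n) powr p) \<le> (a + b) powr p" if "finite S" for S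
    proof -
      have "(\<Sum>n\<in>S. cmod ((x + y) n) powr p) \<le> (\<Sum>n\<in>S. (a + b) powr p * (a / (a + b) * (cmod (x n) / a) powr p + b / (a + b) * (cmod (y n) / b) powr p))"
      proof (rule sum_mono)
        fix n
        have "cmod ((x + y) n) powr p \<le> (cmod (x n) + cmod (y n)) powr p"
          by (intro powr_mono2) (auto intro: norm_triangle_ineq)
        also have "\<dots> \<le> (a + b) powr p * (a / (a + b) * (cmod (x n) / a) powr p + b / (a + b) * (cmod (y n) / b) powr p)"
          using ab by (intro powr_add_le_weighted) auto
        finally show "cmod ((x + y) n) powr p \<le> \<dots>" .
      qed
      also have "\<dots> = (a + b) powr p * (a / (a + b) * ((\<Sum>n\<in>S. cmod (x n) powr p) / a powr p) + b / (a + b) * ((\<Sum>n\<in>S. cmod (y n) powr p) / b powr p))"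
        using ab by (simp add: powr_divide sum_distrib_left[symmetric] sum.distrib sum_divide_distrib[symmetric])
      also have "\<dots> \<le> (a + b) powr p * (a / (a + b) * 1 + b / (a + b) * 1)"
      proof -
        have "(\<Sum>n\<in>S. cmod (x n) powr p) \<le> a powr p" "(\<Sum>n\<in>S. cmod (y n) powr p) \<le> b powr p"
          using lp_bound_iff[of a x] lp_bound_iff[of b y] ab x y that by auto
        then show ?thesis using ab by (intro mult_left_mono add_mono) (auto simp: divide_le_eq_1)
      qed
      also have "\<dots> = (a + b) powr p" using ab by (simp add: add_divide_distrib[symmetric])
      finally show ?thesis .
    qed
    then show ?thesis using lp_bound_iff[of "a+b" "x+y"] ab by auto
  qed
  from *[of "nm x + 1" "nm y + 1"] show "x + y \<in> L" using nm_nonneg[of x] nm_nonneg[of y] by (simp add: add_nonneg_pos)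
  show "nm (x + y) \<le> nm x + nm y"
  proof (rule field_le_epsilon)
    fix e :: real assume "0 < e"
    then show "nm (x + y) \<le> nm x + nm y + e"
      using *[of "nm x + e/2" "nm y + e/2"] nm_nonneg[of x] nm_nonneg[of y] by (simp add: add_nonneg_pos)
  qed
qed

lemma lp_diff:
  assumes x: "x \<in> L" and y: "y \<in> L"
  shows "x - y \<in> L" "nm (x - y) \<le> nm x + nm y"
  using lp_add[OF x lp_uminus(1)[OF y]] lp_uminus(2)[OF y] by auto

lemma lp_sum:
  assumes "\<And>i. i \<in> I \<Longrightarrow> x i \<in> L"
  shows "sum x I \<in> L" "nm (sum x I) \<le> (\<Sum>i\<in>I. nm (x i))"
proof -
  have "sum x I \<in> L \<and> nm (sum x I) \<le> (\<Sum>i\<in>I. nm (x i))"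
    using assms
  proof (induction I rule: infinite_finite_induct)
    case (insert i I)
    have *: "sum x (insert i I) = x i + sum x I" "(\<Sum>j\<in>insert i I. nm (x j)) = nm (x i) + (\<Sum>j\<in>I. nm (x j))"
      using insert.hyps by (simp_all only: sum.insert not_False_eq_True)
    show ?case unfolding * using lp_add[of "x i" "sum x I"] insert by (meson add_left_mono insertI1 insertI2 order_trans)
  qed auto
  then show "sum x I \<in> L" "nm (sum x I) \<le> (\<Sum>i\<in>I. nm (x i))" by auto
qed

lemma nm_triangle3: "x \<in> L \<Longrightarrow> y \<in> L \<Longrightarrow> nm x \<le> nm y + nm (x - y)"
  using lp_add(2)[of y "x - y"] lp_diff[of x y] by simp

text \<open>Lower semicontinuity of the norm (Fatou): every finite sum of pth powers passes to the
  limit.\<close>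

lemma lp_coordinate_limit:
  assumes "\<And>n. x n \<in> L" "\<And>n. nm (x n) \<le> c" "\<And>k. (\<lambda>n. x n k) \<longlonglongrightarrow> y k"
  shows "y \<in> L" "nm y \<le> c"
proof -
  have c: "0 \<le> c" using assms(2)[of 0] nm_nonneg[of "x 0"] by linarith
  have "(\<Sum>k\<in>S. cmod (y k) powr p) \<le> c powr p" if "finite S" for S
  proof (rule LIMSEQ_le_const2)
    show "(\<lambda>n. \<Sum>k\<in>S. cmod (x n k) powr p) \<longlonglongrightarrow> (\<Sum>k\<in>S. cmod (y k) powr p)"
      by (intro tendsto_sum tendsto_powr2 tendsto_norm assms tendsto_const) auto
    show "\<exists>N. \<forall>n\<ge>N. (\<Sum>k\<in>S. cmod (x n k) powr p) \<le> c powr p"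
      using lp_bound_iff[OF c] assms(1,2) that by blast
  qed
  from lp_boundI[OF c this] show "y \<in> L" "nm y \<le> c" by auto
qed

text \<open>At each coordinate at most one summand is nonzero, so the pth powers add. This is what
  improves on the triangle inequality when many pieces are summed.\<close>

lemma lp_sum_disjoint:
  assumes "finite I" "\<And>i. i \<in> I \<Longrightarrow> x i \<in> L"
    "\<And>i j n. i \<in> I \<Longrightarrow> j \<in> I \<Longrightarrow> i \<noteq> j \<Longrightarrow> x i n = 0 \<or> x j n = 0"
  shows "nm (sum x I) powr p = (\<Sum>i\<in>I. nm (x i) powr p)"
proof -
  have pt: "cmod (sum x I n) powr p = (\<Sum>i\<in>I. cmod (x i n) powr p)" for n
  proof (cases "\<exists>i\<in>I. x i n \<noteq> 0")
    case True
    then obtain i where i: "i \<in> I" "x i n \<noteq> 0" by auto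
    then have o: "x j n = 0" if "j \<in> I - {i}" for j using assms(3)[of i j n] that by auto
    have "(\<Sum>j\<in>I. x j n) = x i n" using i o assms(1) by (subst sum.remove[of _ i]) auto
    moreover have "(\<Sum>j\<in>I. cmod (x j n) powr p) = cmod (x i n) powr p"
      using i o assms(1) by (subst sum.remove[of _ i]) auto
    ultimately show ?thesis by (simp add: sum_fun_at)
  qed (simp add: sum_fun_at)
  have "nm (sum x I) powr p = (\<Sum>n. \<Sum>i\<in>I. cmod (x i n) powr p)"
    using lp_sum(1)[of I x] assms(2) by (simp add: nm_powr pt)
  also have "\<dots> = (\<Sum>i\<in>I. \<Sum>n. cmod (x i n) powr p)"
    using assms(2) by (intro suminf_sum) (auto simp: lp_def)
  also have "\<dots> = (\<Sum>i\<in>I. nm (x i) powr p)" using assms(2) by (simp add: nm_powr)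
  finally show ?thesis .
qed

lemma lp_comp_inj:
  assumes x: "x \<in> L" and f: "inj f"
  shows "x \<circ> f \<in> L" "nm (x \<circ> f) \<le> nm x"
proof -
  have "(\<Sum>n\<in>S. cmod ((x \<circ> f) n) powr p) \<le> nm x powr p" if "finite S" for S
  proof -
    have "(\<Sum>n\<in>S. cmod ((x \<circ> f) n) powr p) = (\<Sum>n\<in>f ` S. cmod (x n) powr p)"
      using f by (subst sum.reindex) (auto intro: inj_on_subset)
    also have "\<dots> \<le> nm x powr p" using x that by (intro sum_powr_le_nm) auto
    finally show ?thesis .
  qed
  from lp_boundI[OF nm_nonneg this] show "x \<circ> f \<in> L" "nm (x \<circ> f) \<le> nm x" by blast+
qed

lemma lp_extend_inj:
  assumes x: "x \<in> L" and f: "inj f"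
  shows "(\<lambda>n. if n \<in> range f then x (inv f n) else 0) \<in> L"
    "nm (\<lambda>n. if n \<in> range f then x (inv f n) else 0) \<le> nm x"
proof -
  have "(\<Sum>n\<in>S. cmod (if n \<in> range f then x (inv f n) else 0) powr p) \<le> nm x powr p" if "finite S" for S
  proof -
    have "(\<Sum>n\<in>S. cmod (if n \<in> range f then x (inv f n) else 0) powr p)
        = (\<Sum>n\<in>S \<inter> range f. cmod (x (inv f n)) powr p)"
      using that by (intro sum.mono_neutral_cong_right) auto
    also have "\<dots> = (\<Sum>n\<in>inv f ` (S \<inter> range f). cmod (x n) powr p)"
      by (subst sum.reindex) (auto intro!: inj_on_inv_into)
    also have "\<dots> \<le> nm x powr p" using x that by (intro sum_powr_le_nm) auto
    finally show ?thesis .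
  qed
  from lp_boundI[OF nm_nonneg this] show "(\<lambda>n. if n \<in> range f then x (inv f n) else 0) \<in> L"
    "nm (\<lambda>n. if n \<in> range f then x (inv f n) else 0) \<le> nm x" by auto
qed

lemma lp_tail_tendsto:
  assumes x: "x \<in> L"
  shows "(\<lambda>N. nm (\<lambda>n. if n < N then 0 else x n)) \<longlonglongrightarrow> 0"
proof -
  let ?a = "\<lambda>n. cmod (x n) powr p"
  have s: "summable ?a" using x by (simp add: lp_def)
  have L: "(\<lambda>n. if n < N then 0 else x n) \<in> L" for N
    using lp_dominated(1)[OF x, of _ 1] by auto
  have eq: "nm (\<lambda>n. if n < N then 0 else x n) powr p = suminf ?a - (\<Sum>n<N. ?a n)" for N
  proof -
    have "nm (\<lambda>n. if n < N then 0 else x n) powr p = (\<Sum>n. if n < N then 0 else ?a n)"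
      unfolding nm_powr[OF L] by (intro suminf_cong) auto
    also have "\<dots> = (\<Sum>n. (\<lambda>n. if n < N then 0 else ?a n) (n + N)) + (\<Sum>n<N. if n < N then 0 else ?a n)"
      using L[of N] by (intro suminf_split_initial_segment) (auto simp: lp_def elim!: summable_cong[THEN iffD1, rotated] intro!: eventuallyI)
    also have "\<dots> = (\<Sum>n. ?a (n + N))" by simp
    also have "\<dots> = suminf ?a - (\<Sum>n<N. ?a n)" using suminf_minus_initial_segment[OF s, of N] by simp
    finally show ?thesis .
  qed
  have "(\<lambda>N. suminf ?a - (\<Sum>n<N. ?a n)) \<longlonglongrightarrow> suminf ?a - suminf ?a"
    by (intro tendsto_intros summable_LIMSEQ s)
  then have "(\<lambda>N. (nm (\<lambda>n. if n < N then 0 else x n) powr p) powr (1/p)) \<longlonglongrightarrow> 0 powr (1/p)"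
    unfolding eq by (intro tendsto_powr2) (auto simp: tendsto_const eq[symmetric])
  then show ?thesis by (simp add: powr_powr)
qed


section \<open>Bounded operators\<close>

text \<open>A norm bound in place of the norm: bounds add, compose and weaken without handling a
  supremum. \<open>op_norm\<close> is needed mainly at the interface with the given
  definitions.\<close>

definition nb :: "lpop \<Rightarrow> real \<Rightarrow> bool" where
  "nb T c \<longleftrightarrow> T \<in> bop p \<and> 0 \<le> c \<and> (\<forall>x\<in>L. nm (T x) \<le> c * nm x)"

lemma bop_off: "T \<in> bop p \<Longrightarrow> x \<notin> L \<Longrightarrow> T x = 0"
  and bop_lp: "T \<in> bop p \<Longrightarrow> x \<in> L \<Longrightarrow> T x \<in> L"
  and bop_add: "T \<in> bop p \<Longrightarrow> x \<in> L \<Longrightarrow> y \<in> L \<Longrightarrow> T (x + y) = T x + T y"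
  and bop_scale: "T \<in> bop p \<Longrightarrow> x \<in> L \<Longrightarrow> T (vscale c x) = vscale c (T x)"
  by (auto simp: bop_def)

lemma bop_lp': "T \<in> bop p \<Longrightarrow> T x \<in> L"
  by (metis bop_lp bop_off zero_lp(1))

lemma bop_zero: assumes "T \<in> bop p" shows "T 0 = 0"
proof -
  have "T 0 = T 0 + T 0" using bop_add[OF assms zero_lp(1) zero_lp(1)] by (simp only: add_0_left)
  then show ?thesis by (simp only: add_cancel_right_left)
qed

lemmas bopD = bop_off bop_lp bop_add bop_scale bop_zero

lemma bop_uminus: assumes "T \<in> bop p" "x \<in> L" shows "T (- x) = - T x"
proof -
  have "T x + T (- x) = 0" using bop_add[OF assms lp_uminus(1)[OF assms(2)]] bop_zero[OF assms(1)] by (simp only: add.right_inverse)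
  then show ?thesis by (metis add.inverse_unique)
qed

lemma bop_diff: assumes "T \<in> bop p" "x \<in> L" "y \<in> L" shows "T (x - y) = T x - T y"
  using bop_add[OF assms(1,2) lp_uminus(1)[OF assms(3)]] bop_uminus[OF assms(1,3)] by (simp only: add_uminus_conv_diff)

lemma bop_sum: "T \<in> bop p \<Longrightarrow> (\<And>i. i \<in> I \<Longrightarrow> x i \<in> L) \<Longrightarrow> T (sum x I) = (\<Sum>i\<in>I. T (x i))"
proof (induction I rule: infinite_finite_induct)
  case (insert i I)
  have *: "sum x (insert i I) = x i + sum x I" "(\<Sum>j\<in>insert i I. T (x j)) = T (x i) + (\<Sum>j\<in>I. T (x j))"
    using insert.hyps by (simp_all only: sum.insert not_False_eq_True)
  show ?case unfolding * using insert lp_sum(1)[of I x] by (subst bop_add) auto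
qed (simp_all only: sum.infinite sum.empty bop_zero not_False_eq_True)

lemma bop_ext:
  assumes "S \<in> bop p" "T \<in> bop p" "\<And>x. x \<in> L \<Longrightarrow> S x = T x"
  shows "S = T"
proof
  fix x show "S x = T x" using assms by (cases "x \<in> L") (simp_all only: bop_off[OF assms(1)] bop_off[OF assms(2)] not_False_eq_True)
qed

lemma nbD: "nb T c \<Longrightarrow> T \<in> bop p" "nb T c \<Longrightarrow> 0 \<le> c" "nb T c \<Longrightarrow> x \<in> L \<Longrightarrow> nm (T x) \<le> c * nm x"
  by (auto simp: nb_def)

lemma nb_bounded: "nb T c \<Longrightarrow> x \<in> L \<Longrightarrow> nm x \<le> b \<Longrightarrow> nm (T x) \<le> c * b"
  using nbD(3)[of T c x] nbD(2)[of T c] by (meson mult_left_mono order_trans)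

lemma nb_mono: "nb T c \<Longrightarrow> c \<le> d \<Longrightarrow> nb T d"
  unfolding nb_def by (meson mult_right_mono nm_nonneg order_trans)

lemma bop_nb: assumes "T \<in> bop p" obtains c where "nb T c" "0 < c"
proof -
  obtain K where K: "\<forall>x\<in>L. nm (T x) \<le> K * nm x" using assms by (auto simp: bop_def)
  have "K * nm x \<le> max K 1 * nm x" for x by (intro mult_right_mono) auto
  then have "nb T (max K 1)" unfolding nb_def using assms K by (auto intro: order_trans)
  then show ?thesis by (rule that) auto
qed

lemma nbI:
  assumes "\<And>x. x \<notin> L \<Longrightarrow> T x = 0" "\<And>x. x \<in> L \<Longrightarrow> T x \<in> L"
    "\<And>x y. x \<in> L \<Longrightarrow> y \<in> L \<Longrightarrow> T (x + y) = T x + T y"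
    "\<And>a x. x \<in> L \<Longrightarrow> T (vscale a x) = vscale a (T x)"
    "0 \<le> c" "\<And>x. x \<in> L \<Longrightarrow> nm (T x) \<le> c * nm x"
  shows "nb T c"
  using assms by (auto simp: nb_def bop_def intro!: exI[of _ c])

lemma nbI_bop: "T \<in> bop p \<Longrightarrow> 0 \<le> c \<Longrightarrow> (\<And>x. x \<in> L \<Longrightarrow> nm (T x) \<le> c * nm x) \<Longrightarrow> nb T c"
  by (simp add: nb_def)

lemma vscale_add: "vscale a (x + y) = vscale a x + vscale a y"
  by (auto simp: vscale_def algebra_simps)

lemma nb_add: assumes "nb S c" "nb T d" shows "nb (S + T) (c + d)"
proof -
  note B = nbD(1)[OF assms(1)] nbD(1)[OF assms(2)]
  show ?thesis
  proof (rule nbI)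
    fix x assume x: "x \<in> L"
    show "(S + T) x \<in> L" using lp_add(1)[OF bop_lp[OF B(1) x] bop_lp[OF B(2) x]] by simp
    have "nm ((S + T) x) \<le> nm (S x) + nm (T x)" using lp_add(2)[OF bop_lp[OF B(1) x] bop_lp[OF B(2) x]] by simp
    also have "\<dots> \<le> (c + d) * nm x" using nbD(3)[OF assms(1) x] nbD(3)[OF assms(2) x] by (simp add: algebra_simps)
    finally show "nm ((S + T) x) \<le> (c + d) * nm x" .
  next
    show "0 \<le> c + d" using nbD(2)[OF assms(1)] nbD(2)[OF assms(2)] by simp
  qed (simp_all add: bopD[OF B(1)] bopD[OF B(2)] vscale_add)
qed

lemma nb_scale: assumes "nb T d" shows "nb (op_scale a T) (cmod a * d)"
proof (rule nbI)
  fix x assume x: "x \<in> L"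
  have Tx: "T x \<in> L" by (rule bop_lp[OF nbD(1)[OF assms] x])
  show "op_scale a T x \<in> L" using Tx by (simp add: op_scale_def lp_scale)
  show "nm (op_scale a T x) \<le> cmod a * d * nm x"
    using mult_left_mono[OF nbD(3)[OF assms x], of "cmod a"] Tx by (simp add: op_scale_def lp_scale mult.assoc)
next
  show "0 \<le> cmod a * d" using nbD(2)[OF assms] by simp
qed (simp_all add: op_scale_def bopD[OF nbD(1)[OF assms]] vscale_add, simp_all add: vscale_def algebra_simps fun_eq_iff)

lemma op_scale_minus_one: "op_scale (- 1) T = - T"
  by (auto simp: op_scale_def vscale_def fun_eq_iff)

lemma nb_uminus: "nb T d \<Longrightarrow> nb (- T) d"
  using nb_scale[of T d "-1"] by (simp add: op_scale_minus_one)

lemma nb_diff: "nb S c \<Longrightarrow> nb T d \<Longrightarrow> nb (S - T) (c + d)"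
  using nb_add[of S c "- T" d] nb_uminus[of T d] by simp

lemma nb_zero: "0 \<le> c \<Longrightarrow> nb 0 c"
  by (rule nbI) (auto simp: vscale_def)

lemma nb_sum: "(\<And>i. i \<in> I \<Longrightarrow> nb (T i) (c i)) \<Longrightarrow> nb (sum T I) (sum c I)"
proof (induction I rule: infinite_finite_induct)
  case (insert i I)
  have *: "sum T (insert i I) = T i + sum T I" "sum c (insert i I) = c i + sum c I"
    using insert.hyps by (simp_all only: sum.insert not_False_eq_True)
  show ?case unfolding * using insert by (intro nb_add) auto
qed (auto intro: nb_zero)

lemma nb_comp: assumes "nb S c" "nb T d" shows "nb (S \<circ> T) (c * d)"
proof -
  note B = nbD(1)[OF assms(1)] nbD(1)[OF assms(2)]
  show ?thesis
  proof (rule nbI)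
    fix x assume x: "x \<in> L"
    have Tx: "T x \<in> L" by (rule bop_lp[OF B(2) x])
    show "(S \<circ> T) x \<in> L" using bop_lp[OF B(1) Tx] by simp
    show "nm ((S \<circ> T) x) \<le> c * d * nm x"
      using nb_bounded[OF assms(1) Tx nbD(3)[OF assms(2) x]] by (simp add: mult.assoc)
  next
    show "0 \<le> c * d" using nbD(2)[OF assms(1)] nbD(2)[OF assms(2)] by simp
  qed (simp_all add: bopD[OF B(1)] bopD[OF B(2)])
qed

lemma bop_closed [intro, simp]:
  "S \<in> bop p \<Longrightarrow> T \<in> bop p \<Longrightarrow> S + T \<in> bop p"
  "S \<in> bop p \<Longrightarrow> T \<in> bop p \<Longrightarrow> S - T \<in> bop p"
  "S \<in> bop p \<Longrightarrow> T \<in> bop p \<Longrightarrow> S \<circ> T \<in> bop p"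
  "T \<in> bop p \<Longrightarrow> op_scale a T \<in> bop p"
  "T \<in> bop p \<Longrightarrow> - T \<in> bop p"
  "0 \<in> bop p"
  by (meson bop_nb nbD(1) nb_add, meson bop_nb nbD(1) nb_diff, meson bop_nb nbD(1) nb_comp,
      meson bop_nb nbD(1) nb_scale, meson bop_nb nbD(1) nb_uminus, meson order_refl nbD(1) nb_zero)

lemma bop_sum_closed: "(\<And>i. i \<in> I \<Longrightarrow> T i \<in> bop p) \<Longrightarrow> sum T I \<in> bop p"
proof (induction I rule: infinite_finite_induct)
  case (insert i I)
  then show ?case by (simp only: sum.insert not_False_eq_True) (simp only: bop_closed insert_iff simp_thms)
qed (simp_all only: sum.infinite sum.empty bop_closed not_False_eq_True)

lemma op_add_eq: "op_add S T = S + T"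
  by (auto simp: op_add_def)

lemma comp_add_left: "(S + T) \<circ> R = (S \<circ> R) + (T \<circ> R)" "(S - T) \<circ> R = (S \<circ> R) - (T \<circ> R)" for S T R :: lpop
  by (auto simp: fun_eq_iff)

lemma comp_add_right:
  assumes "R \<in> bop p" "S \<in> bop p" "T \<in> bop p"
  shows "R \<circ> (S + T) = (R \<circ> S) + (R \<circ> T)" "R \<circ> (S - T) = (R \<circ> S) - (R \<circ> T)"
  by (auto simp: fun_eq_iff bop_add[OF assms(1) bop_lp'[OF assms(2)] bop_lp'[OF assms(3)]] bop_diff[OF assms(1) bop_lp'[OF assms(2)] bop_lp'[OF assms(3)]])

lemma comp_scale_right: assumes "R \<in> bop p" "T \<in> bop p" shows "R \<circ> op_scale c T = op_scale c (R \<circ> T)"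
  by (auto simp: op_scale_def bop_scale[OF assms(1) bop_lp'[OF assms(2)]])

lemma comp_scale_left: "op_scale c R \<circ> T = op_scale c (R \<circ> T)"
  by (auto simp: op_scale_def)

lemma one_bop: "nb (op_one p) 1" "op_one p \<in> bop p"
proof -
  show "nb (op_one p) 1" by (rule nbI) (auto simp: op_one_def lp_add lp_scale)
  then show "op_one p \<in> bop p" by (rule nbD)
qed

lemma one_comp: assumes "T \<in> bop p" shows "op_one p \<circ> T = T" "T \<circ> op_one p = T"
  by (auto simp: op_one_def fun_eq_iff bop_lp'[OF assms] bopD[OF assms])

lemma op_norm_le: assumes "nb T c" shows "op_norm p T \<le> c"
  unfolding op_norm_def
proof (rule cSup_least)
  show "{nm (T x) |x. x \<in> L \<and> nm x \<le> 1} \<noteq> {}" using zero_lp by (auto intro!: exI[of _ 0])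
qed (use nb_bounded[OF assms, of _ 1] in auto)

lemma nb_op_norm: assumes "T \<in> bop p" shows "nb T (op_norm p T)"
proof -
  obtain c where c: "nb T c" "0 < c" using bop_nb[OF assms] .
  have bd: "bdd_above {nm (T x) |x. x \<in> L \<and> nm x \<le> 1}"
    by (rule bdd_aboveI[of _ c]) (use nb_bounded[OF c(1), of _ 1] in auto)
  have up: "nm (T x) \<le> op_norm p T" if "x \<in> L" "nm x \<le> 1" for x
    unfolding op_norm_def by (rule cSup_upper[OF _ bd]) (use that in auto)
  show ?thesis
  proof (rule nbI_bop[OF assms])
    show "0 \<le> op_norm p T" using up[of 0] by (simp add: bop_zero[OF assms])
    fix x assume x: "x \<in> L"
    show "nm (T x) \<le> op_norm p T * nm x"
    proof (cases "nm x = 0")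
      case True then show ?thesis using nbD(3)[OF c(1) x] by simp
    next
      case False
      then have n: "0 < nm x" using nm_nonneg[of x] by linarith
      let ?y = "vscale (of_real (1 / nm x)) x"
      have "?y \<in> L" "nm ?y = 1" using x n by (auto simp: lp_scale norm_divide)
      then have "nm (T ?y) \<le> op_norm p T" using up by simp
      moreover have "nm (T ?y) = nm (T x) / nm x" using x n assms by (simp add: bop_scale[OF assms x] lp_scale[OF bop_lp[OF assms x]] norm_divide)
      ultimately show ?thesis using n by (metis pos_divide_le_eq)
    qed
  qed
qed

lemma op_norm_nonneg: "T \<in> bop p \<Longrightarrow> 0 \<le> op_norm p T"
  by (rule nbD(2)[OF nb_op_norm])

section \<open>Multipliers, restriction and zero extension along injections of the
  coordinates\<close>

definition mulop :: "(nat \<Rightarrow> complex) \<Rightarrow> lpop" where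
  "mulop g = (\<lambda>x. if x \<in> L then (\<lambda>n. g n * x n) else 0)"

definition res :: "(nat \<Rightarrow> nat) \<Rightarrow> lpop" where
  "res f = (\<lambda>x. if x \<in> L then x \<circ> f else 0)"

definition emb :: "(nat \<Rightarrow> nat) \<Rightarrow> lpop" where
  "emb f = (\<lambda>x. if x \<in> L then (\<lambda>n. if n \<in> range f then x (inv f n) else 0) else 0)"

lemma nb_mulop: assumes "\<And>n. cmod (g n) \<le> c" shows "nb (mulop g) c"
proof -
  have c: "0 \<le> c" using assms[of 0] norm_ge_zero[of "g 0"] by linarith
  have *: "(\<lambda>n. g n * x n) \<in> L" "nm (\<lambda>n. g n * x n) \<le> c * nm x" if "x \<in> L" for x
    using lp_dominated[OF that _ c, of "\<lambda>n. g n * x n"] assms by (simp_all add: norm_mult mult_right_mono)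
  show ?thesis
    by (rule nbI) (use c * in \<open>auto simp: mulop_def lp_add lp_scale(1)[unfolded vscale_def] vscale_def algebra_simps fun_eq_iff\<close>)
qed

lemma nb_res: assumes "inj f" shows "nb (res f) 1"
  by (rule nbI) (use lp_comp_inj[OF _ assms] in \<open>auto simp: res_def lp_add lp_scale(1)[unfolded vscale_def] vscale_def fun_eq_iff\<close>)

lemma nb_emb: assumes "inj f" shows "nb (emb f) 1"
  by (rule nbI) (use lp_extend_inj[OF _ assms] in \<open>auto simp: emb_def lp_add lp_scale(1)[unfolded vscale_def] vscale_def fun_eq_iff\<close>)

lemma res_emb: assumes "inj f" shows "res f \<circ> emb f = op_one p"
  using lp_extend_inj(1)[OF _ assms] assms by (auto simp: res_def emb_def op_one_def fun_eq_iff)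

lemma emb_res: assumes "inj f" shows "emb f \<circ> res f = mulop (\<lambda>n. if n \<in> range f then 1 else 0)"
  using lp_comp_inj(1)[OF _ assms] assms by (auto simp: res_def emb_def mulop_def fun_eq_iff f_inv_into_f)

lemma mulop_comp: assumes "\<And>n. cmod (h n) \<le> c" shows "mulop g \<circ> mulop h = mulop (\<lambda>n. g n * h n)"
  using bop_lp[OF nbD(1)[OF nb_mulop[of h c, OF assms]]] by (auto simp: mulop_def fun_eq_iff)

lemma mulop_add: "mulop g + mulop h = mulop (\<lambda>n. g n + h n)" "mulop g - mulop h = mulop (\<lambda>n. g n - h n)"
  by (auto simp: mulop_def fun_eq_iff algebra_simps)

lemma mulop_one: "mulop (\<lambda>n. 1) = op_one p"
  by (auto simp: mulop_def op_one_def)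

definition cut :: "nat \<Rightarrow> lpop" where
  "cut N = mulop (\<lambda>n. if n < N then 1 else 0)"

definition tailop :: "nat \<Rightarrow> lpop" where
  "tailop N = mulop (\<lambda>n. if n < N then 0 else 1)"

lemma nb_cut: "nb (cut N) 1" and nb_tail: "nb (tailop N) 1"
  unfolding cut_def tailop_def by (rule nb_mulop, simp)+

lemma cut_bop [simp]: "cut N \<in> bop p" and tail_bop [simp]: "tailop N \<in> bop p"
  by (rule nbD(1)[OF nb_cut], rule nbD(1)[OF nb_tail])

lemma cut_apply: "x \<in> L \<Longrightarrow> cut N x n = (if n < N then x n else 0)"
  and tail_apply: "x \<in> L \<Longrightarrow> tailop N x n = (if n < N then 0 else x n)"
  by (auto simp: cut_def tailop_def mulop_def)

lemma tail_tendsto: assumes "x \<in> L" shows "(\<lambda>N. nm (tailop N x)) \<longlonglongrightarrow> 0"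
proof -
  have "tailop N x = (\<lambda>n. if n < N then 0 else x n)" for N by (rule ext) (simp add: tail_apply assms)
  then show ?thesis using lp_tail_tendsto[OF assms] by simp
qed

lemma cut_tail_split: "x \<in> L \<Longrightarrow> x = cut N x + tailop N x"
  by (auto simp: cut_apply tail_apply)

lemma tail_tail: "M \<le> N \<Longrightarrow> tailop M \<circ> tailop N = tailop N" "M \<le> N \<Longrightarrow> tailop N \<circ> tailop M = tailop N"
  unfolding tailop_def by (subst mulop_comp[where c=1]; force intro: arg_cong[of _ _ mulop])+

text \<open>Truncations converge in norm, and T is already known to be bounded by some d, so a bound
  on finitely supported vectors passes to the limit with the same constant.\<close>

lemma nb_dense:
  assumes T: "T \<in> bop p" and c: "0 \<le> c"
    and b: "\<And>x N. x \<in> L \<Longrightarrow> (\<And>n. N \<le> n \<Longrightarrow> x n = 0) \<Longrightarrow> nm (T x) \<le> c * nm x"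
  shows "nb T c"
proof (rule nbI_bop[OF T c])
  fix x assume x: "x \<in> L"
  obtain d where d: "nb T d" "0 < d" using bop_nb[OF T] .
  have 1: "nm (T x) \<le> c * nm x + d * nm (tailop N x)" for N
  proof -
    have Lc: "cut N x \<in> L" "tailop N x \<in> L" by (rule bop_lp[OF cut_bop x], rule bop_lp[OF tail_bop x])
    have "T x = T (cut N x) + T (tailop N x)" using cut_tail_split[OF x] bop_add[OF T Lc] by metis
    then have "nm (T x) \<le> nm (T (cut N x)) + nm (T (tailop N x))" using lp_add(2)[OF bop_lp[OF T Lc(1)] bop_lp[OF T Lc(2)]] by simp
    also have "nm (T (cut N x)) \<le> c * nm (cut N x)" by (rule b[OF Lc(1), of N]) (simp add: cut_apply x)
    also have "\<dots> \<le> c * nm x" using nbD(3)[OF nb_cut x, of N] c by (simp add: mult_left_mono)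
    also have "nm (T (tailop N x)) \<le> d * nm (tailop N x)" by (rule nbD(3)[OF d(1) Lc(2)])
    finally show ?thesis by simp
  qed
  have "(\<lambda>N. c * nm x + d * nm (tailop N x)) \<longlonglongrightarrow> c * nm x + d * 0"
    by (intro tendsto_intros tail_tendsto x)
  then show "nm (T x) \<le> c * nm x" using 1 by (auto intro: LIMSEQ_le_const)
qed

lemma nm_sum_disjoint_le:
  assumes "finite I" "\<And>i. i \<in> I \<Longrightarrow> y i \<in> L"
    "\<And>i j n. i \<in> I \<Longrightarrow> j \<in> I \<Longrightarrow> i \<noteq> j \<Longrightarrow> y i n = 0 \<or> y j n = 0"
    "\<And>i. i \<in> I \<Longrightarrow> nm (y i) \<le> c" "0 \<le> c"
  shows "nm (sum y I) \<le> real (card I) powr (1 / p) * c"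
proof -
  have "nm (sum y I) powr p = (\<Sum>i\<in>I. nm (y i) powr p)" by (rule lp_sum_disjoint[OF assms(1-3)])
  also have "\<dots> \<le> (\<Sum>i\<in>I. c powr p)" using assms by (intro sum_mono powr_mono2) auto
  also have "\<dots> = (real (card I) powr (1 / p) * c) powr p" using assms by (simp add: powr_mult powr_powr)
  finally show ?thesis by (rule powr_le_powrD[rotated]) (use assms in auto)
qed

text \<open>Block diagonal case: both the ranges and the supports of the pieces lie in disjoint sets
  of coordinates, so the sum is no larger than the largest piece.\<close>

lemma nb_sum_disjoint:
  assumes "finite I" "\<And>i. i \<in> I \<Longrightarrow> nb (A i) c" "0 \<le> c"
    "\<And>i j. i \<in> I \<Longrightarrow> j \<in> I \<Longrightarrow> i \<noteq> j \<Longrightarrow> Z i \<inter> Z j = {}"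
    "\<And>i. i \<in> I \<Longrightarrow> mulop (indicator (Z i)) \<circ> A i = A i"
    "\<And>i. i \<in> I \<Longrightarrow> A i \<circ> mulop (indicator (Z i)) = A i"
  shows "nb (sum A I) c"
proof (rule nbI_bop)
  have A: "A i \<in> bop p" if "i \<in> I" for i using assms(2)[OF that] by (rule nbD)
  show "sum A I \<in> bop p" using A by (rule bop_sum_closed)
  show "0 \<le> c" by fact
  fix x assume x: "x \<in> L"
  let ?z = "\<lambda>i. mulop (indicator (Z i))"
  have zb: "nb (?z i) 1" for i by (rule nb_mulop) (auto simp: indicator_def)
  have zx: "?z i x \<in> L" for i by (rule bop_lp[OF nbD(1)[OF zb] x])
  have zero: "A i x n = 0" if "i \<in> I" "n \<notin> Z i" for i n
  proof -
    have "A i x = ?z i (A i x)" using assms(5)[OF that(1)] by (metis comp_apply)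
    then have "A i x n = ?z i (A i x) n" by simp
    then show ?thesis using that bop_lp[OF A[OF that(1)] x] by (simp add: mulop_def)
  qed
  have 1: "nm (A i x) \<le> c * nm (?z i x)" if "i \<in> I" for i
  proof -
    have "A i x = A i (?z i x)" using assms(6)[OF that] by (metis comp_apply)
    then show ?thesis using nbD(3)[OF assms(2)[OF that] zx[of i]] by simp
  qed
  have "nm (sum A I x) powr p = nm (\<Sum>i\<in>I. A i x) powr p" by (simp add: sum_fun_at)
  also have "\<dots> = (\<Sum>i\<in>I. nm (A i x) powr p)"
  proof (rule lp_sum_disjoint[OF assms(1)])
    fix i j n assume "i \<in> I" "j \<in> I" "i \<noteq> j"
    then show "A i x n = 0 \<or> A j x n = 0" using assms(4)[of i j] zero[of i n] zero[of j n] by blast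
  qed (rule bop_lp[OF A x])
  also have "\<dots> \<le> (\<Sum>i\<in>I. (c * nm (?z i x)) powr p)" by (intro sum_mono powr_mono2 1) auto
  also have "\<dots> = c powr p * (\<Sum>i\<in>I. nm (?z i x) powr p)" using assms(3) by (simp add: powr_mult sum_distrib_left)
  also have "(\<Sum>i\<in>I. nm (?z i x) powr p) = nm (\<Sum>i\<in>I. ?z i x) powr p"
    using assms(4) zx x by (intro lp_sum_disjoint[OF assms(1), symmetric]) (auto simp: mulop_def indicator_def)
  also have "\<dots> \<le> nm x powr p"
  proof (rule powr_mono2)
    have "cmod ((\<Sum>i\<in>I. ?z i x) n) \<le> 1 * cmod (x n)" for n
    proof (cases "\<exists>i\<in>I. n \<in> Z i")
      case True
      then obtain i where i: "i \<in> I" "n \<in> Z i" by auto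
      have "(\<Sum>j\<in>I. ?z j x n) = ?z i x n"
        using i assms(1,4) x by (subst sum.remove[of _ i]) (auto simp: mulop_def indicator_def intro!: sum.neutral)
      then show ?thesis using x i by (simp add: sum_fun_at mulop_def)
    next
      case False
      then show ?thesis using x by (auto simp: sum_fun_at mulop_def indicator_def intro!: sum.neutral)
    qed
    from lp_dominated(2)[OF x this] show "nm (\<Sum>i\<in>I. ?z i x) \<le> nm x" by simp
  qed auto
  also have "c powr p * nm x powr p = (c * nm x) powr p" using assms(3) by (simp add: powr_mult)
  finally have "nm (sum A I x) powr p \<le> (c * nm x) powr p" by (simp add: mult_left_mono)
  then show "nm (sum A I x) \<le> c * nm x" by (rule powr_le_powrD[rotated]) (use assms(3) in auto)
qed


section \<open>Compact operators\<close>

lemma kop_bop: "T \<in> kop p \<Longrightarrow> T \<in> bop p"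
  by (simp add: kop_def)

lemma kopD:
  assumes "T \<in> kop p" "\<And>n. xs n \<in> L" "\<And>n. nm (xs n) \<le> 1"
  obtains r y where "strict_mono (r :: nat \<Rightarrow> nat)" "y \<in> L" "(\<lambda>n. nm (T (xs (r n)) - y)) \<longlonglongrightarrow> 0"
  using assms unfolding kop_def by blast

text \<open>By density a failing bound already fails at a finitely supported vector. Cutting it off
  below N and scaling it into the unit ball supplies one hump of a gliding hump argument.\<close>

lemma not_nb_witness:
  assumes T: "T \<in> bop p" and "0 < \<epsilon>" "\<not> nb (T \<circ> tailop N) \<epsilon>"
  obtains z M where "z \<in> L" "nm z \<le> 1" "\<epsilon> < nm (T z)" "N \<le> M" "\<And>n. z n \<noteq> 0 \<Longrightarrow> N \<le> n \<and> n < M"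
proof -
  have TT: "T \<circ> tailop N \<in> bop p" using T by simp
  obtain x M where x: "x \<in> L" "\<And>n. M \<le> n \<Longrightarrow> x n = 0" "\<not> nm ((T \<circ> tailop N) x) \<le> \<epsilon> * nm x"
    using nb_dense[OF TT, of \<epsilon>] assms by fastforce
  have "nm x \<noteq> 0"
  proof
    assume "nm x = 0"
    then have "x = 0" using nm_eq_0 x by blast
    then show False using x(3) bop_zero[OF TT] by simp
  qed
  then have n: "0 < nm x" using nm_nonneg[of x] by linarith
  define z where "z = vscale (of_real (1 / nm x)) (tailop N x)"
  have tx: "tailop N x \<in> L" by (rule bop_lp[OF tail_bop x(1)])
  show ?thesis
  proof (rule that)
    show "z \<in> L" unfolding z_def by (rule lp_scale(1)[OF tx])
    have "nm (tailop N x) \<le> nm x" using nbD(3)[OF nb_tail x(1)] by simp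
    then show "nm z \<le> 1" unfolding z_def lp_scale(2)[OF tx] using n by (simp add: norm_divide)
    have "nm (T z) = nm (T (tailop N x)) / nm x"
      unfolding z_def bop_scale[OF T tx] lp_scale(2)[OF bop_lp[OF T tx]] using n by (simp add: norm_divide)
    also have "\<dots> > \<epsilon>" using x(3) n by (simp add: pos_less_divide_eq)
    finally show "\<epsilon> < nm (T z)" .
    show "N \<le> max N M" by simp
    show "N \<le> k \<and> k < max N M" if "z k \<noteq> 0" for k
    proof -
      have "tailop N x k \<noteq> 0" using that by (auto simp: z_def vscale_def)
      then have "N \<le> k" "x k \<noteq> 0" by (auto simp: tail_apply[OF x(1)] split: if_splits)
      then show ?thesis using x(2)[of k] by (auto simp: not_le[symmetric])
    qed
  qed
qed

text \<open>Disjointly supported unit vectors have sums of norm at most \<open>k powr (1 / p)\<close>, so for \<open>p > 1\<close> a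
  compact operator cannot send infinitely many of them near one nonzero vector.\<close>

lemma kop_tail_right:
  assumes T: "T \<in> kop p" and e: "0 < \<epsilon>"
  shows "\<exists>N. nb (T \<circ> tailop N) \<epsilon>"
proof (rule ccontr)
  assume "\<not> ?thesis"
  then have no: "\<not> nb (T \<circ> tailop N) \<epsilon>" for N by simp
  have Tb: "T \<in> bop p" by (rule kop_bop[OF T])
  have "\<exists>z M. z \<in> L \<and> nm z \<le> 1 \<and> \<epsilon> < nm (T z) \<and> N \<le> M \<and> (\<forall>n. z n \<noteq> 0 \<longrightarrow> N \<le> n \<and> n < M)" for N
    using not_nb_witness[OF Tb e no[of N]] by metis
  then obtain Z Mf where Z: "\<And>N. Z N \<in> L" "\<And>N. nm (Z N) \<le> 1" "\<And>N. \<epsilon> < nm (T (Z N))"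
    "\<And>N. N \<le> Mf N" "\<And>N n. Z N n \<noteq> 0 \<Longrightarrow> N \<le> n \<and> n < Mf N" by metis
  \<comment> \<open>The next hump starts where the support of the previous one ends, so all humps
    have disjoint supports.\<close>
  define s where "s i = (Mf ^^ i) 0" for i
  have sS: "s (Suc i) = Mf (s i)" for i by (simp add: s_def)
  have smono: "i \<le> j \<Longrightarrow> s i \<le> s j" for i j
    by (rule lift_Suc_mono_le[of s]) (auto simp: sS Z)
  have disj: "Z (s i) n = 0 \<or> Z (s j) n = 0" if "i < j" for i j n
    using Z(5)[of "s i" n] Z(5)[of "s j" n] smono[of "Suc i" j] that sS[of i] by force
  obtain r y where r: "strict_mono r" and y: "y \<in> L" and lim: "(\<lambda>n. nm (T (Z (s (r n))) - y)) \<longlonglongrightarrow> 0"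
    by (rule kopD[OF T, of "\<lambda>i. Z (s i)"]) (auto simp: Z)
  obtain i0 where i0: "\<And>n. n \<ge> i0 \<Longrightarrow> nm (T (Z (s (r n))) - y) < \<epsilon> / 4"
    using order_tendstoD(2)[OF lim, of "\<epsilon>/4"] e by (auto simp: eventually_sequentially)
  define z where "z n = Z (s (r n))" for n
  have z: "z n \<in> L" "nm (z n) \<le> 1" "\<epsilon> < nm (T (z n))" for n by (auto simp: z_def Z)
  have Tz: "T (z n) \<in> L" for n by (rule bop_lp[OF Tb z(1)])
  have ny: "3/4 * \<epsilon> \<le> nm y"
  proof -
    have "nm (T (z i0)) \<le> nm y + nm (T (z i0) - y)" by (rule nm_triangle3[OF Tz y])
    then show ?thesis using z(3)[of i0] i0[of i0] by (simp add: z_def)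
  qed
  obtain c where c: "nb T c" "0 < c" using bop_nb[OF Tb] .
  \<comment> \<open>The images stay within \<epsilon>/4 of y, whose norm is at least 3/4 \<epsilon>;
    hence the sum of k humps has image of norm at least k \<epsilon>/2, while its own norm is at
    most \<open>k powr (1 / p)\<close>.\<close>
  have key: "real k * (\<epsilon> / 2) \<le> c * real k powr (1 / p)" for k
  proof -
    let ?I = "{i0..<i0+k}"
    have "nm (sum z ?I) \<le> real (card ?I) powr (1 / p) * 1"
    proof (rule nm_sum_disjoint_le)
      fix i j n :: nat assume "i \<noteq> j"
      then have "r i \<noteq> r j" using r by (simp add: strict_mono_eq)
      then show "z i n = 0 \<or> z j n = 0" using disj[of "r i" "r j" n] disj[of "r j" "r i" n] by (auto simp: z_def neq_iff)
    qed (auto simp: z)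
    then have 1: "nm (sum z ?I) \<le> real k powr (1 / p)" by simp
    have zI: "sum z ?I \<in> L" by (rule lp_sum(1)) (rule z)
    have ky: "vscale (of_nat k) y = (\<Sum>i\<in>?I. y)"
      by (auto simp: vscale_def sum_fun_at)
    have kyL: "vscale (of_nat k) y \<in> L" by (rule lp_scale(1)[OF y])
    have "vscale (of_nat k) y - T (sum z ?I) = (\<Sum>i\<in>?I. y - T (z i))"
      using bop_sum[OF Tb, of ?I z] z(1) by (simp only: ky sum_subtractf)
    then have "nm (vscale (of_nat k) y - T (sum z ?I)) \<le> (\<Sum>i\<in>?I. nm (y - T (z i)))"
      using lp_sum(2)[of ?I "\<lambda>i. y - T (z i)"] lp_diff(1)[OF y Tz] by simp
    also have "\<dots> \<le> (\<Sum>i\<in>?I. \<epsilon> / 4)"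
    proof (rule sum_mono)
      fix i assume "i \<in> ?I"
      then have "nm (- (T (z i) - y)) \<le> \<epsilon> / 4" unfolding lp_uminus(2)[OF lp_diff(1)[OF Tz y]] using i0[of i] by (simp add: z_def)
      then show "nm (y - T (z i)) \<le> \<epsilon> / 4" by simp
    qed
    finally have 2: "nm (vscale (of_nat k) y - T (sum z ?I)) \<le> real k * (\<epsilon> / 4)" by simp
    have "real k * nm y = nm (vscale (of_nat k) y)" by (simp add: lp_scale(2)[OF y])
    also have "\<dots> \<le> nm (T (sum z ?I)) + nm (vscale (of_nat k) y - T (sum z ?I))"
      by (rule nm_triangle3[OF kyL bop_lp[OF Tb zI]])
    also have "\<dots> \<le> c * real k powr (1 / p) + real k * (\<epsilon> / 4)"
      using nb_bounded[OF c(1) zI 1] 2 by linarith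
    finally have "real k * nm y \<le> \<dots>" .
    moreover have "real k * (3/4 * \<epsilon>) \<le> real k * nm y" using ny by (intro mult_left_mono) auto
    ultimately show ?thesis by (simp add: algebra_simps)
  qed
  have "(\<lambda>k. real k powr (1/p - 1)) \<longlonglongrightarrow> 0"
    using p_gt_1 by (intro tendsto_neg_powr filterlim_real_sequentially) (auto simp: field_simps)
  then have "\<forall>\<^sub>F k in sequentially. real k powr (1/p - 1) < \<epsilon> / (2 * c)"
    using e c by (intro order_tendstoD) auto
  then obtain k where k: "real k powr (1/p - 1) < \<epsilon> / (2 * c)" "0 < k"
    by (metis (no_types, lifting) eventually_conj eventually_gt_at_top eventually_sequentially order_refl)
  have "real k powr (1/p) = real k * real k powr (1/p - 1)"
    using k by (simp add: powr_diff)
  also have "\<dots> < real k * (\<epsilon> / (2 * c))" using k by (intro mult_strict_left_mono) auto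
  finally have "c * real k powr (1/p) < c * (real k * (\<epsilon> / (2 * c)))" using c by (intro mult_strict_left_mono) auto
  also have "\<dots> = real k * (\<epsilon> / 2)" using c by simp
  finally show False using key[of k] by simp
qed

lemma nb_tail_right_mono:
  assumes "nb (T \<circ> tailop N) \<epsilon>" "N \<le> M" shows "nb (T \<circ> tailop M) \<epsilon>"
proof -
  have "T \<circ> tailop M = (T \<circ> tailop N) \<circ> tailop M" using tail_tail(1)[OF assms(2)] by (simp add: comp_assoc)
  then show ?thesis using nb_comp[OF assms(1) nb_tail[of M]] by simp
qed

lemma nb_tail_left_mono:
  assumes "nb (tailop N \<circ> T) \<epsilon>" "N \<le> M" shows "nb (tailop M \<circ> T) \<epsilon>"
proof -
  have "tailop M \<circ> T = tailop M \<circ> (tailop N \<circ> T)" using tail_tail(2)[OF assms(2)] by (simp add: comp_assoc[symmetric])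
  then show ?thesis using nb_comp[OF nb_tail[of M] assms(1)] by simp
qed

lemma nm_cut_tendsto:
  assumes "\<And>n. u n \<in> L" "\<And>k. (\<lambda>n. u n k) \<longlonglongrightarrow> 0"
  shows "(\<lambda>n. nm (cut N (u n))) \<longlonglongrightarrow> 0"
proof -
  have "nm (cut N (u n)) powr p = (\<Sum>k<N. cmod (u n k) powr p)" for n
  proof -
    have "nm (cut N (u n)) powr p = (\<Sum>k. cmod (cut N (u n) k) powr p)"
      by (rule nm_powr[OF bop_lp[OF cut_bop assms(1)]])
    also have "\<dots> = (\<Sum>k<N. cmod (cut N (u n) k) powr p)"
      by (rule suminf_finite) (auto simp: cut_apply assms(1))
    finally show ?thesis by (simp add: cut_apply assms(1))
  qed
  then have "nm (cut N (u n)) = (\<Sum>k<N. cmod (u n k) powr p) powr (1/p)" for n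
    using powr_powr[of "nm (cut N (u n))" p "1/p"] by simp
  moreover have "(\<lambda>n. (\<Sum>k<N. cmod (u n k) powr p) powr (1/p)) \<longlonglongrightarrow> (\<Sum>k<N. cmod 0 powr p) powr (1/p)"
    by (intro tendsto_powr2 tendsto_sum tendsto_norm assms(2) tendsto_const) (auto intro!: sum_nonneg eventuallyI)
  ultimately show ?thesis by simp
qed

text \<open>With \<open>kop_tail_right\<close> this characterises compactness by tails on the right.
  Coordinatewise convergence on the unit ball suffices, since finitely many coordinates converge in
  norm and the tail is uniformly small.\<close>

lemma kopI_tail:
  assumes T: "T \<in> bop p" and tl: "\<And>\<epsilon>. 0 < \<epsilon> \<Longrightarrow> \<exists>N. nb (T \<circ> tailop N) \<epsilon>"
  shows "T \<in> kop p"
  unfolding kop_def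
proof (intro CollectI conjI T allI impI)
  fix xs :: "nat \<Rightarrow> lpvec" assume "\<forall>n. xs n \<in> L \<and> nm (xs n) \<le> 1"
  then have xs: "\<And>n. xs n \<in> L" "\<And>n. nm (xs n) \<le> 1" by auto
  have bd: "cmod (xs n k) \<le> 1" for n k using cmod_le_nm[OF xs(1)] xs(2) by (rule order_trans)
  \<comment> \<open>A diagonal argument over the coordinates; the limit stays in the unit ball by
    \<open>lp_coordinate_limit\<close>.\<close>
  obtain r where r: "strict_mono (r :: nat \<Rightarrow> nat)" "\<And>k. k \<in> UNIV \<Longrightarrow> \<exists>l. (\<lambda>n. xs (r n) k) \<longlonglongrightarrow> l"
    by (rule function_convergent_subsequence[of "UNIV :: nat set" xs 1]) (auto simp: bd)
  then obtain y where y: "\<And>k. (\<lambda>n. xs (r n) k) \<longlonglongrightarrow> y k" by (metis UNIV_I)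
  have yL: "y \<in> L" "nm y \<le> 1"
    using lp_coordinate_limit[of "\<lambda>n. xs (r n)" 1 y] xs y by auto
  define u where "u n = xs (r n) - y" for n
  have u: "u n \<in> L" "nm (u n) \<le> 2" for n
    using lp_diff[OF xs(1) yL(1), of "r n"] xs(2)[of "r n"] yL(2) by (auto simp: u_def)
  have u0: "(\<lambda>n. u n k) \<longlonglongrightarrow> 0" for k
    using tendsto_diff[OF y[of k] tendsto_const[of "y k"]] by (simp add: u_def)
  obtain c where c: "nb T c" "0 < c" using bop_nb[OF T] .
  have "(\<lambda>n. nm (T (u n))) \<longlonglongrightarrow> 0"
  proof (rule LIMSEQ_I)
    fix e :: real assume e: "0 < e"
    obtain N where N: "nb (T \<circ> tailop N) (e / 4)" using tl[of "e/4"] e by auto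
    have "(\<lambda>n. c * nm (cut N (u n))) \<longlonglongrightarrow> c * 0"
      by (intro tendsto_intros nm_cut_tendsto u u0)
    then have "\<forall>\<^sub>F n in sequentially. c * nm (cut N (u n)) < e / 2" using e by (intro order_tendstoD) auto
    then obtain n0 where n0: "\<And>n. n \<ge> n0 \<Longrightarrow> c * nm (cut N (u n)) < e / 2" by (auto simp: eventually_sequentially)
    have "norm (nm (T (u n)) - 0) < e" if "n \<ge> n0" for n
    proof -
      have Lc: "cut N (u n) \<in> L" "tailop N (u n) \<in> L" by (rule bop_lp[OF cut_bop u(1)], rule bop_lp[OF tail_bop u(1)])
      have "T (u n) = T (cut N (u n)) + T (tailop N (u n))" using cut_tail_split[OF u(1)] bop_add[OF T Lc] by metis
      then have "nm (T (u n)) \<le> nm (T (cut N (u n))) + nm (T (tailop N (u n)))"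
        using lp_add(2)[OF bop_lp[OF T Lc(1)] bop_lp[OF T Lc(2)]] by simp
      also have "nm (T (cut N (u n))) \<le> c * nm (cut N (u n))" by (rule nbD(3)[OF c(1) Lc(1)])
      also have "nm (T (tailop N (u n))) \<le> e / 4 * 2" using nb_bounded[OF N u(1) u(2), of n] by simp
      finally show ?thesis using n0[OF that] by simp
    qed
    then show "\<exists>n0. \<forall>n\<ge>n0. norm (nm (T (u n)) - 0) < e" by blast
  qed
  moreover have "T (u n) = T (xs (r n)) - T y" for n unfolding u_def by (rule bop_diff[OF T xs(1) yL(1)])
  ultimately show "\<exists>r y. strict_mono r \<and> y \<in> L \<and> (\<lambda>n. nm (T (xs (r n)) - y)) \<longlonglongrightarrow> 0"
    using r(1) bop_lp[OF T yL(1)] by auto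
qed

text \<open>Otherwise there are unit ball vectors z N whose image has a large tail beyond N. A
  subsequence of the images converges to some y, and the tails of the single vector y tend to
  0.\<close>

lemma kop_tail_left:
  assumes T: "T \<in> kop p" and e: "0 < \<epsilon>"
  shows "\<exists>N. nb (tailop N \<circ> T) \<epsilon>"
proof (rule ccontr)
  assume "\<not> ?thesis"
  then have no: "\<not> nb (tailop N \<circ> T) \<epsilon>" for N by simp
  have Tb: "T \<in> bop p" by (rule kop_bop[OF T])
  have "\<exists>z. z \<in> L \<and> nm z \<le> 1 \<and> \<epsilon> < nm (tailop N (T z))" for N
  proof -
    have TT: "tailop N \<circ> T \<in> bop p" using Tb by simp
    have "\<not> op_norm p (tailop N \<circ> T) \<le> \<epsilon>" using no[of N] nb_op_norm[OF TT] nb_mono by blast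
    then have "\<exists>v\<in>{nm ((tailop N \<circ> T) x) |x. x \<in> L \<and> nm x \<le> 1}. \<epsilon> < v"
      unfolding op_norm_def not_le by (intro less_cSupD) (auto intro!: exI[of _ 0])
    then show ?thesis by auto
  qed
  then obtain z where z: "\<And>N. z N \<in> L" "\<And>N. nm (z N) \<le> 1" "\<And>N. \<epsilon> < nm (tailop N (T (z N)))" by metis
  obtain r y where r: "strict_mono r" and y: "y \<in> L" and lim: "(\<lambda>n. nm (T (z (r n)) - y)) \<longlonglongrightarrow> 0"
    by (rule kopD[OF T, of z]) (auto simp: z)
  have "(\<lambda>n. nm (tailop (r n) y)) \<longlonglongrightarrow> 0"
    using LIMSEQ_subseq_LIMSEQ[OF tail_tendsto[OF y] r] by (simp add: comp_def)
  from tendsto_add[OF this lim] have s: "(\<lambda>n. nm (tailop (r n) y) + nm (T (z (r n)) - y)) \<longlonglongrightarrow> 0" by simp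
  have "\<epsilon> \<le> nm (tailop (r n) y) + nm (T (z (r n)) - y)" for n
  proof -
    have Tz: "T (z (r n)) \<in> L" by (rule bop_lp[OF Tb z(1)])
    have tl: "tailop (r n) w \<in> L" if "w \<in> L" for w by (rule bop_lp[OF tail_bop that])
    have "nm (tailop (r n) (T (z (r n)))) \<le> nm (tailop (r n) y) + nm (tailop (r n) (T (z (r n))) - tailop (r n) y)"
      by (rule nm_triangle3[OF tl[OF Tz] tl[OF y]])
    also have "tailop (r n) (T (z (r n))) - tailop (r n) y = tailop (r n) (T (z (r n)) - y)"
      by (rule bop_diff[OF tail_bop Tz y, symmetric])
    also have "nm \<dots> \<le> nm (T (z (r n)) - y)" using nbD(3)[OF nb_tail lp_diff(1)[OF Tz y]] by simp
    finally show ?thesis using z(3)[of "r n"] by simp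
  qed
  with s have "\<epsilon> \<le> 0" by (auto intro: LIMSEQ_le_const)
  then show False using e by simp
qed

lemma kop_add: assumes "S \<in> kop p" "T \<in> kop p" shows "S + T \<in> kop p"
proof (rule kopI_tail)
  show "S + T \<in> bop p" using assms kop_bop by simp
  fix \<epsilon> :: real assume "0 < \<epsilon>"
  then obtain N M where "nb (S \<circ> tailop N) (\<epsilon>/2)" "nb (T \<circ> tailop M) (\<epsilon>/2)"
    using kop_tail_right[OF assms(1), of "\<epsilon>/2"] kop_tail_right[OF assms(2), of "\<epsilon>/2"] by auto
  then have "nb (S \<circ> tailop (max N M)) (\<epsilon>/2)" "nb (T \<circ> tailop (max N M)) (\<epsilon>/2)"
    by (auto intro: nb_tail_right_mono)
  from nb_add[OF this] have "nb ((S + T) \<circ> tailop (max N M)) \<epsilon>" by (simp add: comp_add_left)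
  then show "\<exists>N. nb ((S + T) \<circ> tailop N) \<epsilon>" ..
qed

lemma kop_comp_left: assumes "T \<in> kop p" "S \<in> bop p" shows "S \<circ> T \<in> kop p"
proof (rule kopI_tail)
  show "S \<circ> T \<in> bop p" using assms kop_bop by simp
  fix \<epsilon> :: real assume e: "0 < \<epsilon>"
  obtain c where c: "nb S c" "0 < c" using bop_nb[OF assms(2)] .
  then obtain N where N: "nb (T \<circ> tailop N) (\<epsilon>/c)"
    using kop_tail_right[OF assms(1), of "\<epsilon>/c"] e by auto
  show "\<exists>N. nb ((S \<circ> T) \<circ> tailop N) \<epsilon>"
    using nb_comp[OF c(1) N] c(2) by (auto simp: comp_assoc)
qed

lemma kop_scale: assumes "T \<in> kop p" shows "op_scale a T \<in> kop p"
proof -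
  have "op_scale a T = op_scale a (op_one p) \<circ> T"
    using kop_bop[OF assms] by (simp add: comp_scale_left one_comp)
  then show ?thesis using kop_comp_left[OF assms, of "op_scale a (op_one p)"] one_bop by simp
qed

lemma kop_uminus: "T \<in> kop p \<Longrightarrow> - T \<in> kop p"
  using kop_scale[of T "-1"] by (simp add: op_scale_minus_one)

lemma kop_diff: "S \<in> kop p \<Longrightarrow> T \<in> kop p \<Longrightarrow> S - T \<in> kop p"
  using kop_add[of S "- T"] kop_uminus[of T] by simp

lemma kop_zero: "0 \<in> kop p"
proof -
  have "(0 :: lpop) \<circ> T = 0" for T :: lpop by (auto simp: fun_eq_iff)
  then show ?thesis by (intro kopI_tail) (auto intro: nb_zero)
qed

lemma kop_sum: "(\<And>i. i \<in> I \<Longrightarrow> T i \<in> kop p) \<Longrightarrow> sum T I \<in> kop p"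
proof (induction I rule: infinite_finite_induct)
  case (insert i I)
  then show ?case by (simp only: sum.insert not_False_eq_True) (simp only: kop_add insert_iff simp_thms)
qed (simp_all only: sum.infinite sum.empty kop_zero not_False_eq_True)

text \<open>Tails are of no help here, because S does not respect them. The definition by sequences
  is used instead: the vectors S (xs n), scaled by 1/c, stay in the unit ball.\<close>

lemma kop_comp_right: assumes "T \<in> kop p" "S \<in> bop p" shows "T \<circ> S \<in> kop p"
proof -
  have Tb: "T \<in> bop p" by (rule kop_bop[OF assms(1)])
  obtain c where c: "nb S c" "0 < c" using bop_nb[OF assms(2)] .
  show ?thesis unfolding kop_def
  proof (intro CollectI conjI allI impI)
    show "T \<circ> S \<in> bop p" using assms Tb by simp
    fix xs :: "nat \<Rightarrow> lpvec" assume xs: "\<forall>n. xs n \<in> L \<and> nm (xs n) \<le> 1"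
    have Sx: "S (xs n) \<in> L" "nm (S (xs n)) \<le> c" for n
      using bop_lp[OF assms(2)] xs nb_bounded[OF c(1), of "xs n" 1] by auto
    define w where "w n = vscale (of_real (1/c)) (S (xs n))" for n
    have w: "w n \<in> L" "nm (w n) \<le> 1" for n
      using lp_scale[OF Sx(1), of "of_real (1/c)" n] Sx(2)[of n] c(2) by (auto simp: w_def norm_divide)
    obtain r y where r: "strict_mono (r :: nat \<Rightarrow> nat)" and y: "y \<in> L" and lim: "(\<lambda>n. nm (T (w (r n)) - y)) \<longlonglongrightarrow> 0"
      by (rule kopD[OF assms(1), of w]) (auto simp: w)
    have "nm ((T \<circ> S) (xs n) - vscale (of_real c) y) = c * nm (T (w n) - y)" for n
    proof -
      have "(T \<circ> S) (xs n) - vscale (of_real c) y = vscale (of_real c) (T (w n) - y)"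
        using c(2) unfolding w_def bop_scale[OF Tb Sx(1)] by (auto simp: vscale_def fun_eq_iff algebra_simps)
      then show ?thesis using lp_scale(2)[OF lp_diff(1)[OF bop_lp[OF Tb w(1)] y], of "of_real c" n] c(2) by simp
    qed
    then have "(\<lambda>n. nm ((T \<circ> S) (xs (r n)) - vscale (of_real c) y)) \<longlonglongrightarrow> 0"
      using tendsto_mult_right_zero[OF lim, of c] by simp
    then show "\<exists>r y. strict_mono r \<and> y \<in> L \<and> (\<lambda>n. nm ((T \<circ> S) (xs (r n)) - y)) \<longlonglongrightarrow> 0"
      using r lp_scale(1)[OF y] by blast
  qed
qed

lemma kop_closed:
  assumes T: "T \<in> bop p" and a: "\<And>\<epsilon>. 0 < \<epsilon> \<Longrightarrow> \<exists>K\<in>kop p. nb (T - K) \<epsilon>"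
  shows "T \<in> kop p"
proof (rule kopI_tail[OF T])
  fix \<epsilon> :: real assume e: "0 < \<epsilon>"
  then obtain K where K: "K \<in> kop p" "nb (T - K) (\<epsilon>/2)" using a[of "\<epsilon>/2"] by auto
  obtain N where N: "nb (K \<circ> tailop N) (\<epsilon>/2)" using kop_tail_right[OF K(1), of "\<epsilon>/2"] e by auto
  have "T \<circ> tailop N = ((T - K) \<circ> tailop N) + (K \<circ> tailop N)" by (simp add: comp_add_left)
  then have "nb (T \<circ> tailop N) (\<epsilon>/2 * 1 + \<epsilon>/2)" using nb_add[OF nb_comp[OF K(2) nb_tail] N] by simp
  then show "\<exists>N. nb (T \<circ> tailop N) \<epsilon>" by auto
qed

lemma finite_mulop_kop:
  assumes "\<And>n. N \<le> n \<Longrightarrow> g n = 0"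
  shows "mulop g \<in> kop p"
proof (rule kopI_tail)
  have "cmod (g n) \<le> (\<Sum>k<N. cmod (g k))" for n
    by (cases "n < N") (auto simp: assms sum_nonneg intro!: member_le_sum[of n "{..<N}" "\<lambda>k. cmod (g k)"])
  from nb_mulop[OF this] show "mulop g \<in> bop p" by (rule nbD)
  have "mulop g \<circ> tailop N = mulop (\<lambda>n. g n * (if n < N then 0 else 1))"
    unfolding tailop_def by (rule mulop_comp[where c = 1]) auto
  also have "\<dots> = 0" using assms by (auto simp: mulop_def fun_eq_iff not_less)
  finally show "\<exists>N. nb (mulop g \<circ> tailop N) \<epsilon>" if "0 < \<epsilon>" for \<epsilon> using that nb_zero[of \<epsilon>] by (metis less_imp_le)
qed

lemma cut_kop: "cut N \<in> kop p"
  unfolding cut_def by (rule finite_mulop_kop[of N]) auto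

end

section \<open>Quasicentral cutoffs\<close>

text \<open>A path in the plane from 0 to 1 that avoids \<open>1/2\<close>, so that \<open>\<gamma> + (1 - \<gamma>) \<sigma>\<close> stays invertible for
  every involution \<open>\<sigma>\<close> when \<open>\<gamma>\<close> moves along it.\<close>

definition detour :: "real \<Rightarrow> complex" where
  "detour t = Complex t (2 * t * (1 - t))"

lemma detour_ends: "detour 0 = 0" "detour 1 = 1"
  by (auto simp: detour_def complex_eq_iff)

text \<open>The divided difference of the path has real part 1 and imaginary part 2 (1 - s - t),
  which is at most 2 in modulus.\<close>

lemma detour_lipschitz:
  assumes "0 \<le> s" "s \<le> 1" "0 \<le> t" "t \<le> 1"
  shows "cmod (detour s - detour t) \<le> 3 * \<bar>s - t\<bar>"
proof -
  have "detour s - detour t = of_real (s - t) * Complex 1 (2 * (1 - s - t))"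
    by (auto simp: detour_def complex_eq_iff algebra_simps)
  moreover have "cmod (Complex 1 (2 * (1 - s - t))) \<le> 3"
    using cmod_le[of "Complex 1 (2 * (1 - s - t))"] assms by auto
  ultimately show ?thesis
    by (simp only: norm_mult norm_of_real) (simp only: mult.commute[of 3] mult_left_mono abs_ge_zero)
qed

lemma detour_norm: "0 \<le> t \<Longrightarrow> t \<le> 1 \<Longrightarrow> cmod (detour t) \<le> 3"
  using detour_lipschitz[of t 0] by (simp add: detour_ends)

lemma detour_avoids_half: "1/2 \<le> cmod (2 * detour t - 1)"
proof -
  have "(1/2)\<^sup>2 \<le> (2 * t - 1)\<^sup>2 + (4 * t * (1 - t))\<^sup>2"
  proof -
    \<comment> \<open>With u = 4 t (1 - t) the first square is 1 - u, so the sum is u^2 - u + 1,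
      that is the square of u - 1/2 plus 3/4.\<close>
    have "(2 * t - 1)\<^sup>2 + (4 * t * (1 - t))\<^sup>2 - 1/4 = (4 * t * (1 - t) - 1/2)\<^sup>2 + 1/2"
      by (simp add: power2_eq_square algebra_simps)
    moreover have "(1/2)\<^sup>2 = (1/4 :: real)" by (simp add: power2_eq_square)
    ultimately show ?thesis using zero_le_power2[of "4 * t * (1 - t) - 1/2"] by linarith
  qed
  also have "\<dots> = (cmod (2 * detour t - 1))\<^sup>2"
    by (simp add: cmod_power2 detour_def power_mult_distrib)
  finally show ?thesis by (rule power2_le_imp_le) simp
qed

context lp_space
begin

text \<open>Only the ranges are disjoint here, so in contrast to \<open>nb_sum_disjoint\<close> a
  factor remains. For q pieces of size O(1/q) it is harmless because 1/p < 1.\<close>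

lemma nb_sum_disjoint_range:
  assumes "finite I" "\<And>i. i \<in> I \<Longrightarrow> nb (A i) c" "0 \<le> c"
    "\<And>i j. i \<in> I \<Longrightarrow> j \<in> I \<Longrightarrow> i \<noteq> j \<Longrightarrow> Z i \<inter> Z j = {}"
    "\<And>i x n. i \<in> I \<Longrightarrow> x \<in> L \<Longrightarrow> n \<notin> Z i \<Longrightarrow> A i x n = 0"
  shows "nb (sum A I) (real (card I) powr (1 / p) * c)"
proof (rule nbI_bop)
  have A: "A i \<in> bop p" if "i \<in> I" for i using assms(2)[OF that] by (rule nbD)
  show "sum A I \<in> bop p" using A by (rule bop_sum_closed)
  show "0 \<le> real (card I) powr (1 / p) * c" using assms(3) by simp
  fix x assume x: "x \<in> L"
  have "nm (\<Sum>i\<in>I. A i x) \<le> real (card I) powr (1 / p) * (c * nm x)"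
  proof (rule nm_sum_disjoint_le[OF assms(1)])
    fix i j n assume "i \<in> I" "j \<in> I" "i \<noteq> j"
    then show "A i x n = 0 \<or> A j x n = 0"
      using assms(4)[of i j] assms(5)[of i x n] assms(5)[of j x n] x by blast
  qed (use assms(3) nbD(3)[OF assms(2) x] bop_lp[OF A x] in auto)
  then show "nm (sum A I x) \<le> real (card I) powr (1 / p) * c * nm x" by (simp add: sum_fun_at mult.assoc)
qed

text \<open>\<open>cut k\<close> is compact, hence so are its products with T on either side, and
  the tails of these are eventually small. Iteration makes a finite set of operators almost block
  tridiagonal.\<close>

lemma next_cutoff:
  assumes F: "finite F" "F \<subseteq> bop p" and d: "0 < \<delta>"
  shows "\<exists>k'>k. \<forall>T\<in>F. nb (cut k \<circ> T \<circ> tailop k') \<delta> \<and> nb (tailop k' \<circ> T \<circ> cut k) \<delta>"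
proof -
  have "\<forall>\<^sub>F k' in sequentially. \<forall>T\<in>F. nb (cut k \<circ> T \<circ> tailop k') \<delta> \<and> nb (tailop k' \<circ> T \<circ> cut k) \<delta>"
  proof (rule eventually_ball_finite[OF F(1)], rule ballI)
    fix T assume "T \<in> F"
    then have T: "T \<in> bop p" using F by auto
    have "cut k \<circ> T \<in> kop p" "T \<circ> cut k \<in> kop p" using kop_comp_right[OF cut_kop T] kop_comp_left[OF cut_kop T] by auto
    then obtain N M where "nb (cut k \<circ> T \<circ> tailop N) \<delta>" "nb (tailop M \<circ> (T \<circ> cut k)) \<delta>"
      using kop_tail_right[OF _ d] kop_tail_left[OF _ d] by metis
    then have "nb (cut k \<circ> T \<circ> tailop k') \<delta> \<and> nb (tailop k' \<circ> T \<circ> cut k) \<delta>" if "k' \<ge> max N M" for k'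
      using nb_tail_right_mono[of "cut k \<circ> T" N \<delta> k'] nb_tail_left_mono[of M "T \<circ> cut k" \<delta> k'] that by (auto simp: comp_assoc)
    then show "\<forall>\<^sub>F k' in sequentially. nb (cut k \<circ> T \<circ> tailop k') \<delta> \<and> nb (tailop k' \<circ> T \<circ> cut k) \<delta>"
      unfolding eventually_sequentially by blast
  qed
  with eventually_gt_at_top[of k] have "\<forall>\<^sub>F k' in sequentially. k < k' \<and> (\<forall>T\<in>F. nb (cut k \<circ> T \<circ> tailop k') \<delta> \<and> nb (tailop k' \<circ> T \<circ> cut k) \<delta>)"
    by (rule eventually_conj)
  then show ?thesis by (auto simp: eventually_sequentially)
qed

lemma finite_bop_bound:
  assumes "finite F" "F \<subseteq> bop p" obtains C where "0 < C" "\<And>T. T \<in> F \<Longrightarrow> nb T C"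
proof -
  have "\<exists>C>0. \<forall>T\<in>F. nb T C"
    using assms
  proof (induction F)
    case (insert T F)
    then obtain C where C: "0 < C" "\<forall>T\<in>F. nb T C" by auto
    have "T \<in> bop p" using insert by simp
    then obtain c where "nb T c" using bop_nb by metis
    then show ?case using C by (intro exI[of _ "max C c"]) (auto intro: nb_mono)
  qed (auto intro: exI[of _ 1])
  then show ?thesis using that by blast
qed

text \<open>The cutoff decreases in \<open>q\<close> equal steps along coordinates \<open>m i\<close> spaced so widely that all operators are almost
  block tridiagonal. The commutator is then a sum of \<open>q\<close> pieces of size \<open>O(1/q)\<close> with disjoint
  ranges, hence of norm \<open>O(q powr (1/p - 1))\<close>.\<close>

lemma quasicentral_cutoff:
  assumes F: "finite F" "F \<subseteq> bop p" and d: "0 < \<delta>"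
  obtains n' \<gamma> where "n < n'" "\<And>l. l < n \<Longrightarrow> \<gamma> l = 1" "\<And>l. n' \<le> l \<Longrightarrow> \<gamma> l = 0"
    "\<And>l. \<exists>t. 0 \<le> t \<and> t \<le> 1 \<and> \<gamma> l = detour t"
    "\<And>T. T \<in> F \<Longrightarrow> nb ((mulop \<gamma> \<circ> T) - (T \<circ> mulop \<gamma>)) \<delta>"
proof -
  obtain C where C: "0 < C" "\<And>T. T \<in> F \<Longrightarrow> nb T C" using finite_bop_bound[OF F] by metis
  have "(\<lambda>k. real k powr (1/p - 1)) \<longlonglongrightarrow> 0"
    using p_gt_1 by (intro tendsto_neg_powr filterlim_real_sequentially) (auto simp: field_simps)
  then have "\<forall>\<^sub>F k in sequentially. real k powr (1/p - 1) < \<delta> / (12 * C)"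
    using d C by (intro order_tendstoD) auto
  \<comment> \<open>The 12 is 3, the Lipschitz constant of \<open>detour\<close>, times 4, the
    number of sums into which the commutator is split.\<close>
  then obtain q where q: "real q powr (1/p - 1) < \<delta> / (12 * C)" "0 < q"
    by (metis (no_types, lifting) eventually_conj eventually_gt_at_top eventually_sequentially order_refl)
  have qest: "real q powr (1/p) * (3 / real q * C) \<le> \<delta> / 4"
  proof -
    have "real q powr (1/p) * (3 / real q * C) = 3 * C * real q powr (1/p - 1)"
      using q by (simp add: powr_diff)
    also have "\<dots> \<le> 3 * C * (\<delta> / (12 * C))" using q C by (intro mult_left_mono) auto
    also have "\<dots> = \<delta> / 4" using C by simp
    finally show ?thesis .
  qed
  obtain nx where nx: "\<And>k. k < nx k" "\<And>k T. T \<in> F \<Longrightarrow> nb (cut k \<circ> T \<circ> tailop (nx k)) (\<delta>/12)"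
      "\<And>k T. T \<in> F \<Longrightarrow> nb (tailop (nx k) \<circ> T \<circ> cut k) (\<delta>/12)"
    using next_cutoff[OF F, of "\<delta>/12"] d by (metis zero_less_divide_iff zero_less_numeral)
  define m where "m i = (nx ^^ i) (Suc n)" for i
  have m0: "m 0 = Suc n" and mS: "m (Suc i) = nx (m i)" for i by (auto simp: m_def)
  have mm: "strict_mono m" by (rule strict_mono_Suc_iff[THEN iffD2]) (simp add: mS nx)
  define t where "t i = 1 - real i / real q" for i
  have t: "0 \<le> t i" "t i \<le> 1" if "i \<le> q" for i using that q by (auto simp: t_def)
  define w where "w i = detour (t i) - detour (t (Suc i))" for i
  have w: "cmod (w i) \<le> 3 / real q" if "i < q" for i
  proof -
    have "t i - t (Suc i) = 1 / real q" using q by (simp add: t_def field_simps)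
    then show ?thesis using detour_lipschitz[of "t i" "t (Suc i)"] t[of i] t[of "Suc i"] that by (simp add: w_def)
  qed
  \<comment> \<open>Summation by parts: the staircase is a combination of cutoffs with the
    increments of the path as coefficients, so its commutators reduce to those of each
    \<open>cut (m i)\<close>.\<close>
  define \<gamma> where "\<gamma> l = (\<Sum>i<q. w i * (if l < m i then 1 else 0))" for l
  have tele: "(\<Sum>i=k..<q. w i) = detour (t k)" if "k \<le> q" for k
    using sum_Suc_diff'[OF that, of "\<lambda>i. - detour (t i)"] q by (simp add: w_def t_def detour_ends)
  have \<gamma>v: "\<gamma> l = detour (t k)" if "k \<le> q" "\<And>i. i < q \<Longrightarrow> l < m i \<longleftrightarrow> k \<le> i" for k l
  proof -
    have "\<gamma> l = (\<Sum>i<q. if k \<le> i then w i else 0)" unfolding \<gamma>_def using that(2) by (intro sum.cong) auto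
    also have "\<dots> = (\<Sum>i=k..<q. w i)" by (rule sum.mono_neutral_cong_right) auto
    finally show ?thesis using tele[OF that(1)] by simp
  qed
  show ?thesis
  proof (rule that[of "m q" \<gamma>])
    have "m 0 \<le> m q" using mm by (simp add: strict_mono_less_eq)
    then show "n < m q" using m0 by simp
    show "\<gamma> l = 1" if "l < n" for l
    proof -
      have "l < m i" for i using that m0 strict_mono_less_eq[OF mm, of 0 i] by simp
      then show ?thesis using \<gamma>v[of 0 l] by (simp add: t_def detour_ends)
    qed
    show "\<gamma> l = 0" if "m q \<le> l" for l
    proof -
      have "\<not> l < m i" if "i < q" for i using \<open>m q \<le> l\<close> strict_mono_less[OF mm, of i q] that by simp
      then show ?thesis using \<gamma>v[of q l] q by (simp add: t_def detour_ends)
    qed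
    show "\<exists>s. 0 \<le> s \<and> s \<le> 1 \<and> \<gamma> l = detour s" for l
    proof -
      \<comment> \<open>The number of steps already taken at l; the value q means that the staircase
        has ended.\<close>
      define k where "k = (LEAST i. i = q \<or> l < m i)"
      have k: "k = q \<or> l < m k" unfolding k_def by (rule LeastI[of _ q]) simp
      have kq: "k \<le> q" unfolding k_def by (rule Least_le) simp
      have kl: "\<not> (i = q \<or> l < m i)" if "i < k" for i using not_less_Least that unfolding k_def by blast
      have "l < m i \<longleftrightarrow> k \<le> i" if "i < q" for i
      proof
        assume "l < m i" then show "k \<le> i" using kl[of i] by (auto simp: not_less[symmetric])
      next
        assume "k \<le> i"
        then show "l < m i" using k that strict_mono_less_eq[OF mm, of k i] by auto
      qed
      then have "\<gamma> l = detour (t k)" by (rule \<gamma>v[OF kq])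
      then show ?thesis using t[OF kq] by blast
    qed
    fix T assume T: "T \<in> F"
    then have Tb: "T \<in> bop p" using F by auto
    \<comment> \<open>\<open>cut (m i)\<close> is its last block \<open>D i\<close> plus the remote
      part \<open>E i\<close>, and \<open>tailop (m i)\<close> is the next block
      \<open>D (Suc i)\<close> plus a remote tail. The spacing of m makes pairings with a remote
      part small; pairings with a block have ranges that are disjoint for different i.\<close>
    define D where "D i = mulop (indicator {(if i = 0 then 0 else m (i - 1))..<m i})" for i
    define E where "E i = cut (if i = 0 then 0 else m (i - 1))" for i
    have Dnb: "nb (D i) 1" for i unfolding D_def by (rule nb_mulop) (auto simp: indicator_def)
    have Enb: "nb (E i) 1" for i unfolding E_def by (rule nb_cut)
    have DE: "cut (m i) = D i + E i" for i
      unfolding cut_def D_def E_def mulop_add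
      by (rule arg_cong[of _ _ mulop]) (use strict_mono_less[OF mm, of "i - 1" i] in \<open>auto simp: indicator_def fun_eq_iff\<close>)
    have DT: "tailop (m i) = D (Suc i) + tailop (m (Suc i))" for i
      unfolding tailop_def D_def mulop_add
      by (rule arg_cong[of _ _ mulop]) (use strict_mono_less[OF mm, of i "Suc i"] in \<open>auto simp: indicator_def fun_eq_iff\<close>)
    let ?A = "\<lambda>i. op_scale (w i) (D i \<circ> T \<circ> tailop (m i))"
    let ?E = "\<lambda>i. op_scale (w i) (E i \<circ> T \<circ> tailop (m i))"
    let ?B = "\<lambda>i. op_scale (w i) (D (Suc i) \<circ> T \<circ> cut (m i))"
    let ?H = "\<lambda>i. op_scale (w i) (tailop (m (Suc i)) \<circ> T \<circ> cut (m i))"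
    \<comment> \<open>The commutator of T with a projection c is c T (1 - c) - (1 - c) T c; the left
      factors are then split as above.\<close>
    have pc: "(cut (m i) \<circ> T) x - (T \<circ> cut (m i)) x = (D i \<circ> T \<circ> tailop (m i)) x + (E i \<circ> T \<circ> tailop (m i)) x
        - (D (Suc i) \<circ> T \<circ> cut (m i)) x - (tailop (m (Suc i)) \<circ> T \<circ> cut (m i)) x" if x: "x \<in> L" for x i
    proof -
      have Lc: "cut (m i) x \<in> L" "tailop (m i) x \<in> L" by (rule bop_lp[OF cut_bop x], rule bop_lp[OF tail_bop x])
      have 1: "T x = T (cut (m i) x) + T (tailop (m i) x)" using cut_tail_split[OF x] bop_add[OF Tb Lc] by metis
      have 2: "T (cut (m i) x) = cut (m i) (T (cut (m i) x)) + tailop (m i) (T (cut (m i) x))"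
        by (rule cut_tail_split[OF bop_lp[OF Tb Lc(1)]])
      have 3: "cut (m i) (T x) = cut (m i) (T (cut (m i) x)) + cut (m i) (T (tailop (m i) x))"
        unfolding 1 by (rule bop_add[OF cut_bop bop_lp[OF Tb Lc(1)] bop_lp[OF Tb Lc(2)]])
      have "cut (m i) (T x) - T (cut (m i) x) = cut (m i) (T (tailop (m i) x)) - tailop (m i) (T (cut (m i) x))"
        using 2 3 by (metis add_diff_cancel_left)
      also have "\<dots> = (D i + E i) (T (tailop (m i) x)) - (D (Suc i) + tailop (m (Suc i))) (T (cut (m i) x))"
        by (simp only: DE[symmetric] DT[symmetric])
      finally show ?thesis by (simp add: algebra_simps)
    qed
    have eq: "(mulop \<gamma> \<circ> T) - (T \<circ> mulop \<gamma>) = sum ?A {..<q} + sum ?E {..<q} - sum ?B {..<q} - sum ?H {..<q}"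
      (is "?l = ?r")
    proof (rule bop_ext)
      have \<gamma>bd: "cmod (\<gamma> l) \<le> (\<Sum>i<q. cmod (w i))" for l
        unfolding \<gamma>_def by (rule order_trans[OF norm_sum]) (auto intro!: sum_mono simp: norm_mult)
      have \<gamma>b: "mulop \<gamma> \<in> bop p" by (rule nbD(1)[OF nb_mulop[OF \<gamma>bd]])
      show "?l \<in> bop p" using \<gamma>b Tb by simp
      show "?r \<in> bop p" by (intro bop_closed bop_sum_closed Tb tail_bop cut_bop nbD(1)[OF Dnb] nbD(1)[OF Enb])
      fix x assume x: "x \<in> L"
      have mg: "mulop \<gamma> y = (\<Sum>i<q. vscale (w i) (cut (m i) y))" if "y \<in> L" for y
        using that by (auto simp: mulop_def \<gamma>_def fun_eq_iff sum_fun_at vscale_def cut_apply sum_distrib_right intro!: sum.cong)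
      have cL: "cut (m i) x \<in> L" for i by (rule bop_lp[OF cut_bop x])
      have "T (mulop \<gamma> x) = (\<Sum>i<q. vscale (w i) (T (cut (m i) x)))"
        unfolding mg[OF x] using bop_sum[OF Tb, of "{..<q}" "\<lambda>i. vscale (w i) (cut (m i) x)"]
        by (simp add: lp_scale(1)[OF cL] bop_scale[OF Tb cL])
      then have "?l x = (\<Sum>i<q. vscale (w i) ((cut (m i) \<circ> T) x - (T \<circ> cut (m i)) x))"
        using mg[OF bop_lp[OF Tb x]] by (simp add: sum_subtractf[symmetric] vscale_def fun_eq_iff sum_fun_at right_diff_distrib)
      also have "\<dots> = ?r x"
        unfolding pc[OF x] by (simp add: fun_eq_iff sum_fun_at op_scale_def vscale_def algebra_simps sum.distrib sum_subtractf)
      finally show "?l x = ?r x" .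
    qed
    have z: "mulop (indicator Z) y n = 0" if "n \<notin> Z" for Z y n using that by (auto simp: mulop_def)
    have dj: "{(if i = 0 then 0 else m (i - 1))..<m i} \<inter> {(if j = 0 then 0 else m (j - 1))..<m j} = {}" if "i \<noteq> j" for i j :: nat
    proof -
      have "i < j \<Longrightarrow> m i \<le> m (j - 1)" "j < i \<Longrightarrow> m j \<le> m (i - 1)" using strict_mono_less_eq[OF mm] by auto
      then show ?thesis using that by (cases "i < j") auto
    qed
    have sc: "nb (op_scale (w i) X) (3 / real q * c)" if "i < q" "nb X c" for i X c
      by (rule nb_mono[OF nb_scale[OF that(2)] mult_right_mono[OF w[OF that(1)] nbD(2)[OF that(2)]]])
    have A: "nb (sum ?A {..<q}) (\<delta>/4)"
    proof (rule nb_mono[OF nb_sum_disjoint_range[where Z="\<lambda>i. {(if i = 0 then 0 else m (i - 1))..<m i}"]])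
      show "nb (?A i) (3 / real q * C)" if "i \<in> {..<q}" for i
        using sc[of i, OF _ nb_comp[OF nb_comp[OF Dnb C(2)[OF T]] nb_tail]] that by simp
      show "?A i x k = 0" if "k \<notin> {(if i = 0 then 0 else m (i - 1))..<m i}" for i x k
        using z[OF that] by (simp add: op_scale_def vscale_def D_def)
    qed (use dj C q qest in auto)
    have B: "nb (sum ?B {..<q}) (\<delta>/4)"
    proof (rule nb_mono[OF nb_sum_disjoint_range[where Z="\<lambda>i. {m i..<m (Suc i)}"]])
      show "nb (?B i) (3 / real q * C)" if "i \<in> {..<q}" for i
        using sc[of i, OF _ nb_comp[OF nb_comp[OF Dnb C(2)[OF T]] nb_cut]] that by simp
      show "{m i..<m (Suc i)} \<inter> {m j..<m (Suc j)} = {}" if "i \<noteq> j" for i j using dj[of "Suc i" "Suc j"] that by simp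
      show "?B i x k = 0" if "k \<notin> {m i..<m (Suc i)}" for i x k
        using z[OF that] by (simp add: op_scale_def vscale_def D_def)
    qed (use C q qest in auto)
    have sumd: "(\<Sum>i<q. 3 / real q * (\<delta>/12)) = \<delta>/4" using q by simp
    have "nb (sum ?E {..<q}) (\<Sum>i<q. 3 / real q * (\<delta>/12))"
    proof (rule nb_sum)
      fix i assume "i \<in> {..<q}"
      moreover have "nb (E i \<circ> T \<circ> tailop (m i)) (\<delta>/12)"
      proof (cases i)
        case 0
        have "E i \<circ> T \<circ> tailop (m i) = 0" using 0 by (auto simp: E_def cut_def mulop_def fun_eq_iff)
        then show ?thesis using nb_zero[of "\<delta>/12"] d by simp
      next
        case (Suc j)
        then show ?thesis using nx(2)[OF T, of "m j"] by (simp add: E_def mS)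
      qed
      ultimately show "nb (?E i) (3 / real q * (\<delta>/12))" by (intro sc) auto
    qed
    then have E: "nb (sum ?E {..<q}) (\<delta>/4)" unfolding sumd .
    have "nb (sum ?H {..<q}) (\<Sum>i<q. 3 / real q * (\<delta>/12))"
      by (rule nb_sum, rule sc) (use nx(3)[OF T] in \<open>auto simp: mS\<close>)
    then have H: "nb (sum ?H {..<q}) (\<delta>/4)" unfolding sumd .
    from nb_diff[OF nb_diff[OF nb_add[OF A E] B] H]
    show "nb ((mulop \<gamma> \<circ> T) - (T \<circ> mulop \<gamma>)) \<delta>" unfolding eq by simp
  qed
qed

end

section \<open>Dyadic cycles\<close>

text \<open>Stage \<open>j\<close> cycles through the dyadic points of level \<open>j\<close> in increasing order; passing to the
  next stage inserts the midpoints, which is composition with an involution.\<close>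

definition dy :: "nat \<Rightarrow> rat set" where
  "dy j = {of_nat k / 2 ^ j | k. k \<le> 2 ^ j}"

definition dyc :: "nat \<Rightarrow> rat \<Rightarrow> rat" where
  "dyc j r = (if r \<in> dy j then if r = 1 then 0 else r + 1 / 2 ^ j else r)"

definition dyt :: "nat \<Rightarrow> rat \<Rightarrow> rat" where
  "dyt j r = (if r \<in> dy j \<and> r \<noteq> 1 then r + 1 / 2 ^ Suc j
     else if r - 1 / 2 ^ Suc j \<in> dy j \<and> r - 1 / 2 ^ Suc j \<noteq> 1 then r - 1 / 2 ^ Suc j else r)"

lemma dy_0_1: "0 \<in> dy j" "1 \<in> dy j"
  unfolding dy_def by (auto intro: exI[of _ 0] exI[of _ "2 ^ j"])

lemma dy_bounds: assumes "r \<in> dy j" shows "0 \<le> r" "r \<le> 1"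
  using assms by (auto simp: dy_def)

lemma dy_step: assumes "r \<in> dy j" "r \<noteq> 1" shows "r + 1 / 2 ^ j \<in> dy j"
proof -
  obtain k where k: "r = of_nat k / 2 ^ j" "k \<le> 2 ^ j" using assms by (auto simp: dy_def)
  have "k \<noteq> 2 ^ j" using assms(2) k by auto
  then show ?thesis unfolding dy_def using k by (intro CollectI exI[of _ "Suc k"]) (auto simp: field_simps)
qed

lemma dy_mono: assumes "r \<in> dy j" shows "r \<in> dy (Suc j)"
proof -
  obtain k where "r = of_nat k / 2 ^ j" "k \<le> 2 ^ j" using assms by (auto simp: dy_def)
  then show ?thesis unfolding dy_def by (intro CollectI exI[of _ "2 * k"]) (auto simp: field_simps)
qed

text \<open>Clearing the denominator \<open>2 ^ Suc j\<close> leaves an odd number on one side and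
  an even number on the other.\<close>

lemma dy_mid_notin: assumes "r \<in> dy j" shows "r + 1 / 2 ^ Suc j \<notin> dy j"
proof
  assume "r + 1 / 2 ^ Suc j \<in> dy j"
  then obtain k l where "r = of_nat k / 2 ^ j" "r + 1 / 2 ^ Suc j = of_nat l / (2 ^ j :: rat)"
    using assms by (auto simp: dy_def)
  then have "(of_nat k / 2 ^ j + 1 / 2 ^ Suc j) * 2 ^ Suc j = (of_nat l / 2 ^ j * 2 ^ Suc j :: rat)" by simp
  moreover have "(of_nat k / 2 ^ j + 1 / 2 ^ Suc j) * 2 ^ Suc j = (of_nat (2 * k + 1) :: rat)" by (simp add: distrib_right)
  moreover have "of_nat l / 2 ^ j * 2 ^ Suc j = (of_nat (2 * l) :: rat)" by simp
  ultimately have "of_nat (2 * k + 1) = (of_nat (2 * l) :: rat)" by argo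
  then have "2 * k + 1 = 2 * l" by (simp only: of_nat_eq_iff)
  then show False by presburger
qed

lemma dy_mid_in: assumes "r \<in> dy j" "r \<noteq> 1" shows "r + 1 / 2 ^ Suc j \<in> dy (Suc j)"
proof -
  obtain k where k: "r = of_nat k / 2 ^ j" "k \<le> 2 ^ j" using assms by (auto simp: dy_def)
  have "k \<noteq> 2 ^ j" using assms(2) k by auto
  then show ?thesis unfolding dy_def using k by (intro CollectI exI[of _ "2 * k + 1"]) (auto simp: field_simps)
qed

lemma dy_Suc_cases: assumes "r \<in> dy (Suc j)" "r \<notin> dy j" shows "r - 1 / 2 ^ Suc j \<in> dy j" "r - 1 / 2 ^ Suc j \<noteq> 1"
proof -
  obtain k where k: "r = of_nat k / 2 ^ Suc j" "k \<le> 2 ^ Suc j" using assms(1) by (auto simp: dy_def)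
  have "odd k"
  proof
    assume "even k"
    then obtain l where "k = 2 * l" by auto
    then have "r \<in> dy j" using k unfolding dy_def by (intro CollectI exI[of _ l]) auto
    then show False using assms(2) by simp
  qed
  then obtain l where l: "k = 2 * l + 1" by (elim oddE)
  then show "r - 1 / 2 ^ Suc j \<in> dy j" using k unfolding dy_def by (intro CollectI exI[of _ l]) (auto simp: field_simps)
  have "r \<le> 1" using dy_bounds assms(1) by blast
  moreover have "(0::rat) < 1 / 2 ^ Suc j" by simp
  ultimately show "r - 1 / 2 ^ Suc j \<noteq> 1" by linarith
qed

lemma dyc_simps:
  "r \<in> dy j \<Longrightarrow> r \<noteq> 1 \<Longrightarrow> dyc j r = r + 1 / 2 ^ j" "dyc j 1 = 0" "r \<notin> dy j \<Longrightarrow> dyc j r = r"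
  by (simp_all only: dyc_def dy_0_1 if_True if_False simp_thms)

lemma dyt_simps:
  "r \<in> dy j \<Longrightarrow> r \<noteq> 1 \<Longrightarrow> dyt j r = r + 1 / 2 ^ Suc j"
  "r \<notin> dy j \<Longrightarrow> r - 1 / 2 ^ Suc j \<in> dy j \<and> r - 1 / 2 ^ Suc j \<noteq> 1 \<Longrightarrow> dyt j r = r - 1 / 2 ^ Suc j"
  "\<not> (r \<in> dy j \<and> r \<noteq> 1) \<Longrightarrow> \<not> (r - 1 / 2 ^ Suc j \<in> dy j \<and> r - 1 / 2 ^ Suc j \<noteq> 1) \<Longrightarrow> dyt j r = r"
  by (simp_all only: dyt_def simp_thms if_True if_False)

lemma dy_before_one: "1 - 1 / 2 ^ Suc j \<notin> dy j"
proof
  assume "1 - 1 / 2 ^ Suc j \<in> dy j"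
  from dy_mid_notin[OF this] show False using dy_0_1(2)[of j] by (simp only: diff_add_cancel simp_thms)
qed

lemma dyt_invol: "dyt j (dyt j r) = r"
proof (cases "r \<in> dy j \<and> r \<noteq> 1")
  case True
  have "dyt j (r + 1 / 2 ^ Suc j) = r + 1 / 2 ^ Suc j - 1 / 2 ^ Suc j"
    by (rule dyt_simps(2)) (use True dy_mid_notin[of r j] in \<open>simp_all only: add_diff_cancel_right' simp_thms\<close>)
  then show ?thesis using dyt_simps(1)[of r j] True by (simp only: add_diff_cancel_right' simp_thms)
next
  case False
  show ?thesis
  proof (cases "r - 1 / 2 ^ Suc j \<in> dy j \<and> r - 1 / 2 ^ Suc j \<noteq> 1")
    case True
    then have "r \<notin> dy j" using False dy_before_one[of j] by blast
    then have "dyt j r = r - 1 / 2 ^ Suc j" using True by (rule dyt_simps(2))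
    moreover have "dyt j (r - 1 / 2 ^ Suc j) = r - 1 / 2 ^ Suc j + 1 / 2 ^ Suc j" using True by (intro dyt_simps(1)) auto
    ultimately show ?thesis by (simp only: diff_add_cancel)
  next
    case F2: False
    then have "dyt j r = r" by (rule dyt_simps(3)[OF False])
    then show ?thesis by simp
  qed
qed

text \<open>The involution sends r to the midpoint on its right, which \<open>dyc j\<close> fixes,
  and sends that midpoint to r, which \<open>dyc j\<close> moves on to \<open>r + 1 / 2 ^ j\<close>.
  So the midpoint is inserted into the cycle between the two.\<close>

lemma dyc_Suc: "dyc (Suc j) = dyc j \<circ> dyt j"
proof
  fix r
  have h: "1 / 2 ^ j = 1 / 2 ^ Suc j + (1 / 2 ^ Suc j :: rat)" by simp
  have "dyc (Suc j) r = dyc j (dyt j r)"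
  proof (cases "r \<in> dy j")
    case True
    show ?thesis
    proof (cases "r = 1")
      case r1: True
      have "dyt j r = r" by (rule dyt_simps(3)) (use r1 dy_before_one[of j] in blast)+
      then show ?thesis using r1 by (simp only: dyc_simps(2))
    next
      case False
      have "dyt j r = r + 1 / 2 ^ Suc j" by (rule dyt_simps(1)[OF True False])
      then show ?thesis using dyc_simps(3)[OF dy_mid_notin[OF True]] dyc_simps(1)[OF dy_mono[OF True] False] by metis
    qed
  next
    case False
    then have r1: "r \<noteq> 1" using dy_0_1 by auto
    show ?thesis
    proof (cases "r - 1 / 2 ^ Suc j \<in> dy j \<and> r - 1 / 2 ^ Suc j \<noteq> 1")
      case True
      have 1: "dyt j r = r - 1 / 2 ^ Suc j" by (rule dyt_simps(2)[OF False True])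
      have "r - 1 / 2 ^ Suc j + 1 / 2 ^ Suc j \<in> dy (Suc j)" using True by (intro dy_mid_in) auto
      then have "r \<in> dy (Suc j)" by (simp only: diff_add_cancel)
      then have "dyc (Suc j) r = r + 1 / 2 ^ Suc j" using r1 by (rule dyc_simps(1))
      moreover have "dyc j (r - 1 / 2 ^ Suc j) = r - 1 / 2 ^ Suc j + 1 / 2 ^ j" using True by (intro dyc_simps(1)) auto
      ultimately show ?thesis unfolding 1 using h by linarith
    next
      case F2: False
      have "dyt j r = r" by (rule dyt_simps(3)) (use False F2 in blast)+
      moreover have "r \<notin> dy (Suc j)" using dy_Suc_cases[of r j] F2 False by blast
      ultimately show ?thesis using False by (metis dyc_simps(3))
    qed
  qed
  then show "dyc (Suc j) r = (dyc j \<circ> dyt j) r" by simp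
qed

text \<open>Level 0 exchanges 0 and 1, and every later level arises by composing with an involution;
  no explicit inverse is required.\<close>

lemma bij_dyc: "bij (dyc j)"
proof (induction j)
  case 0
  have in0: "r = 0 \<or> r = 1" if "r \<in> dy 0" for r
  proof -
    obtain k :: nat where k: "r = of_nat k / 2 ^ 0" "k \<le> 2 ^ 0" using \<open>r \<in> dy 0\<close> unfolding dy_def by blast
    then have "k = 0 \<or> k = 1" by (simp add: le_Suc_eq)
    then show ?thesis using k(1) by (elim disjE) simp_all
  qed
  have d01: "dyc 0 0 = 1" "dyc 0 1 = 0" using dy_0_1[of 0] by (simp_all add: dyc_def)
  have "dyc 0 (dyc 0 r) = r" for r
    by (cases "r \<in> dy 0") (use in0[of r] d01 in \<open>auto simp: dyc_def[of 0 r]\<close>)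
  then show ?case by (intro o_bij[of "dyc 0"]) (simp_all add: fun_eq_iff)
next
  case (Suc j)
  have "bij (dyt j)" by (intro o_bij[of "dyt j"]) (auto simp: dyt_invol)
  then show ?case unfolding dyc_Suc using Suc bij_comp by blast
qed

definition transport :: "('a \<Rightarrow> 'b) \<Rightarrow> ('a \<Rightarrow> 'a) \<Rightarrow> 'b \<Rightarrow> 'b" where
  "transport e f i = (if i \<in> range e then e (f (inv e i)) else i)"

lemma transport_comp: "inj e \<Longrightarrow> transport e f \<circ> transport e g = transport e (f \<circ> g)"
  by (auto simp: transport_def fun_eq_iff)

lemma transport_id: "inj e \<Longrightarrow> transport e id = id"
  by (auto simp: transport_def fun_eq_iff)

lemma bij_transport: assumes "inj e" "bij f" shows "bij (transport e f)"
proof (rule o_bij)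
  show "transport e (inv f) \<circ> transport e f = id" "transport e f \<circ> transport e (inv f) = id"
    using assms transport_comp[of e "inv f" f] transport_comp[of e f "inv f"] transport_id[of e]
    by (simp_all add: bij_is_inj bij_is_surj surj_iff[symmetric] inv_o_cancel) (metis bij_is_surj surj_iff)
qed

text \<open>\<open>s i\<close> is the parameter of copy i in the source and \<open>s(0 := 1)\<close>
  the one in the target. The last condition is the cost of a move: moving from 1 to the copy 0 costs
  nothing, a step to the right costs one mesh width, and a fixed copy other than 0 costs
  nothing.\<close>

lemma dyadic_rays:
  obtains s :: "nat \<Rightarrow> real" and c \<sigma> :: "nat \<Rightarrow> nat \<Rightarrow> nat" where
    "s 0 = 0" "\<And>i. 0 \<le> s i \<and> s i \<le> 1" "\<And>j. bij (c j)" "\<And>j. finite {i. c j i \<noteq> i}"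
    "\<And>j. c (Suc j) = c j \<circ> \<sigma> j" "\<And>j i. \<sigma> j (\<sigma> j i) = i"
    "\<And>j i. \<bar>s i - (s(0 := 1)) (c j i)\<bar> \<le> 1 / 2 ^ j"
proof -
  \<comment> \<open>The successor keeps the label 0 free for the dyadic point 0.\<close>
  define e :: "rat \<Rightarrow> nat" where "e r = (if r = 0 then 0 else Suc (to_nat r))" for r
  have e: "inj e" by (auto simp: inj_def e_def split: if_splits)
  have e0: "e r = 0 \<longleftrightarrow> r = 0" for r by (simp add: e_def)
  define s where "s i = (if i \<in> range e then of_rat (max 0 (min 1 (inv e i))) else 0 :: real)" for i
  have se: "s (e r) = of_rat (max 0 (min 1 r))" for r using e by (simp add: s_def)
  show ?thesis
  proof (rule that[of s "\<lambda>j. transport e (dyc j)" "\<lambda>j. transport e (dyt j)"])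
    show "s 0 = 0" using se[of 0] by (simp add: e_def)
    show "0 \<le> s i \<and> s i \<le> 1" for i by (simp add: s_def)
    show "bij (transport e (dyc j))" for j by (rule bij_transport[OF e bij_dyc])
    show "finite {i. transport e (dyc j) i \<noteq> i}" for j
    proof (rule finite_subset)
      show "{i. transport e (dyc j) i \<noteq> i} \<subseteq> e ` dy j" by (auto simp: transport_def dyc_def e split: if_splits)
      have "dy j = (\<lambda>k. of_nat k / 2 ^ j) ` {..2 ^ j}" by (auto simp: dy_def)
      then show "finite (e ` dy j)" by simp
    qed
    show "transport e (dyc (Suc j)) = transport e (dyc j) \<circ> transport e (dyt j)" for j
      unfolding dyc_Suc transport_comp[OF e] ..
    show "transport e (dyt j) (transport e (dyt j) i) = i" for j i
      using e by (auto simp: transport_def dyt_invol)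
    fix j i
    show "\<bar>s i - (s(0 := 1)) (transport e (dyc j) i)\<bar> \<le> 1 / 2 ^ j"
    proof (cases "i \<in> range e")
      case False
      then have "i \<noteq> 0" using e0[of 0] by (metis rangeI)
      then show ?thesis using False by (simp add: transport_def)
    next
      case True
      then obtain r where r: "i = e r" by auto
      have t: "transport e (dyc j) i = e (dyc j r)" using e by (simp add: transport_def r)
      show ?thesis
      proof (cases "r \<in> dy j")
        case False
        then have "r \<noteq> 0" using dy_0_1 by auto
        then show ?thesis using False unfolding t by (simp add: r dyc_def e0)
      next
        case True
        note b = dy_bounds[OF True]
        show ?thesis
        proof (cases "r = 1")
          case True
          then show ?thesis unfolding t using se[of 1] dy_0_1(2)[of j] by (simp add: r dyc_def e0)
        next
          case False
          let ?h = "1 / 2 ^ j :: rat"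
          have h: "0 < ?h" by simp
          have "r + ?h \<le> 1" using dy_bounds(2)[OF dy_step[OF True False]] .
          moreover have "r + ?h \<noteq> 0" using b h by linarith
          moreover have "dyc j r = r + ?h" using \<open>r \<in> dy j\<close> False by (simp add: dyc_def)
          moreover have "max 0 (min 1 (r + ?h)) = r + ?h" using \<open>r + ?h \<le> 1\<close> b h by (simp only: min_absorb2 max_absorb2 add_nonneg_nonneg less_imp_le)
          ultimately have "(s(0 := 1)) (e (dyc j r)) = of_rat (r + ?h)"
            by (simp only: fun_upd_apply e0 se if_False)
          moreover have "s i = of_rat r" using b by (simp add: r se)
          ultimately show ?thesis unfolding t by (simp add: of_rat_add of_rat_divide of_rat_power)
        qed
      qed
    qed
  qed
qed

section \<open>Sums over rays\<close>

text \<open>The one sequence space serves as the sum of countably many copies of itself, so infinite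
  direct sums remain operators in \<open>bop p\<close>.\<close>

definition ray :: "nat \<Rightarrow> nat \<Rightarrow> nat" where
  "ray i l = prod_encode (i, l)"

lemma inj_ray: "inj (ray i)"
  by (auto simp: inj_def ray_def)

lemma ray_eq_iff: "ray i l = ray j m \<longleftrightarrow> i = j \<and> l = m"
  by (auto simp: ray_def)

lemma ray_cases: obtains i l where "n = ray i l"
  by (metis ray_def prod_decode_inverse surj_pair)

lemma ray_ext: "(\<And>i l. x (ray i l) = y (ray i l)) \<Longrightarrow> x = y"
  by (metis ext ray_cases)

text \<open>The permutation of the copies may depend on the coordinate l inside them; this freedom
  lets the twist change from window to window.\<close>

definition fib :: "(nat \<Rightarrow> nat \<Rightarrow> nat) \<Rightarrow> nat \<Rightarrow> nat" where
  "fib q n = (case prod_decode n of (i, l) \<Rightarrow> ray (q l i) l)"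

lemma fib_ray: "fib q (ray i l) = ray (q l i) l"
  by (simp add: fib_def ray_def)

lemma inj_fib: assumes "\<And>l. inj (q l)" shows "inj (fib q)"
proof (rule injI)
  fix a b assume "fib q a = fib q b"
  moreover obtain i l j m where "a = ray i l" "b = ray j m" by (metis ray_cases)
  ultimately show "a = b" using assms by (auto simp: fib_ray ray_eq_iff dest: injD)
qed

context lp_space
begin

definition dsm :: "(nat \<Rightarrow> lpop) \<Rightarrow> lpop" where
  "dsm M = (\<lambda>x. if x \<in> L then (\<lambda>n. case prod_decode n of (i, l) \<Rightarrow> M i (x \<circ> ray i) l) else 0)"

lemma dsm_ray: "x \<in> L \<Longrightarrow> dsm M x (ray i l) = M i (x \<circ> ray i) l"
  by (simp add: dsm_def ray_def)

lemma dsm_comp_ray: "x \<in> L \<Longrightarrow> dsm M x \<circ> ray i = M i (x \<circ> ray i)"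
  by (auto simp: dsm_ray)

lemma comp_ray_lp: "x \<in> L \<Longrightarrow> x \<circ> ray i \<in> L"
  by (rule lp_comp_inj(1)[OF _ inj_ray])

lemma sum_nm_rays:
  assumes x: "x \<in> L" and I: "finite I"
  shows "(\<Sum>i\<in>I. nm (x \<circ> ray i) powr p) \<le> nm x powr p"
proof -
  define y where "y i = mulop (indicator (range (ray i))) x" for i
  have yb: "nb (mulop (indicator (range (ray i)))) 1" for i by (rule nb_mulop) (auto simp: indicator_def)
  have y: "y i \<in> L" for i unfolding y_def by (rule bop_lp[OF nbD(1)[OF yb] x])
  have yv: "y i n = (if n \<in> range (ray i) then x n else 0)" for i n using x by (simp add: y_def mulop_def)
  have "nm (x \<circ> ray i) \<le> nm (y i)" for i
  proof -
    have "x \<circ> ray i = y i \<circ> ray i" by (auto simp: yv)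
    then show ?thesis using lp_comp_inj(2)[OF y inj_ray] by metis
  qed
  then have "(\<Sum>i\<in>I. nm (x \<circ> ray i) powr p) \<le> (\<Sum>i\<in>I. nm (y i) powr p)"
    by (intro sum_mono powr_mono2) auto
  also have "\<dots> = nm (sum y I) powr p"
    by (rule lp_sum_disjoint[OF I y, symmetric]) (auto simp: yv ray_eq_iff)
  also have "\<dots> \<le> nm x powr p"
  proof (rule powr_mono2)
    have "cmod (sum y I n) \<le> 1 * cmod (x n)" for n
    proof -
      obtain i l where n: "n = ray i l" by (rule ray_cases)
      have "sum y I n = (\<Sum>j\<in>I. if j = i then x n else 0)"
        unfolding sum_fun_at by (rule sum.cong) (auto simp: yv n ray_eq_iff)
      then show ?thesis using I by simp
    qed
    from lp_dominated(2)[OF x this] show "nm (sum y I) \<le> nm x" by simp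
  qed auto
  finally show ?thesis .
qed

text \<open>A finite set of coordinates is enclosed in a rectangle of copies and inner coordinates.
  Each copy contributes at most \<open>c powr p\<close> times the pth power of the norm of x on that
  copy.\<close>

lemma nb_dsm:
  assumes M: "\<And>i. nb (M i) c"
  shows "nb (dsm M) c"
proof -
  have c: "0 \<le> c" by (rule nbD(2)[OF M])
  note Mb = nbD(1)[OF M]
  have *: "dsm M x \<in> L \<and> nm (dsm M x) \<le> c * nm x" if x: "x \<in> L" for x
  proof -
    have "(\<Sum>n\<in>S. cmod (dsm M x n) powr p) \<le> (c * nm x) powr p" if S: "finite S" for S
    proof -
      define I K where "I = fst ` prod_decode ` S" and "K = snd ` prod_decode ` S"
      have fin: "finite I" "finite K" using S by (auto simp: I_def K_def)
      have sub: "S \<subseteq> (\<lambda>(i, l). ray i l) ` (I \<times> K)"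
      proof
        fix n assume n: "n \<in> S"
        obtain i l where il: "prod_decode n = (i, l)" by fastforce
        then have "i \<in> I" "l \<in> K" using n by (force simp: I_def K_def)+
        moreover have "n = ray i l" using il by (metis ray_def prod_decode_inverse)
        ultimately show "n \<in> (\<lambda>(i, l). ray i l) ` (I \<times> K)" by auto
      qed
      have "(\<Sum>n\<in>S. cmod (dsm M x n) powr p) \<le> (\<Sum>n\<in>(\<lambda>(i, l). ray i l) ` (I \<times> K). cmod (dsm M x n) powr p)"
        using fin sub by (intro sum_mono2) auto
      also have "\<dots> = (\<Sum>(i, l)\<in>I \<times> K. cmod (dsm M x (ray i l)) powr p)"
        by (subst sum.reindex) (auto simp: inj_on_def ray_eq_iff case_prod_unfold)
      also have "\<dots> = (\<Sum>i\<in>I. \<Sum>l\<in>K. cmod (M i (x \<circ> ray i) l) powr p)"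
        by (simp add: sum.cartesian_product dsm_ray[OF x])
      also have "\<dots> \<le> (\<Sum>i\<in>I. c powr p * nm (x \<circ> ray i) powr p)"
      proof (rule sum_mono)
        fix i
        have "(\<Sum>l\<in>K. cmod (M i (x \<circ> ray i) l) powr p) \<le> nm (M i (x \<circ> ray i)) powr p"
          by (rule sum_powr_le_nm[OF bop_lp[OF Mb comp_ray_lp[OF x]] fin(2)])
        also have "\<dots> \<le> (c * nm (x \<circ> ray i)) powr p"
          using nbD(3)[OF M comp_ray_lp[OF x]] by (intro powr_mono2) auto
        also have "\<dots> = c powr p * nm (x \<circ> ray i) powr p" by (rule powr_mult)
        finally show "(\<Sum>l\<in>K. cmod (M i (x \<circ> ray i) l) powr p) \<le> \<dots>" .
      qed
      also have "\<dots> \<le> c powr p * nm x powr p"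
        unfolding sum_distrib_left[symmetric] by (intro mult_left_mono sum_nm_rays[OF x fin(1)]) auto
      also have "\<dots> = (c * nm x) powr p" by (rule powr_mult[symmetric])
      finally show ?thesis .
    qed
    then show ?thesis using lp_bound_iff[of "c * nm x" "dsm M x"] c by auto
  qed
  show ?thesis
  proof (rule nbI)
    show "dsm M x = 0" if "x \<notin> L" for x using that by (simp add: dsm_def)
    show "0 \<le> c" by fact
    show "dsm M (x + y) = dsm M x + dsm M y" if "x \<in> L" "y \<in> L" for x y
    proof (rule ray_ext)
      fix i l
      have "(x + y) \<circ> ray i = (x \<circ> ray i) + (y \<circ> ray i)" by auto
      then show "dsm M (x + y) (ray i l) = (dsm M x + dsm M y) (ray i l)"
        using bop_add[OF Mb comp_ray_lp[OF that(1)] comp_ray_lp[OF that(2)]] that by (simp add: dsm_ray lp_add)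
    qed
    show "dsm M (vscale a x) = vscale a (dsm M x)" if "x \<in> L" for a x
    proof (rule ray_ext)
      fix i l
      have "vscale a x \<circ> ray i = vscale a (x \<circ> ray i)" by (auto simp: vscale_def)
      then show "dsm M (vscale a x) (ray i l) = vscale a (dsm M x) (ray i l)"
        using bop_scale[OF Mb comp_ray_lp[OF that], where c = a] that by (simp add: dsm_ray lp_scale) (simp add: vscale_def dsm_ray that)
    qed
  qed (use * in auto)
qed

lemma dsm_comp:
  assumes "\<And>i. nb (M i) b" "\<And>i. nb (N i) c" shows "dsm M \<circ> dsm N = dsm (\<lambda>i. M i \<circ> N i)"
proof (rule bop_ext)
  have N: "dsm N \<in> bop p" by (rule nbD(1)[OF nb_dsm[OF assms(2)]])
  show "dsm M \<circ> dsm N \<in> bop p" using N nbD(1)[OF nb_dsm[OF assms(1)]] by simp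
  show "dsm (\<lambda>i. M i \<circ> N i) \<in> bop p" by (rule nbD(1)[OF nb_dsm[OF nb_comp[OF assms]]])
  fix x assume x: "x \<in> L"
  show "(dsm M \<circ> dsm N) x = dsm (\<lambda>i. M i \<circ> N i) x"
    using bop_lp[OF N x] x by (intro ray_ext) (simp add: dsm_ray dsm_comp_ray)
qed

lemma dsm_add: "dsm M + dsm N = dsm (\<lambda>i. M i + N i)" "dsm M - dsm N = dsm (\<lambda>i. M i - N i)"
  by (auto simp: dsm_def fun_eq_iff split: prod.splits)

lemma dsm_mulop: "dsm (\<lambda>i. mulop (g i)) = mulop (\<lambda>n. case prod_decode n of (i, l) \<Rightarrow> g i l)"
proof
  fix x
  show "dsm (\<lambda>i. mulop (g i)) x = mulop (\<lambda>n. case prod_decode n of (i, l) \<Rightarrow> g i l) x"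
  proof (cases "x \<in> L")
    case True
    then show ?thesis by (intro ray_ext) (simp add: dsm_ray mulop_def comp_ray_lp, simp add: ray_def)
  qed (simp add: dsm_def mulop_def)
qed

text \<open>With the inverse in place, the content of copy i arrives in copy
  \<open>c i\<close>.\<close>

definition rperm :: "(nat \<Rightarrow> nat) \<Rightarrow> lpop" where
  "rperm c = res (fib (\<lambda>_. inv c))"

lemma nb_rperm: assumes "bij c" shows "nb (rperm c) 1"
  unfolding rperm_def by (rule nb_res) (intro inj_fib bij_is_inj bij_imp_bij_inv assms)

lemma rperm_ray: "x \<in> L \<Longrightarrow> rperm c x (ray i l) = x (ray (inv c i) l)"
  by (simp add: rperm_def res_def fib_ray)

lemma rperm_dsm:
  assumes c: "bij c" and M: "\<And>i. nb (M i) b"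
  shows "dsm M \<circ> rperm c = rperm c \<circ> dsm (\<lambda>i. M (c i))"
proof (rule bop_ext)
  note R = nbD(1)[OF nb_rperm[OF c]]
  have D: "dsm M \<in> bop p" "dsm (\<lambda>i. M (c i)) \<in> bop p" by (rule nbD(1)[OF nb_dsm[OF M]])+
  show "dsm M \<circ> rperm c \<in> bop p" "rperm c \<circ> dsm (\<lambda>i. M (c i)) \<in> bop p" using D R by auto
  fix x assume x: "x \<in> L"
  have "rperm c x \<circ> ray i = x \<circ> ray (inv c i)" for i by (auto simp: rperm_ray x)
  then show "(dsm M \<circ> rperm c) x = (rperm c \<circ> dsm (\<lambda>i. M (c i))) x"
    using bop_lp[OF R x] bop_lp[OF D(2) x] x c
    by (intro ray_ext) (simp add: dsm_ray rperm_ray bij_is_surj surj_f_inv_f)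
qed

end

section \<open>The twisting operator\<close>

text \<open>The coordinate \<open>ray i l\<close> is the \<open>l\<close>-th coordinate of the \<open>i\<close>-th copy of the sequence space. On the
  coordinates \<open>l \<in> E\<close> in the window from \<open>N j\<close> to \<open>N (Suc j)\<close> the operator \<open>U\<close> below permutes the copies by a
  combination of \<open>c j\<close> and \<open>c (Suc j)\<close>, so that it turns slowly from one permutation into the next.\<close>

locale ray_twist = lp_space +
  fixes E :: "nat set" and c \<sigma> :: "nat \<Rightarrow> nat \<Rightarrow> nat" and N :: "nat \<Rightarrow> nat" and \<gamma> :: "nat \<Rightarrow> complex"
  assumes bij_c: "bij (c j)" and finite_c: "finite {i. c j i \<noteq> i}"
    and c_Suc: "c (Suc j) = c j \<circ> \<sigma> j" and \<sigma>_invol: "\<sigma> j (\<sigma> j i) = i"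
    and N_0: "N 0 = 0" and N_mono: "strict_mono N"
    and \<gamma>_detour: "\<exists>t. 0 \<le> t \<and> t \<le> 1 \<and> \<gamma> l = detour t"
begin

text \<open>The index of the window that contains l; the greatest element exists because
  \<open>N 0 = 0\<close> and \<open>j \<le> N j\<close>.\<close>

definition stage :: "nat \<Rightarrow> nat" where
  "stage l = (GREATEST j. N j \<le> l)"

lemma N_ge: "j \<le> N j"
  by (rule strict_mono_imp_increasing[OF N_mono])

lemma stage_le: "N (stage l) \<le> l" and stage_gt: "l < N (Suc (stage l))"
proof -
  have b: "N y \<le> l \<Longrightarrow> y \<le> l" for y using N_ge[of y] by simp
  show "N (stage l) \<le> l" unfolding stage_def by (rule GreatestI_nat[of _ 0 l]) (auto simp: N_0 b)
  show "l < N (Suc (stage l))"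
  proof (rule ccontr)
    assume "\<not> l < N (Suc (stage l))"
    then have "Suc (stage l) \<le> stage l" unfolding stage_def by (intro Greatest_le_nat[of _ _ l]) (auto simp: b stage_def)
    then show False by simp
  qed
qed

lemma stage_unique: "N j \<le> l \<Longrightarrow> l < N (Suc j) \<Longrightarrow> stage l = j"
  using stage_le[of l] stage_gt[of l] strict_mono_less[OF N_mono]
  by (metis less_Suc_eq_le order.strict_trans1 order_antisym)

text \<open>The weight of the permutation \<open>c j\<close> at the coordinate l. It is faded in
  during the window before j and faded out during window j; for each l the weights of all
  permutations add up to 1.\<close>

definition f :: "nat \<Rightarrow> nat \<Rightarrow> complex" where
  "f j l = (if stage l = j then \<gamma> l else if Suc (stage l) = j then 1 - \<gamma> l else 0)"

lemma \<gamma>_bound: "cmod (\<gamma> l) \<le> 3" "cmod (1 - \<gamma> l) \<le> 4"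
proof -
  show "cmod (\<gamma> l) \<le> 3" using \<gamma>_detour[of l] detour_norm by metis
  then show "cmod (1 - \<gamma> l) \<le> 4" using norm_triangle_ineq4[of 1 "\<gamma> l"] by simp
qed

lemma f_bound: "cmod (f j l) \<le> 4"
  using \<gamma>_bound[of l] by (auto simp: f_def)

definition two_term :: "(nat \<Rightarrow> complex) \<Rightarrow> (nat \<Rightarrow> nat \<Rightarrow> nat) \<Rightarrow> (nat \<Rightarrow> complex) \<Rightarrow> (nat \<Rightarrow> nat \<Rightarrow> nat) \<Rightarrow> lpop" where
  "two_term u q v r = (mulop (\<lambda>n. u (snd (prod_decode n))) \<circ> res (fib q)) + (mulop (\<lambda>n. v (snd (prod_decode n))) \<circ> res (fib r))"

lemma two_term_bop:
  assumes "\<And>l. cmod (u l) \<le> b" "\<And>l. cmod (v l) \<le> b" "\<And>l. inj (q l)" "\<And>l. inj (r l)"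
  shows "two_term u q v r \<in> bop p"
proof -
  have "nb (two_term u q v r) (b * 1 + b * 1)" unfolding two_term_def
    by (intro nb_add nb_comp nb_mulop nb_res inj_fib assms)
  then show ?thesis by (rule nbD)
qed

lemma two_term_ray:
  assumes "\<And>l. inj (q l)" "\<And>l. inj (r l)" "x \<in> L"
  shows "two_term u q v r x (ray i l) = u l * x (ray (q l i) l) + v l * x (ray (r l i) l)"
proof -
  have "res (fib q) x \<in> L" "res (fib r) x \<in> L"
    by (rule bop_lp[OF nbD(1)[OF nb_res[OF inj_fib]] assms(3)], fact)+
  then show ?thesis using assms(3) by (simp add: two_term_def mulop_def) (simp add: res_def fib_ray, simp add: ray_def)
qed

definition U :: lpop where
  "U = two_term (\<lambda>l. if l \<in> E then \<gamma> l else 1) (\<lambda>l. if l \<in> E then inv (c (stage l)) else id)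
          (\<lambda>l. if l \<in> E then 1 - \<gamma> l else 0) (\<lambda>l. if l \<in> E then inv (c (Suc (stage l))) else id)"

text \<open>With \<open>\<beta> = 1 - \<gamma>\<close>, the inverse of \<open>\<gamma> + \<beta> \<sigma>\<close> is \<open>(\<gamma> - \<beta> \<sigma>) / (\<gamma> - \<beta>)\<close>.\<close>

definition \<gamma>i :: "nat \<Rightarrow> complex" where
  "\<gamma>i l = \<gamma> l / (2 * \<gamma> l - 1)"

definition Ui :: lpop where
  "Ui = two_term (\<lambda>l. if l \<in> E then \<gamma>i l else 1) (\<lambda>l. if l \<in> E then c (stage l) else id)
          (\<lambda>l. if l \<in> E then 1 - \<gamma>i l else 0) (\<lambda>l. if l \<in> E then c (Suc (stage l)) else id)"

lemma \<gamma>_half: "1/2 \<le> cmod (2 * \<gamma> l - 1)"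
  using \<gamma>_detour[of l] detour_avoids_half by metis

lemma \<gamma>i_bound: "cmod (\<gamma>i l) \<le> 7" "cmod (1 - \<gamma>i l) \<le> 8"
proof -
  have "cmod (\<gamma>i l) = cmod (\<gamma> l) / cmod (2 * \<gamma> l - 1)" by (simp add: \<gamma>i_def norm_divide)
  also have "\<dots> \<le> 3 / (1/2)" using \<gamma>_bound[of l] \<gamma>_half[of l] by (intro frac_le) auto
  finally show "cmod (\<gamma>i l) \<le> 7" by simp
  then show "cmod (1 - \<gamma>i l) \<le> 8" using norm_triangle_ineq4[of 1 "\<gamma>i l"] by simp
qed

lemma inj_q: "inj (if l \<in> E then inv (c j) else id)" "inj (if l \<in> E then c j else id)"
  using bij_is_inj[OF bij_c] bij_is_inj[OF bij_imp_bij_inv[OF bij_c]] by auto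

lemma U_bop: "U \<in> bop p" and Ui_bop: "Ui \<in> bop p"
  unfolding U_def Ui_def
proof -
  have "cmod (\<gamma> l) \<le> 8" "cmod (1 - \<gamma> l) \<le> 8" "cmod (\<gamma>i l) \<le> 8" for l
    using \<gamma>_bound[of l] \<gamma>i_bound[of l] by linarith+
  then show "two_term (\<lambda>l. if l \<in> E then \<gamma> l else 1) (\<lambda>l. if l \<in> E then inv (c (stage l)) else id)
          (\<lambda>l. if l \<in> E then 1 - \<gamma> l else 0) (\<lambda>l. if l \<in> E then inv (c (Suc (stage l))) else id) \<in> bop p"
    "two_term (\<lambda>l. if l \<in> E then \<gamma>i l else 1) (\<lambda>l. if l \<in> E then c (stage l) else id)
          (\<lambda>l. if l \<in> E then 1 - \<gamma>i l else 0) (\<lambda>l. if l \<in> E then c (Suc (stage l)) else id) \<in> bop p"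
    using \<gamma>i_bound(2) inj_q by (auto intro!: two_term_bop[where b = 8])
qed

lemma U_ray: "x \<in> L \<Longrightarrow> U x (ray i l) = (if l \<in> E then \<gamma> l * x (ray (inv (c (stage l)) i) l)
    + (1 - \<gamma> l) * x (ray (inv (c (Suc (stage l))) i) l) else x (ray i l))"
  unfolding U_def by (subst two_term_ray) (use inj_q in auto)

lemma Ui_ray: "x \<in> L \<Longrightarrow> Ui x (ray i l) = (if l \<in> E then \<gamma>i l * x (ray (c (stage l) i) l)
    + (1 - \<gamma>i l) * x (ray (c (Suc (stage l)) i) l) else x (ray i l))"
  unfolding Ui_def by (subst two_term_ray) (use inj_q in auto)

lemma inv_c: "inv (c j) (c j i) = i" "c j (inv (c j) i) = i"
  using bij_c[of j] by (auto simp: bij_is_inj bij_is_surj surj_f_inv_f)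

text \<open>These are the mixed terms in the products of \<open>U\<close> and \<open>Ui\<close>. All
  reduce to \<sigma> or to its conjugate under \<open>c j\<close>, so inverting \<open>U\<close> is
  a computation in the algebra generated by one involution.\<close>

lemma c_swap: "inv (c (Suc j)) (c j i) = \<sigma> j i" "inv (c j) (c (Suc j) i) = \<sigma> j i"
    "c (Suc j) (inv (c j) i) = c j (\<sigma> j (inv (c j) i))" "c j (inv (c (Suc j)) i) = c j (\<sigma> j (inv (c j) i))"
proof -
  have 1: "c j i = c (Suc j) (\<sigma> j i)" for i by (simp add: c_Suc \<sigma>_invol)
  show "inv (c (Suc j)) (c j i) = \<sigma> j i" unfolding 1 by (rule inv_c)
  show "inv (c j) (c (Suc j) i) = \<sigma> j i" by (simp add: c_Suc inv_c)
  show "c (Suc j) (inv (c j) i) = c j (\<sigma> j (inv (c j) i))" by (simp add: c_Suc)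
  have "c (Suc j) (inv (c (Suc j)) i) = c (Suc j) (\<sigma> j (inv (c j) i))"
    unfolding inv_c by (simp add: c_Suc \<sigma>_invol inv_c)
  then have "inv (c (Suc j)) i = \<sigma> j (inv (c j) i)" using bij_is_inj[OF bij_c[of "Suc j"]] by (simp add: inj_eq)
  then show "c j (inv (c (Suc j)) i) = c j (\<sigma> j (inv (c j) i))" by simp
qed

lemma \<gamma>_inverse: "\<gamma> l * \<gamma>i l + (1 - \<gamma> l) * (1 - \<gamma>i l) = 1" "\<gamma>i l * (1 - \<gamma> l) + (1 - \<gamma>i l) * \<gamma> l = 0"
proof -
  have "2 * \<gamma> l - 1 \<noteq> 0" using \<gamma>_half[of l] by auto
  then have "\<gamma>i l * (2 * \<gamma> l - 1) = \<gamma> l" by (simp add: \<gamma>i_def)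
  then have "2 * (\<gamma>i l * \<gamma> l) = \<gamma> l + \<gamma>i l" by (simp add: algebra_simps)
  then show "\<gamma> l * \<gamma>i l + (1 - \<gamma> l) * (1 - \<gamma>i l) = 1" "\<gamma>i l * (1 - \<gamma> l) + (1 - \<gamma>i l) * \<gamma> l = 0"
    by (simp_all add: algebra_simps)
qed

text \<open>The identity (h + (1 - h) \<sigma>) (g + (1 - g) \<sigma>) = 1, evaluated on two values
  x and y that \<sigma> exchanges; the two hypotheses are the coefficients of 1 and of
  \<sigma>.\<close>

lemma two_term_cancel:
  fixes g h x y :: complex
  assumes "g * h + (1 - g) * (1 - h) = 1" "h * (1 - g) + (1 - h) * g = 0"
  shows "h * (g * x + (1 - g) * y) + (1 - h) * (g * y + (1 - g) * x) = x"
proof -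
  have "h * (g * x + (1 - g) * y) + (1 - h) * (g * y + (1 - g) * x)
      = (g * h + (1 - g) * (1 - h)) * x + (h * (1 - g) + (1 - h) * g) * y" by (simp add: algebra_simps)
  then show ?thesis unfolding assms by simp
qed

lemma Ui_U: "Ui \<circ> U = op_one p"
proof (rule bop_ext)
  show "Ui \<circ> U \<in> bop p" "op_one p \<in> bop p" using U_bop Ui_bop one_bop by auto
  fix x assume x: "x \<in> L"
  have Ux: "U x \<in> L" by (rule bop_lp[OF U_bop x])
  show "(Ui \<circ> U) x = op_one p x"
  proof (rule ray_ext)
    fix i l
    show "(Ui \<circ> U) x (ray i l) = op_one p x (ray i l)"
      using two_term_cancel[OF \<gamma>_inverse, of l "x (ray i l)" "x (ray (\<sigma> (stage l) i) l)"]
      by (simp add: Ui_ray[OF Ux] U_ray[OF x] inv_c c_swap op_one_def x)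
  qed
qed

lemma U_Ui: "U \<circ> Ui = op_one p"
proof (rule bop_ext)
  show "U \<circ> Ui \<in> bop p" "op_one p \<in> bop p" using U_bop Ui_bop one_bop by auto
  fix x assume x: "x \<in> L"
  have Ux: "Ui x \<in> L" by (rule bop_lp[OF Ui_bop x])
  show "(U \<circ> Ui) x = op_one p x"
  proof (rule ray_ext)
    fix i l
    have g: "\<gamma>i l * \<gamma> l + (1 - \<gamma>i l) * (1 - \<gamma> l) = 1" "\<gamma> l * (1 - \<gamma>i l) + (1 - \<gamma> l) * \<gamma>i l = 0"
      using \<gamma>_inverse[of l] by (simp_all add: mult.commute add.commute)
    show "(U \<circ> Ui) x (ray i l) = op_one p x (ray i l)"
      using two_term_cancel[OF g, of "x (ray i l)" "x (ray (c (stage l) (\<sigma> (stage l) (inv (c (stage l)) i))) l)"]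
      by (simp add: U_ray[OF Ux] Ui_ray[OF x] inv_c c_swap op_one_def x)
  qed
qed

section \<open>Decomposition of the twist into compact pieces\<close>

definition P :: lpop where "P = mulop (indicator E)"

text \<open>Copy 0 is always included: \<open>Th\<close> removes the part in E from it, so every
  level has to put its weight back there.\<close>

definition R :: "nat \<Rightarrow> nat set" where "R j = insert 0 {i. c j i \<noteq> i}"

lemma finite_R: "finite (R j)"
  using finite_c by (simp add: R_def)

definition h :: "nat \<Rightarrow> lpop" where
  "h j = mulop (\<lambda>l. indicator E l * f j l)"

definition ch :: "nat \<Rightarrow> lpop" where
  "ch j = mulop (indicator {l \<in> E. f j l \<noteq> 0})"

definition commutator :: "lpop \<Rightarrow> lpop \<Rightarrow> lpop" where
  "commutator S T = (S \<circ> T) - (T \<circ> S)"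

lemma nb_h: "nb (h j) 4"
  unfolding h_def using f_bound by (intro nb_mulop) (auto simp: norm_mult indicator_def)

lemma nb_ch: "nb (ch j) 1"
  unfolding ch_def by (intro nb_mulop) (auto simp: indicator_def)

lemma h_ch: "h j \<circ> ch j = h j" "ch j \<circ> h j = h j"
proof -
  show "h j \<circ> ch j = h j" unfolding h_def ch_def
    by (subst mulop_comp[where c=1]) (auto simp: indicator_def intro!: arg_cong[of _ _ mulop])
  show "ch j \<circ> h j = h j" unfolding h_def ch_def
    by (subst mulop_comp[where c=4]) (use f_bound in \<open>auto simp: indicator_def norm_mult intro!: arg_cong[of _ _ mulop]\<close>)
qed

lemma f_support: "N (Suc j) \<le> l \<Longrightarrow> f j l = 0"
  using stage_gt[of l] stage_unique[of "stage l" l] strict_mono_less_eq[OF N_mono, of "Suc (stage l)" "Suc j"]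
    strict_mono_less_eq[OF N_mono, of "Suc (stage l)" j]
  by (auto simp: f_def)

definition hr :: "nat \<Rightarrow> nat \<Rightarrow> lpop" where
  "hr j i = (if i \<in> R j then h j else 0)"

definition hr' :: "nat \<Rightarrow> nat \<Rightarrow> lpop" where
  "hr' j i = (if i \<in> R j \<and> i \<noteq> 0 then h j else 0)"

text \<open>On E the twist is the sum over j of \<open>f j\<close> times the permutation
  \<open>c j\<close>. Subtracting \<open>f j\<close> times the identity on the copies other than 0
  leaves only the finitely many copies in \<open>R j\<close>, which makes \<open>X j\<close>
  compact. The subtracted identities add up to the part of \<open>Th\<close> on E, because the
  weights add up to 1.\<close>

definition X :: "nat \<Rightarrow> lpop" where
  "X j = (rperm (c j) \<circ> dsm (hr j)) - dsm (hr' j)"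

definition Th :: lpop where
  "Th = dsm (\<lambda>i. if i = 0 then op_one p - P else op_one p)"

lemma nb_hr: "nb (hr j i) 4" "nb (hr' j i) 4"
  using nb_h nb_zero by (auto simp: hr_def hr'_def)

lemma dsm_h_kop:
  assumes "finite S" shows "dsm (\<lambda>i. if i \<in> S then h j else 0) \<in> kop p"
proof -
  define g where "g i l = (if i \<in> S then indicator E l * f j l else 0)" for i l
  have z: "mulop (\<lambda>l. 0) = 0" by (auto simp: mulop_def fun_eq_iff)
  have "(\<lambda>i. if i \<in> S then h j else 0) = (\<lambda>i. mulop (g i))"
  proof
    fix i
    have "i \<in> S \<Longrightarrow> g i = (\<lambda>l. indicator E l * f j l)" "i \<notin> S \<Longrightarrow> g i = (\<lambda>l. 0)" by (auto simp: g_def)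
    then show "(if i \<in> S then h j else 0) = mulop (g i)" by (cases "i \<in> S") (simp_all add: h_def z)
  qed
  then have eq: "dsm (\<lambda>i. if i \<in> S then h j else 0) = mulop (\<lambda>n. case prod_decode n of (i, l) \<Rightarrow> g i l)"
    by (simp add: dsm_mulop)
  define T where "T = (\<lambda>(i, l). ray i l) ` (S \<times> {..<N (Suc j)})"
  have fin: "finite T" using assms by (simp add: T_def)
  show ?thesis unfolding eq
  proof (rule finite_mulop_kop[of "Suc (Max T)"])
    fix n assume n: "Suc (Max T) \<le> n"
    obtain i l where il: "n = ray i l" by (rule ray_cases)
    have "n \<notin> T" using Max_ge[OF fin, of n] n by auto
    then have "i \<notin> S \<or> N (Suc j) \<le> l" using il by (auto simp: T_def not_less[symmetric])
    then show "(case prod_decode n of (i, l) \<Rightarrow> g i l) = 0" using f_support[of j l] by (auto simp: il ray_def g_def)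
  qed
qed

lemma X_kop: "X j \<in> kop p"
proof -
  have "dsm (hr j) \<in> kop p" using dsm_h_kop[OF finite_R, of j j] by (simp add: hr_def[abs_def])
  moreover have "dsm (hr' j) \<in> kop p" using dsm_h_kop[of "R j - {0}" j] finite_R[of j] by (simp add: hr'_def[abs_def])
  ultimately show ?thesis unfolding X_def
    by (intro kop_diff kop_comp_left nbD(1)[OF nb_rperm[OF bij_c]])
qed

lemma hr_apply: assumes "x \<in> L" shows "hr j i x l = (if i \<in> R j then indicator E l * f j l * x l else 0)"
  "hr' j i x l = (if i \<in> R j \<and> i \<noteq> 0 then indicator E l * f j l * x l else 0)"
  using assms by (auto simp: hr_def hr'_def h_def mulop_def)

lemma X_ray: assumes x: "x \<in> L"
  shows "X j x (ray i l) = (if l \<in> E then f j l * (x (ray (inv (c j) i) l) - (if i = 0 then 0 else x (ray i l))) else 0)"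
proof -
  have d: "dsm (hr j) x \<in> L" by (rule bop_lp[OF nbD(1)[OF nb_dsm[OF nb_hr(1)]] x])
  have 1: "X j x (ray i l) = hr j (inv (c j) i) (x \<circ> ray (inv (c j) i)) l - hr' j i (x \<circ> ray i) l"
    by (simp add: X_def rperm_ray[OF d] dsm_ray[OF x])
  show ?thesis
  proof (cases "i = 0 \<or> c j i \<noteq> i \<or> inv (c j) i = 0")
    case True
    then have "inv (c j) i \<in> R j" "i \<noteq> 0 \<Longrightarrow> i \<in> R j"
      using inv_c[of j i] inv_c(1)[of j "inv (c j) i"] by (auto simp: R_def)
    then show ?thesis unfolding 1 hr_apply[OF comp_ray_lp[OF x]] by (auto simp: algebra_simps)
  next
    case False
    then have "inv (c j) i = i" using inv_c(1)[of j i] by simp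
    then have "i \<notin> R j" "inv (c j) i = i" using False by (auto simp: R_def)
    then show ?thesis unfolding 1 hr_apply[OF comp_ray_lp[OF x]] using False by auto
  qed
qed

lemma Th_ray: assumes x: "x \<in> L"
  shows "Th x (ray i l) = (if i = 0 \<and> l \<in> E then 0 else x (ray i l))"
  using comp_ray_lp[OF x] by (simp add: Th_def dsm_ray[OF x] P_def mulop_def op_one_def)

text \<open>These partial sums need not converge to \<open>U\<close> in norm. They agree with
  \<open>U\<close> eventually at each coordinate, and on each finitely supported vector.\<close>

definition UJ :: "nat \<Rightarrow> lpop" where "UJ J = Th + (\<Sum>j<J. X j)"

lemma nb_P: "nb P 1"
  unfolding P_def by (intro nb_mulop) (auto simp: indicator_def)

lemma nb_Th: "nb Th 2"
proof -
  have "nb (if i = 0 then op_one p - P else op_one p) 2" for i :: nat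
    using nb_diff[OF one_bop(1) nb_P] nb_mono[OF one_bop(1), of 2] by auto
  then show ?thesis unfolding Th_def by (rule nb_dsm)
qed

lemma X_bop: "X j \<in> bop p" by (rule kop_bop[OF X_kop])

lemma UJ_bop: "UJ J \<in> bop p"
  unfolding UJ_def by (intro bop_closed bop_sum_closed X_bop nbD(1)[OF nb_Th])

lemma UJ_ray: assumes x: "x \<in> L" and J: "Suc (stage l) < J" shows "UJ J x (ray i l) = U x (ray i l)"
proof (cases "l \<in> E")
  case False
  then show ?thesis by (simp add: UJ_def sum_fun_at X_ray[OF x] Th_ray[OF x] U_ray[OF x])
next
  case True
  let ?t = "\<lambda>j. x (ray (inv (c j) i) l) - (if i = 0 then 0 else x (ray i l))"
  have "(\<Sum>j<J. f j l * ?t j) = (\<Sum>j\<in>{stage l, Suc (stage l)}. f j l * ?t j)"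
    by (rule sum.mono_neutral_right) (use J in \<open>auto simp: f_def\<close>)
  also have "\<dots> = \<gamma> l * ?t (stage l) + (1 - \<gamma> l) * ?t (Suc (stage l))" by (simp add: f_def)
  finally show ?thesis using True
    by (simp add: UJ_def sum_fun_at X_ray[OF x] Th_ray[OF x] U_ray[OF x] algebra_simps)
qed

text \<open>The pairing function dominates its second argument, so x vanishes at inner coordinates
  from K on, and below K the stage is less than K.\<close>

lemma UJ_finite:
  assumes x: "x \<in> L" and fin: "\<And>n. K \<le> n \<Longrightarrow> x n = 0"
  shows "\<exists>J0. \<forall>J\<ge>J0. UJ J x = U x"
proof (intro exI allI impI)
  let ?J0 = "Suc (Suc K)"
  fix J assume J: "?J0 \<le> J"
  show "UJ J x = U x"
  proof (rule ray_ext)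
    fix i l
    show "UJ J x (ray i l) = U x (ray i l)"
    proof (cases "l < K")
      case True
      have "stage l \<le> l" using stage_le[of l] N_ge[of "stage l"] by simp
      then show ?thesis using True J by (intro UJ_ray[OF x]) auto
    next
      case False
      have "l \<le> ray a l" for a unfolding ray_def by (rule le_prod_encode_2)
      then have "x (ray a l) = 0" for a using False fin[of "ray a l"] by (meson not_less order_trans)
      then show ?thesis by (simp add: UJ_def sum_fun_at X_ray[OF x] Th_ray[OF x] U_ray[OF x])
    qed
  qed
qed


lemma commutator_diff: assumes "H \<in> bop p" "S \<in> bop p" "T \<in> bop p" shows "commutator H (S - T) = commutator H S - commutator H T"
  by (auto simp: commutator_def comp_add_left comp_add_right[OF assms] algebra_simps)

text \<open>HS - TH is [H, T] + H (S - T). Since H (1 - W) = 0, the part of H (S - T) seen by 1 - W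
  is again a commutator. The remaining term H (S - T) W is localised on both sides.\<close>

lemma commutator_split:
  assumes H: "H \<in> bop p" and S: "S \<in> bop p" and T: "T \<in> bop p" and W: "W \<in> bop p" and HW: "H \<circ> W = H"
  shows "((H \<circ> S) - (T \<circ> H)) - (H \<circ> (S - T) \<circ> W) = commutator H T + (commutator H (S - T) \<circ> (op_one p - W))"
proof (rule bop_ext)
  show "((H \<circ> S) - (T \<circ> H)) - (H \<circ> (S - T) \<circ> W) \<in> bop p"
    "commutator H T + (commutator H (S - T) \<circ> (op_one p - W)) \<in> bop p"
    unfolding commutator_def by (intro bop_closed H S T W one_bop)+
  fix x assume x: "x \<in> L"
  define D where "D = S - T"
  have D: "D \<in> bop p" unfolding D_def using S T by simp
  have Wx: "W x \<in> L" by (rule bop_lp[OF W x])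
  have 1: "H (x - W x) = 0"
    unfolding bop_diff[OF H x Wx] using fun_cong[OF HW, of x] by simp
  have 2: "H (D (x - W x)) = H (D x) - H (D (W x))"
    unfolding bop_diff[OF D x Wx] by (rule bop_diff[OF H bop_lp[OF D x] bop_lp[OF D Wx]])
  have 3: "H (D x) = H (S x) - H (T x)"
    unfolding D_def using bop_diff[OF H bop_lp[OF S x] bop_lp[OF T x]] by simp
  show "(((H \<circ> S) - (T \<circ> H)) - (H \<circ> (S - T) \<circ> W)) x = (commutator H T + (commutator H (S - T) \<circ> (op_one p - W))) x"
    unfolding D_def[symmetric] by (simp add: commutator_def op_one_def x 1 2 3 bop_zero[OF D])
qed

definition Z :: "nat \<Rightarrow> nat set" where
  "Z j = {n. f j (snd (prod_decode n)) \<noteq> 0}"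

definition w :: "nat \<Rightarrow> lpop" where
  "w j = mulop (indicator {l. f j l \<noteq> 0})"

lemma nb_w: "nb (w j) 1"
  unfolding w_def by (intro nb_mulop) (auto simp: indicator_def)

lemma w_h: "w j \<circ> h j = h j" "ch j \<circ> w j = ch j"
proof -
  show "w j \<circ> h j = h j" unfolding h_def w_def
    by (subst mulop_comp[where c=4]) (use f_bound in \<open>auto simp: indicator_def norm_mult intro!: arg_cong[of _ _ mulop]\<close>)
  show "ch j \<circ> w j = ch j" unfolding ch_def w_def
    by (subst mulop_comp[where c=1]) (auto simp: indicator_def intro!: arg_cong[of _ _ mulop])
qed

lemma mulop_Z: "mulop (indicator (Z j)) = dsm (\<lambda>_. w j)"
  unfolding w_def dsm_mulop by (rule arg_cong[of _ _ mulop]) (auto simp: Z_def indicator_def fun_eq_iff split: prod.splits)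

text \<open>\<open>f j\<close> lives in the windows j - 1 and j only, so two different levels of
  equal parity never meet.\<close>

lemma Z_disjoint: "j < j' \<Longrightarrow> even j = even j' \<Longrightarrow> Z j \<inter> Z j' = {}"
  by (auto simp: Z_def f_def split: if_splits)

lemma R_c: "i \<in> R j \<Longrightarrow> c j i \<in> R j"
  using bij_is_inj[OF bij_c[of j]] by (auto simp: R_def inj_eq)

lemma sum_split_filter: "finite S \<Longrightarrow> sum g S = sum g {x \<in> S. Q x} + sum g {x \<in> S. \<not> Q x}"
  for g :: "'i \<Rightarrow> 'a::comm_monoid_add"
  by (subst sum.union_disjoint[symmetric]) (auto intro!: sum.cong)

text \<open>The defect of \<open>U\<close> telescopes into compact pieces \<open>K j\<close>. Up to
  summable commutators, \<open>K j\<close> is an operator \<open>A j\<close> of norm at most \<eta>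
  j living on \<open>Z j\<close>. Operators \<open>A j\<close> of one parity form a block diagonal
  family, so a late sum of them is as small as their supremum, and \<eta> tending to 0 suffices.
  Hence the defect is a norm limit of compact operators.\<close>

lemma twist_intertwines:
  assumes M: "\<And>i. nb (M i) C" and M': "\<And>i. nb (M' i) C" and MM: "\<And>i. i \<noteq> 0 \<Longrightarrow> M' i = M i"
    and M0: "P \<circ> M 0 = M 0" "M' 0 \<circ> P = M' 0"
    and e: "\<And>j i. j0 \<le> j \<Longrightarrow> i \<in> R j \<Longrightarrow> nb (commutator (h j) (M i)) (e j) \<and> nb (commutator (h j) (M' i)) (e j)"
    and \<eta>: "\<And>j i. j0 \<le> j \<Longrightarrow> i \<in> R j \<Longrightarrow> nb (h j \<circ> (M i - M' (c j i)) \<circ> ch j) (\<eta> j)"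
    and sum_e: "summable e" and lim_\<eta>: "\<eta> \<longlonglongrightarrow> 0"
  shows "(U \<circ> dsm M) - (dsm M' \<circ> U) \<in> kop p"
proof -
  note Mb = nbD(1)[OF M] and M'b = nbD(1)[OF M'] and hb = nbD(1)[OF nb_h] and cb = nbD(1)[OF nb_ch]
  let ?B = "dsm M" and ?B' = "dsm M'"
  have B: "?B \<in> bop p" "?B' \<in> bop p" by (rule nbD(1)[OF nb_dsm[OF M]], rule nbD(1)[OF nb_dsm[OF M']])
  have rp: "rperm (c j) \<in> bop p" for j by (rule nbD(1)[OF nb_rperm[OF bij_c]])
  have C0: "0 \<le> C" by (rule nbD(2)[OF M])
  \<comment> \<open>\<open>K j\<close> is the contribution of \<open>X j\<close> to the defect;
    \<open>A j\<close> is the part of it that compares the representation before a move with the one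
    after it.\<close>
  define K where "K j = (X j \<circ> ?B) - (?B' \<circ> X j)" for j
  define m where "m j i = (if i \<in> R j then h j \<circ> (M i - M' (c j i)) \<circ> ch j else 0)" for j i
  define A where "A j = rperm (c j) \<circ> dsm (m j)" for j
  have mb: "nb (m j i) (4 * (C + C) * 1)" for j i
    unfolding m_def using nb_comp[OF nb_comp[OF nb_h nb_diff[OF M M']] nb_ch] C0 by (auto intro: nb_zero)
  have \<eta>0: "0 \<le> \<eta> j" and e0: "0 \<le> e j" if "j0 \<le> j" for j
    using nbD(2)[OF \<eta>[OF that, of 0]] nbD(2)[OF conjunct1[OF e[OF that, of 0]]] by (auto simp: R_def)
  have K_kop: "K j \<in> kop p" for j
    unfolding K_def by (intro kop_diff kop_comp_left kop_comp_right X_kop B)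
  \<comment> \<open>The moved part \<open>a\<close> leaves three commutators by
    \<open>commutator_split\<close>. The subtracted identity \<open>b\<close> avoids copy 0, where
    alone M and M' may differ, and leaves one.\<close>
  have KA: "nb (K j - A j) (4 * e j)" if j: "j0 \<le> j" for j
  proof -
    define a where "a i = (hr j i \<circ> M i) - (M' (c j i) \<circ> hr j i)" for i
    define b where "b i = (hr' j i \<circ> M i) - (M' i \<circ> hr' j i)" for i
    have hM: "nb (hr j i \<circ> M i) (4 * C)" "nb (hr' j i \<circ> M i) (4 * C)" "nb (M' i' \<circ> hr j i) (C * 4)" "nb (M' i' \<circ> hr' j i) (C * 4)" for i i'
      by (intro nb_comp nb_hr M M')+
    have hb': "dsm (hr j) \<in> bop p" "dsm (hr' j) \<in> bop p" by (rule nbD(1)[OF nb_dsm[OF nb_hr(1)]], rule nbD(1)[OF nb_dsm[OF nb_hr(2)]])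
    have 1: "X j \<circ> ?B = (rperm (c j) \<circ> dsm (\<lambda>i. hr j i \<circ> M i)) - dsm (\<lambda>i. hr' j i \<circ> M i)"
      unfolding X_def comp_add_left comp_assoc dsm_comp[OF nb_hr(1) M] dsm_comp[OF nb_hr(2) M] ..
    have 2: "?B' \<circ> X j = (rperm (c j) \<circ> dsm (\<lambda>i. M' (c j i) \<circ> hr j i)) - dsm (\<lambda>i. M' i \<circ> hr' j i)"
    proof -
      have "?B' \<circ> X j = (?B' \<circ> (rperm (c j) \<circ> dsm (hr j))) - (?B' \<circ> dsm (hr' j))"
        unfolding X_def using B rp hb' by (intro comp_add_right(2)) auto
      also have "?B' \<circ> (rperm (c j) \<circ> dsm (hr j)) = rperm (c j) \<circ> (dsm (\<lambda>i. M' (c j i)) \<circ> dsm (hr j))"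
        unfolding comp_assoc[symmetric] rperm_dsm[OF bij_c M'] ..
      finally show ?thesis unfolding dsm_comp[OF M' nb_hr(1)] dsm_comp[OF M' nb_hr(2)] .
    qed
    have d: "dsm (\<lambda>i. hr j i \<circ> M i) \<in> bop p" "dsm (\<lambda>i. M' (c j i) \<circ> hr j i) \<in> bop p" "dsm (m j) \<in> bop p"
      by (rule nbD(1)[OF nb_dsm[OF hM(1)]], rule nbD(1)[OF nb_dsm[OF hM(3)]], rule nbD(1)[OF nb_dsm[OF mb]])
    have KAeq: "K j - A j = (rperm (c j) \<circ> dsm (\<lambda>i. a i - m j i)) - dsm b"
    proof -
      have "rperm (c j) \<circ> dsm (\<lambda>i. a i - m j i) = rperm (c j) \<circ> (dsm (\<lambda>i. hr j i \<circ> M i) - dsm (\<lambda>i. M' (c j i) \<circ> hr j i) - dsm (m j))"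
        unfolding dsm_add a_def ..
      also have "\<dots> = (rperm (c j) \<circ> dsm (\<lambda>i. hr j i \<circ> M i)) - (rperm (c j) \<circ> dsm (\<lambda>i. M' (c j i) \<circ> hr j i)) - A j"
        unfolding A_def using rp d by (simp add: comp_add_right)
      finally show ?thesis unfolding K_def 1 2 b_def dsm_add(2)[symmetric] by (simp add: algebra_simps)
    qed
    have na: "nb (a i - m j i) (3 * e j)" for i
    proof (cases "i \<in> R j")
      case False
      then have "a i - m j i = 0" by (auto simp: a_def hr_def m_def fun_eq_iff bop_zero[OF M'b])
      then show ?thesis using nb_zero[of "3 * e j"] e0[OF j] by simp
    next
      case True
      have "a i - m j i = commutator (h j) (M' (c j i)) + (commutator (h j) (M i - M' (c j i)) \<circ> (op_one p - ch j))"
        using True commutator_split[OF hb Mb M'b cb h_ch(1)] by (simp add: a_def hr_def m_def)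
      also have "\<dots> = commutator (h j) (M' (c j i)) + ((commutator (h j) (M i) - commutator (h j) (M' (c j i))) \<circ> (op_one p - ch j))"
        unfolding commutator_diff[OF hb Mb M'b] ..
      finally have eq: "a i - m j i = \<dots>" .
      have n1: "nb (op_one p - ch j) 1"
      proof -
        have "op_one p - ch j = mulop (\<lambda>l. 1 - indicator {l \<in> E. f j l \<noteq> 0} l)"
          unfolding ch_def mulop_one[symmetric] mulop_add ..
        then show ?thesis using nb_mulop[of "\<lambda>l. 1 - indicator {l \<in> E. f j l \<noteq> 0} l" 1] by (auto simp: indicator_def)
      qed
      have "nb (a i - m j i) (e j + (e j + e j) * 1)" unfolding eq
        by (intro nb_add nb_comp nb_diff n1 conjunct1[OF e[OF j True]] conjunct2[OF e[OF j R_c[OF True]]])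
      then show ?thesis by simp
    qed
    have nbb: "nb (b i) (e j)" for i
    proof (cases "i \<in> R j \<and> i \<noteq> 0")
      case False
      then have "b i = 0" by (auto simp: b_def hr'_def fun_eq_iff bop_zero[OF M'b])
      then show ?thesis using nb_zero[of "e j"] e0[OF j] by simp
    next
      case True
      then have "b i = commutator (h j) (M i)" by (simp add: b_def hr'_def commutator_def MM)
      then show ?thesis using e[OF j, of i] True by simp
    qed
    show ?thesis
      using nb_diff[OF nb_comp[OF nb_rperm[OF bij_c[of j]] nb_dsm[OF na]] nb_dsm[OF nbb]] unfolding KAeq by simp
  qed
  have A_nb: "nb (A j) (\<eta> j)" if j: "j0 \<le> j" for j
  proof -
    have "nb (m j i) (\<eta> j)" for i using \<eta>[OF j, of i] nb_zero[OF \<eta>0[OF j]] by (simp add: m_def)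
    then have "nb (A j) (1 * \<eta> j)" unfolding A_def by (intro nb_comp nb_dsm nb_rperm bij_c)
    then show ?thesis by simp
  qed
  have A_Z: "mulop (indicator (Z j)) \<circ> A j = A j" "A j \<circ> mulop (indicator (Z j)) = A j" for j
  proof -
    have wm: "w j \<circ> m j i = m j i" "m j i \<circ> w j = m j i" for i
    proof -
      show "w j \<circ> m j i = m j i" using w_h(1)[of j] bop_zero[OF nbD(1)[OF nb_w]]
        by (cases "i \<in> R j") (simp_all add: m_def comp_assoc[symmetric] fun_eq_iff)
      show "m j i \<circ> w j = m j i"
      proof (cases "i \<in> R j")
        case True
        then show ?thesis by (simp add: m_def comp_assoc w_h(2))
      qed (auto simp: m_def fun_eq_iff)
    qed
    have "mulop (indicator (Z j)) \<circ> A j = (dsm (\<lambda>_. w j) \<circ> rperm (c j)) \<circ> dsm (m j)"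
      unfolding mulop_Z A_def comp_assoc ..
    also have "\<dots> = rperm (c j) \<circ> (dsm (\<lambda>_. w j) \<circ> dsm (m j))"
      unfolding rperm_dsm[OF bij_c nb_w] comp_assoc ..
    also have "\<dots> = A j" unfolding dsm_comp[OF nb_w mb] wm A_def ..
    finally show "mulop (indicator (Z j)) \<circ> A j = A j" .
    show "A j \<circ> mulop (indicator (Z j)) = A j"
      unfolding A_def mulop_Z comp_assoc dsm_comp[OF mb nb_w] wm ..
  qed
  \<comment> \<open>The factor 2 counts the two parity classes, each of which is block
    diagonal.\<close>
  have tail: "nb (sum K {J..<J'}) (2 * \<delta> + 4 * sum e {J..<J'})"
    if J: "j0 \<le> J" and \<delta>: "\<And>j. J \<le> j \<Longrightarrow> \<eta> j \<le> \<delta>" for J J' \<delta>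
  proof -
    have d0: "0 \<le> \<delta>" using \<delta>[of J] \<eta>0[OF J] by simp
    have half: "nb (sum A {j \<in> {J..<J'}. even j = v}) \<delta>" for v
    proof (rule nb_sum_disjoint[where Z = Z])
      fix i assume "i \<in> {j \<in> {J..<J'}. even j = v}"
      then show "nb (A i) \<delta>" using A_nb[of i] \<delta>[of i] J by (auto intro: nb_mono)
    next
      fix i j assume "i \<in> {j \<in> {J..<J'}. even j = v}" "j \<in> {j \<in> {J..<J'}. even j = v}" "i \<noteq> j"
      then show "Z i \<inter> Z j = {}" using Z_disjoint[of i j] Z_disjoint[of j i] by (cases "i < j") auto
    qed (use d0 A_Z in auto)
    have "sum A {J..<J'} = sum A {j \<in> {J..<J'}. even j = True} + sum A {j \<in> {J..<J'}. even j = False}"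
      using sum_split_filter[of "{J..<J'}" A even] by simp
    then have 1: "nb (sum A {J..<J'}) (\<delta> + \<delta>)" using nb_add[OF half[of True] half[of False]] by (simp only:)
    have 2: "nb (\<Sum>j\<in>{J..<J'}. K j - A j) (\<Sum>j\<in>{J..<J'}. 4 * e j)" by (rule nb_sum, rule KA) (use J in auto)
    have "sum K {J..<J'} = sum A {J..<J'} + (\<Sum>j\<in>{J..<J'}. K j - A j)" by (simp only: sum.distrib[symmetric] add_diff_eq diff_add_cancel add_diff_cancel_left')
    then show ?thesis using nb_add[OF 1 2] by (simp add: sum_distrib_left)
  qed
  \<comment> \<open>The initial term contributes no defect: 1 - P annihilates M 0 from the left and
    M' 0 from the right, and both products with \<open>Th\<close> vanish on copy 0.\<close>
  have Th_comm: "Th \<circ> ?B = ?B' \<circ> Th"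
  proof -
    let ?t = "\<lambda>i::nat. if i = 0 then op_one p - P else op_one p"
    have t: "nb (?t i) 2" for i using nb_diff[OF one_bop(1) nb_P] nb_mono[OF one_bop(1), of 2] by auto
    have "?t i \<circ> M i = M' i \<circ> ?t i" for i
    proof (cases "i = 0")
      case True
      have "(op_one p - P) \<circ> M 0 = 0" unfolding comp_add_left M0 one_comp(1)[OF Mb] by simp
      moreover have "M' 0 \<circ> (op_one p - P) = 0"
        unfolding comp_add_right(2)[OF M'b one_bop(2) nbD(1)[OF nb_P]] M0 one_comp(2)[OF M'b] by simp
      ultimately show ?thesis using True by simp
    next
      case False then show ?thesis by (simp add: MM one_comp[OF Mb])
    qed
    then show ?thesis unfolding Th_def dsm_comp[OF t M] dsm_comp[OF M' t] by simp
  qed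
  define KJ where "KJ J = (UJ J \<circ> ?B) - (?B' \<circ> UJ J)" for J
  have KJ_sum: "KJ J = sum K {..<J}" for J
  proof (induction J)
    case 0
    show ?case using Th_comm by (simp add: KJ_def UJ_def)
  next
    case (Suc J)
    have "UJ (Suc J) = UJ J + X J" by (simp only: UJ_def sum.lessThan_Suc add.assoc)
    then have "KJ (Suc J) = KJ J + K J"
      unfolding KJ_def K_def by (simp add: comp_add_left comp_add_right[OF B(2) UJ_bop X_bop] algebra_simps)
    then show ?case using Suc by (simp only: sum.lessThan_Suc)
  qed
  show ?thesis
  proof (rule kop_closed)
    show T: "(U \<circ> ?B) - (?B' \<circ> U) \<in> bop p" using U_bop B by simp
    fix \<epsilon> :: real assume eps: "0 < \<epsilon>"
    have "\<forall>\<^sub>F j in sequentially. \<eta> j < \<epsilon> / 4" using lim_\<eta> eps by (intro order_tendstoD) auto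
    then obtain J1 where J1: "\<And>j. J1 \<le> j \<Longrightarrow> \<eta> j \<le> \<epsilon> / 4" by (auto simp: eventually_sequentially intro: less_imp_le)
    obtain J2 where J2: "\<And>J J'. J2 \<le> J \<Longrightarrow> norm (sum e {J..<J'}) < \<epsilon> / 8"
      using summable_Cauchy[THEN iffD1, OF sum_e] eps by (metis zero_less_divide_iff zero_less_numeral)
    define J where "J = max j0 (max J1 J2)"
    have tb: "nb (sum K {J..<J'}) \<epsilon>" for J'
    proof (rule nb_mono[OF tail[of J "\<epsilon>/4"]])
      have "J2 \<le> J" by (simp add: J_def)
      from J2[OF this, of J'] have "sum e {J..<J'} < \<epsilon> / 8" unfolding real_norm_def by linarith
      then show "2 * (\<epsilon>/4) + 4 * sum e {J..<J'} \<le> \<epsilon>" by simp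
    qed (use J1 in \<open>auto simp: J_def\<close>)
    show "\<exists>K\<in>kop p. nb ((U \<circ> ?B) - (?B' \<circ> U) - K) \<epsilon>"
    proof
      show KJk: "KJ J \<in> kop p" unfolding KJ_sum by (rule kop_sum[OF K_kop])
      show "nb ((U \<circ> ?B) - (?B' \<circ> U) - KJ J) \<epsilon>"
      proof (rule nb_dense)
        show "(U \<circ> ?B) - (?B' \<circ> U) - KJ J \<in> bop p" using T kop_bop[OF KJk] by simp
        show "0 \<le> \<epsilon>" using eps by simp
        fix x k assume x: "x \<in> L" and fin: "\<And>n. k \<le> n \<Longrightarrow> x n = 0"
        define y where "y n = sum K {J..<J+n} x" for n
        have y: "y n \<in> L" "nm (y n) \<le> \<epsilon> * nm x" for n
          unfolding y_def using bop_lp[OF nbD(1)[OF tb] x] nbD(3)[OF tb x] by auto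
        have yK: "y n = KJ (J + n) x - KJ J x" for n
        proof -
          have "sum K {..<J+n} = sum K {..<J} + sum K {J..<J+n}"
            by (subst sum.union_disjoint[symmetric]) (auto intro!: sum.cong)
          then show ?thesis unfolding y_def KJ_sum by simp
        qed
        \<comment> \<open>\<open>?B x\<close> need not be finitely supported, so the partial sums
          are known to agree with \<open>U\<close> there only coordinate by coordinate; on x itself
          they agree as vectors. The norm bound survives by lower semicontinuity.\<close>
        have lim: "(\<lambda>n. y n i) \<longlonglongrightarrow> ((U \<circ> ?B) - (?B' \<circ> U) - KJ J) x i" for i
        proof (rule tendsto_eventually)
          obtain J3 where J3: "\<And>J. J3 \<le> J \<Longrightarrow> UJ J x = U x" using UJ_finite[OF x fin] by blast
          obtain a l where al: "i = ray a l" by (rule ray_cases)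
          have "y n i = ((U \<circ> ?B) - (?B' \<circ> U) - KJ J) x i" if n: "max J3 (Suc (Suc (stage l))) \<le> n" for n
          proof -
            have "UJ (J + n) (?B x) i = U (?B x) i"
              unfolding al by (rule UJ_ray[OF bop_lp[OF B(1) x]]) (use n in auto)
            moreover have "UJ (J + n) x = U x" using J3[of "J + n"] n by simp
            ultimately show ?thesis unfolding yK by (simp add: KJ_def)
          qed
          then show "\<forall>\<^sub>F n in sequentially. y n i = ((U \<circ> ?B) - (?B' \<circ> U) - KJ J) x i"
            unfolding eventually_sequentially by blast
        qed
        show "nm (((U \<circ> ?B) - (?B' \<circ> U) - KJ J) x) \<le> \<epsilon> * nm x"
          by (rule lp_coordinate_limit(2)[OF y lim])
      qed
    qed
  qed
qed

end

context lp_space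
begin

section \<open>Extensions\<close>

abbreviation q where "q \<equiv> calk_pi p"

lemma calk_pi_mem: "S \<in> q T \<longleftrightarrow> S \<in> bop p \<and> S - T \<in> kop p"
  by (simp add: calk_pi_def op_add_eq op_scale_minus_one)

lemma calk_pi_eqI: assumes "S - T \<in> kop p" shows "q S = q T"
proof -
  have "R - S \<in> kop p \<longleftrightarrow> R - T \<in> kop p" for R
  proof
    assume "R - S \<in> kop p"
    from kop_add[OF this assms] show "R - T \<in> kop p" by simp
  next
    assume "R - T \<in> kop p"
    from kop_diff[OF this assms] show "R - S \<in> kop p" by simp
  qed
  then show ?thesis by (auto simp: calk_pi_mem)
qed

lemma calk_pi_eqD: assumes "q S = q T" "S \<in> bop p" shows "S - T \<in> kop p"
proof -
  have "S \<in> q S" using assms(2) kop_zero by (simp add: calk_pi_mem)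
  then show ?thesis unfolding assms(1) by (simp add: calk_pi_mem)
qed

lemma calk_rep: assumes "T \<in> bop p"
  shows "calk_rep p (q T) \<in> bop p" "q (calk_rep p (q T)) = q T" "calk_rep p (q T) - T \<in> kop p"
proof -
  have "calk_rep p (q T) \<in> bop p \<and> q (calk_rep p (q T)) = q T"
    unfolding calk_rep_def by (rule someI[of _ T]) (simp add: assms)
  then show "calk_rep p (q T) \<in> bop p" "q (calk_rep p (q T)) = q T" by auto
  then show "calk_rep p (q T) - T \<in> kop p" by (intro calk_pi_eqD) auto
qed

lemma kop_comp_diff:
  assumes "S - S' \<in> kop p" "T - T' \<in> kop p" "S \<in> bop p" "T \<in> bop p" "T' \<in> bop p"
  shows "(S \<circ> T) - (S' \<circ> T') \<in> kop p"
proof -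
  have "(S \<circ> T) - (S' \<circ> T') = (S \<circ> (T - T')) + ((S - S') \<circ> T')"
    by (simp add: comp_add_left comp_add_right[OF assms(3,4,5)])
  then show ?thesis using kop_add[OF kop_comp_left[OF assms(2,3)] kop_comp_right[OF assms(1,5)]] by simp
qed

lemma calkin_ops:
  assumes "S \<in> bop p" "T \<in> bop p"
  shows "ba_add (calkin p) (q S) (q T) = q (S + T)" "ba_mult (calkin p) (q S) (q T) = q (S \<circ> T)"
    "ba_scale (calkin p) a (q T) = q (op_scale a T)"
proof -
  note r = calk_rep[OF assms(1)] and t = calk_rep[OF assms(2)]
  have "calk_rep p (q S) + calk_rep p (q T) - (S + T) = (calk_rep p (q S) - S) + (calk_rep p (q T) - T)"
    by (simp add: algebra_simps)
  then have "calk_rep p (q S) + calk_rep p (q T) - (S + T) \<in> kop p"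
    using kop_add[OF r(3) t(3)] by (simp only:)
  from calk_pi_eqI[OF this] show "ba_add (calkin p) (q S) (q T) = q (S + T)"
    by (simp add: calkin_def op_add_eq)
  show "ba_mult (calkin p) (q S) (q T) = q (S \<circ> T)"
    unfolding calkin_def by simp (rule calk_pi_eqI, rule kop_comp_diff[OF r(3) t(3) r(1) t(1) assms(2)])
  have "op_scale a (calk_rep p (q T)) - op_scale a T = op_scale a (calk_rep p (q T) - T)"
    by (auto simp: op_scale_def vscale_def fun_eq_iff algebra_simps)
  then show "ba_scale (calkin p) a (q T) = q (op_scale a T)"
    using kop_scale[OF t(3), of a] by (simp add: calkin_def calk_pi_eqI)
qed

section \<open>Direct sums of two operators on the even and the odd coordinates\<close>

definition ev :: "nat \<Rightarrow> nat" where "ev k = 2 * k"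
definition od :: "nat \<Rightarrow> nat" where "od k = 2 * k + 1"

lemma inj_ev: "inj ev" and inj_od: "inj od"
  by (auto simp: inj_def ev_def od_def)

lemma ev_od_cases: obtains k where "n = ev k" | k where "n = od k"
  by (metis ev_def od_def evenE oddE)

lemma ev_od_ne: "ev k \<noteq> od l" "od l \<noteq> ev k"
  unfolding ev_def od_def by presburger+

text \<open>This is the conjugate of a direct sum by \<open>S0\<close>, written with operators on
  one space, so that sums, products and compactness follow from those of \<open>emb\<close> and
  \<open>res\<close>.\<close>

definition dsum2 :: "lpop \<Rightarrow> lpop \<Rightarrow> lpop" where
  "dsum2 S T = (emb ev \<circ> S \<circ> res ev) + (emb od \<circ> T \<circ> res od)"

lemma emb_res_bop: "inj g \<Longrightarrow> emb g \<in> bop p" "inj g \<Longrightarrow> res g \<in> bop p"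
  using nbD(1)[OF nb_emb] nbD(1)[OF nb_res] by auto

lemmas eo_bop [simp] = emb_res_bop[OF inj_ev] emb_res_bop[OF inj_od]

lemma nb_dsum2: "nb S c \<Longrightarrow> nb T d \<Longrightarrow> nb (dsum2 S T) (c + d)"
  using nb_add[OF nb_comp[OF nb_comp[OF nb_emb[OF inj_ev]] nb_res[OF inj_ev], of S c]
    nb_comp[OF nb_comp[OF nb_emb[OF inj_od]] nb_res[OF inj_od], of T d]] by (simp add: dsum2_def)

lemma dsum2_bop [simp]: "S \<in> bop p \<Longrightarrow> T \<in> bop p \<Longrightarrow> dsum2 S T \<in> bop p"
  unfolding dsum2_def by simp

lemma dsum2_apply:
  assumes "S \<in> bop p" "T \<in> bop p" "x \<in> L"
  shows "dsum2 S T x (ev k) = S (x \<circ> ev) k" "dsum2 S T x (od k) = T (x \<circ> od) k"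
proof -
  have L: "S (x \<circ> ev) \<in> L" "T (x \<circ> od) \<in> L"
    by (rule bop_lp[OF assms(1) lp_comp_inj(1)[OF assms(3) inj_ev]], rule bop_lp[OF assms(2) lp_comp_inj(1)[OF assms(3) inj_od]])
  have "ev k \<notin> range od" "od k \<notin> range ev" using ev_od_ne by auto
  then show "dsum2 S T x (ev k) = S (x \<circ> ev) k" "dsum2 S T x (od k) = T (x \<circ> od) k"
    using L assms(3) inj_ev inj_od by (auto simp: dsum2_def emb_def res_def)
qed

lemma dsum2_comp_eo:
  assumes "S \<in> bop p" "T \<in> bop p" "x \<in> L"
  shows "dsum2 S T x \<circ> ev = S (x \<circ> ev)" "dsum2 S T x \<circ> od = T (x \<circ> od)"
  using dsum2_apply[OF assms] by auto

lemma eo_ext: "(\<And>k. x (ev k) = y (ev k)) \<Longrightarrow> (\<And>k. x (od k) = y (od k)) \<Longrightarrow> x = y"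
  by (rule ext) (metis ev_od_cases)

lemma dsum2_comp:
  assumes "S \<in> bop p" "T \<in> bop p" "S' \<in> bop p" "T' \<in> bop p"
  shows "dsum2 S T \<circ> dsum2 S' T' = dsum2 (S \<circ> S') (T \<circ> T')"
proof (rule bop_ext)
  show "dsum2 S T \<circ> dsum2 S' T' \<in> bop p" "dsum2 (S \<circ> S') (T \<circ> T') \<in> bop p" using assms by auto
  fix x assume x: "x \<in> L"
  have d: "dsum2 S' T' x \<in> L" using bop_lp[OF dsum2_bop[OF assms(3,4)] x] .
  have cb: "S \<circ> S' \<in> bop p" "T \<circ> T' \<in> bop p" using assms by auto
  show "(dsum2 S T \<circ> dsum2 S' T') x = dsum2 (S \<circ> S') (T \<circ> T') x"
    by (rule eo_ext)
      (simp_all only: comp_apply[of "dsum2 S T"] dsum2_apply[OF assms(1,2) d] dsum2_comp_eo[OF assms(3,4) x] dsum2_apply[OF cb x] comp_apply)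
qed

lemma dsum2_add:
  assumes "S \<in> bop p" "T \<in> bop p" "S' \<in> bop p" "T' \<in> bop p"
  shows "dsum2 S T + dsum2 S' T' = dsum2 (S + S') (T + T')" "dsum2 S T - dsum2 S' T' = dsum2 (S - S') (T - T')"
  unfolding dsum2_def using assms by (simp_all add: comp_add_left comp_add_right)

lemma dsum2_scale:
  assumes "S \<in> bop p" "T \<in> bop p" shows "op_scale a (dsum2 S T) = dsum2 (op_scale a S) (op_scale a T)"
proof -
  have "op_scale a (A + B) = op_scale a A + op_scale a B" for A B by (auto simp: op_scale_def vscale_def fun_eq_iff algebra_simps)
  then show ?thesis unfolding dsum2_def using assms by (simp add: comp_scale_left comp_scale_right)
qed

lemma dsum2_one: "dsum2 (op_one p) (op_one p) = op_one p"
proof (rule bop_ext)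
  show "dsum2 (op_one p) (op_one p) \<in> bop p" "op_one p \<in> bop p" using one_bop by auto
  fix x assume x: "x \<in> L"
  show "dsum2 (op_one p) (op_one p) x = op_one p x"
    using lp_comp_inj(1)[OF x inj_ev] lp_comp_inj(1)[OF x inj_od]
    by (intro eo_ext; simp only: dsum2_apply[OF one_bop(2) one_bop(2) x]; simp add: op_one_def x)
qed

lemma dsum2_kop: "S \<in> kop p \<Longrightarrow> T \<in> kop p \<Longrightarrow> dsum2 S T \<in> kop p"
  unfolding dsum2_def by (intro kop_add kop_comp_left kop_comp_right eo_bop)

lemma res_dsum2_emb:
  assumes "S \<in> bop p" "T \<in> bop p"
  shows "res ev \<circ> dsum2 S T \<circ> emb ev = S" "res od \<circ> dsum2 S T \<circ> emb od = T"
proof -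
  have *: "emb ev x \<in> L" "emb ev x \<circ> ev = x" "emb od x \<in> L" "emb od x \<circ> od = x" if "x \<in> L" for x
    using lp_extend_inj(1)[OF that inj_ev] lp_extend_inj(1)[OF that inj_od] that inj_ev inj_od
    by (auto simp: emb_def fun_eq_iff)
  show "res ev \<circ> dsum2 S T \<circ> emb ev = S"
  proof (rule bop_ext[OF _ assms(1)])
    fix x assume x: "x \<in> L"
    show "(res ev \<circ> dsum2 S T \<circ> emb ev) x = S x"
      using dsum2_comp_eo(1)[OF assms *(1)[OF x]] bop_lp[OF dsum2_bop[OF assms] *(1)[OF x]] *(2)[OF x] by (simp add: res_def)
  qed (use assms in simp)
  show "res od \<circ> dsum2 S T \<circ> emb od = T"
  proof (rule bop_ext[OF _ assms(2)])
    fix x assume x: "x \<in> L"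
    show "(res od \<circ> dsum2 S T \<circ> emb od) x = T x"
      using dsum2_comp_eo(2)[OF assms *(3)[OF x]] bop_lp[OF dsum2_bop[OF assms] *(3)[OF x]] *(4)[OF x] by (simp add: res_def)
  qed (use assms in simp)
qed

lemma S0_dsum2:
  assumes "S \<in> bop p" "T \<in> bop p"
  shows "S0 \<circ> op_dsum S T \<circ> S0_inv p = dsum2 S T"
proof
  fix x
  show "(S0 \<circ> op_dsum S T \<circ> S0_inv p) x = dsum2 S T x"
  proof (cases "x \<in> L")
    case True
    have "(\<lambda>n. x (2 * n)) = x \<circ> ev" "(\<lambda>n. x (2 * n + 1)) = x \<circ> od" by (auto simp: ev_def od_def)
    then have "(S0 \<circ> op_dsum S T \<circ> S0_inv p) x = S0 (S (x \<circ> ev), T (x \<circ> od))"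
      using True by (simp add: S0_inv_def op_dsum_def)
    also have "\<dots> = dsum2 S T x"
      by (rule eo_ext) (simp_all add: dsum2_apply[OF assms True] S0_def, simp_all add: ev_def od_def)
    finally show ?thesis .
  next
    case False
    then show ?thesis using bop_off[OF dsum2_bop[OF assms] False]
      by (auto simp: S0_inv_def op_dsum_def S0_def bop_zero[OF assms(1)] bop_zero[OF assms(2)])
  qed
qed

text \<open>\<open>calk_rep\<close> chooses unknown representatives. They differ from S and T by
  compact operators, whose direct sum is compact, so any representatives may be used.\<close>

lemma ext_sum_eq:
  assumes "\<psi>1 a = q S" "\<psi>2 a = q T" "S \<in> bop p" "T \<in> bop p"
  shows "ext_sum p \<psi>1 \<psi>2 a = q (dsum2 S T)"
proof -
  note r = calk_rep[OF assms(3)] and t = calk_rep[OF assms(4)]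
  have "ext_sum p \<psi>1 \<psi>2 a = q (dsum2 (calk_rep p (q S)) (calk_rep p (q T)))"
    unfolding ext_sum_def assms(1,2) S0_dsum2[OF r(1) t(1)] ..
  also have "\<dots> = q (dsum2 S T)"
    by (rule calk_pi_eqI) (use dsum2_kop[OF r(3) t(3)] in \<open>simp add: dsum2_add[OF r(1) t(1) assms(3,4)]\<close>)
  finally show ?thesis .
qed

text \<open>Equivalence is obtained from an intertwining relation modulo compacts, which needs no
  inverse in its statement and is stable under composition.\<close>

lemma ext_equivI:
  assumes S: "S \<in> bop p" "S' \<in> bop p" "S \<circ> S' = op_one p" "S' \<circ> S = op_one p"
    and a: "\<And>a. a \<in> ba_carrier A \<Longrightarrow> \<exists>T T'. T \<in> bop p \<and> T' \<in> bop p \<and> \<psi>1 a = q T \<and> \<psi>2 a = q T' \<and> (S \<circ> T) - (T' \<circ> S) \<in> kop p"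
  shows "ext_equiv p A \<psi>1 \<psi>2"
  unfolding ext_equiv_def
proof (intro bexI conjI ballI)
  fix a assume "a \<in> ba_carrier A"
  then obtain T T' where T: "T \<in> bop p" "T' \<in> bop p" "\<psi>1 a = q T" "\<psi>2 a = q T'" "(S \<circ> T) - (T' \<circ> S) \<in> kop p"
    using a by blast
  have "ba_mult (calkin p) (ba_mult (calkin p) (q S) (\<psi>1 a)) (q S') = q (S \<circ> T \<circ> S')"
    unfolding T(3) using S T by (simp add: calkin_ops)
  also have "\<dots> = q T'"
  proof (rule calk_pi_eqI)
    have "(S \<circ> T \<circ> S') - T' = ((S \<circ> T) - (T' \<circ> S)) \<circ> S'"
      unfolding comp_add_left comp_assoc S(3) one_comp(2)[OF T(2)] ..
    then show "(S \<circ> T \<circ> S') - T' \<in> kop p" using kop_comp_right[OF T(5) S(2)] by simp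
  qed
  finally show "\<psi>2 a = ba_mult (calkin p) (ba_mult (calkin p) (q S) (\<psi>1 a)) (q S')" using T(4) by simp
qed (use S in auto)

lemma bops_simps [simp]:
  "ba_carrier (bops p) = bop p" "ba_add (bops p) = (+)" "ba_scale (bops p) = op_scale" "ba_mult (bops p) = (\<circ>)"
  "ba_one (bops p) = op_one p" "ba_norm (bops p) = op_norm p"
  by (auto simp: bops_def op_add_eq fun_eq_iff op_add_def)

lemma bounded_hom_nb:
  assumes "bounded_hom A (bops p) \<rho>"
  obtains K where "0 \<le> K" "\<And>a. a \<in> ba_carrier A \<Longrightarrow> 0 \<le> ba_norm A a \<Longrightarrow> nb (\<rho> a) (K * ba_norm A a)"
proof -
  obtain K where K: "\<And>a. a \<in> ba_carrier A \<Longrightarrow> \<rho> a \<in> bop p" "\<And>a. a \<in> ba_carrier A \<Longrightarrow> op_norm p (\<rho> a) \<le> K * ba_norm A a"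
    using assms unfolding bounded_hom_def ba_hom_def bops_simps by blast
  show ?thesis
  proof (rule that[of "max K 0"])
    fix a assume a: "a \<in> ba_carrier A" "0 \<le> ba_norm A a"
    then have "K * ba_norm A a \<le> max K 0 * ba_norm A a" by (intro mult_right_mono) auto
    then show "nb (\<rho> a) (max K 0 * ba_norm A a)" using nb_mono[OF nb_op_norm[OF K(1)[OF a(1)]]] K(2)[OF a(1)] by simp
  qed auto
qed

lemma calkin_norm_le: assumes "S \<in> q T" shows "ba_norm (calkin p) (q T) \<le> op_norm p S"
proof -
  have "bdd_below (op_norm p ` q T)" by (rule bdd_belowI[of _ 0]) (auto simp: calk_pi_mem op_norm_nonneg)
  then show ?thesis unfolding calkin_def using assms by (auto intro: cInf_lower)
qed

lemma op_norm_compress: assumes "inj g" "S \<in> bop p" shows "op_norm p (res g \<circ> S \<circ> emb g) \<le> op_norm p S"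
  using op_norm_le[OF nb_comp[OF nb_comp[OF nb_res[OF assms(1)] nb_op_norm[OF assms(2)]] nb_emb[OF assms(1)]]] by simp

text \<open>Compression to the coordinates in the range of g is contractive and preserves
  compactness, so the lower bounds of \<rho>, among operators and modulo compacts, pass to D. The
  other summands of D only have to be bounded.\<close>

lemma trivial_dilation:
  assumes \<theta>: "iso_ext p A \<theta>" and \<rho>: "unital_iso_into A (bops p) \<rho>" and \<theta>\<rho>: "\<And>a. a \<in> ba_carrier A \<Longrightarrow> \<theta> a = q (\<rho> a)"
    and D: "unital_bounded_hom A (bops p) D" and g: "inj g"
    and gD: "\<And>a. a \<in> ba_carrier A \<Longrightarrow> res g \<circ> D a \<circ> emb g = \<rho> a"
  shows "trivial_ext p A (\<lambda>a. q (D a))"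
proof -
  note eb = emb_res_bop[OF g]
  have Db: "D a \<in> bop p" if "a \<in> ba_carrier A" for a
    using D that by (auto simp: unital_bounded_hom_def bounded_hom_def ba_hom_def)
  have Dhom: "ba_hom A (bops p) D" and D1: "D (ba_one A) = op_one p"
    using D by (auto simp: unital_bounded_hom_def bounded_hom_def)
  obtain K where K: "\<And>a. a \<in> ba_carrier A \<Longrightarrow> op_norm p (D a) \<le> K * ba_norm A a"
    using D by (auto simp: unital_bounded_hom_def bounded_hom_def)
  obtain c1 where c1: "0 < c1" "\<And>a. a \<in> ba_carrier A \<Longrightarrow> c1 * ba_norm A a \<le> op_norm p (\<rho> a)"
    using \<rho> by (auto simp: unital_iso_into_def iso_into_def)
  obtain c2 where c2: "0 < c2" "\<And>a. a \<in> ba_carrier A \<Longrightarrow> c2 * ba_norm A a \<le> ba_norm (calkin p) (q (\<rho> a))"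
    using \<theta> \<theta>\<rho> by (auto simp: iso_ext_def unital_iso_into_def iso_into_def)
  have "unital_iso_into A (bops p) D"
    unfolding unital_iso_into_def iso_into_def
  proof (intro conjI exI[of _ c1] ballI)
    show "bounded_hom A (bops p) D" "D (ba_one A) = ba_one (bops p)" using D by (auto simp: unital_bounded_hom_def)
    fix a assume a: "a \<in> ba_carrier A"
    show "c1 * ba_norm A a \<le> ba_norm (bops p) (D a)"
      using c1(2)[OF a] op_norm_compress[OF g Db[OF a]] unfolding gD[OF a] by simp
  qed (rule c1)
  moreover have "iso_ext p A (\<lambda>a. q (D a))"
  proof -
    have self: "D a \<in> q (D a)" if "a \<in> ba_carrier A" for a using Db[OF that] kop_zero by (simp add: calk_pi_mem)
    have "bounded_hom A (calkin p) (\<lambda>a. q (D a))"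
      unfolding bounded_hom_def ba_hom_def
    proof (intro conjI exI[of _ K] ballI allI)
      fix a assume a: "a \<in> ba_carrier A"
      show "q (D a) \<in> ba_carrier (calkin p)" using Db[OF a] by (simp add: calkin_def)
      show "q (D (ba_scale A k a)) = ba_scale (calkin p) k (q (D a))" for k
        using Dhom a Db[OF a] by (simp add: ba_hom_def calkin_ops(3)[OF Db[OF a] Db[OF a]])
      show "q (D (ba_add A a b)) = ba_add (calkin p) (q (D a)) (q (D b))"
        "q (D (ba_mult A a b)) = ba_mult (calkin p) (q (D a)) (q (D b))" if b: "b \<in> ba_carrier A" for b
        using Dhom a b by (simp_all add: ba_hom_def calkin_ops[OF Db[OF a] Db[OF b]])
      show "ba_norm (calkin p) (q (D a)) \<le> K * ba_norm A a"
        using calkin_norm_le[OF self[OF a]] K[OF a] by (rule order_trans)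
    qed
    moreover have "c2 * ba_norm A a \<le> ba_norm (calkin p) (q (D a))" if a: "a \<in> ba_carrier A" for a
    proof -
      have "c2 * ba_norm A a \<le> Inf (op_norm p ` q (D a))"
      proof (rule cInf_greatest)
        show "op_norm p ` q (D a) \<noteq> {}" using self[OF a] by auto
        fix v assume "v \<in> op_norm p ` q (D a)"
        then obtain S where S: "v = op_norm p S" "S \<in> bop p" "S - D a \<in> kop p" by (auto simp: calk_pi_mem)
        \<comment> \<open>The compression of any representative S of D a is a representative of
          \<rho> a, so its norm is bounded below.\<close>
        have "(res g \<circ> S \<circ> emb g) - \<rho> a = res g \<circ> (S - D a) \<circ> emb g"
          unfolding gD[OF a, symmetric] comp_add_right(2)[OF eb(2) S(2) Db[OF a]] comp_add_left ..
        then have "res g \<circ> S \<circ> emb g \<in> q (\<rho> a)"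
          using kop_comp_right[OF kop_comp_left[OF S(3) eb(2)] eb(1)] S(2) eb by (simp add: calk_pi_mem)
        from calkin_norm_le[OF this] show "c2 * ba_norm A a \<le> v"
          using c2(2)[OF a] op_norm_compress[OF g S(2)] S(1) by simp
      qed
      then show ?thesis by (simp add: calkin_def)
    qed
    moreover have "q (D (ba_one A)) = ba_one (calkin p)" by (simp add: D1 calkin_def)
    ultimately show ?thesis unfolding iso_ext_def unital_iso_into_def iso_into_def using c2(1) by blast
  qed
  ultimately show ?thesis unfolding trivial_ext_def by blast
qed

lemma dsum2_hom:
  assumes "unital_bounded_hom A (bops p) \<rho>1" "unital_bounded_hom A (bops p) \<rho>2"
  shows "unital_bounded_hom A (bops p) (\<lambda>a. dsum2 (\<rho>1 a) (\<rho>2 a))"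
proof -
  have b: "\<rho>1 a \<in> bop p" "\<rho>2 a \<in> bop p" if "a \<in> ba_carrier A" for a
    using assms that by (auto simp: unital_bounded_hom_def bounded_hom_def ba_hom_def)
  obtain K1 where K1: "\<And>a. a \<in> ba_carrier A \<Longrightarrow> op_norm p (\<rho>1 a) \<le> K1 * ba_norm A a"
    using assms by (auto simp: unital_bounded_hom_def bounded_hom_def)
  obtain K2 where K2: "\<And>a. a \<in> ba_carrier A \<Longrightarrow> op_norm p (\<rho>2 a) \<le> K2 * ba_norm A a"
    using assms by (auto simp: unital_bounded_hom_def bounded_hom_def)
  show ?thesis
    unfolding unital_bounded_hom_def bounded_hom_def
  proof (intro conjI exI[of _ "K1 + K2"] ballI)
    show "ba_hom A (bops p) (\<lambda>a. dsum2 (\<rho>1 a) (\<rho>2 a))"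
      using assms b by (simp add: unital_bounded_hom_def bounded_hom_def ba_hom_def dsum2_comp dsum2_add dsum2_scale)
    show "dsum2 (\<rho>1 (ba_one A)) (\<rho>2 (ba_one A)) = ba_one (bops p)"
      using assms by (simp add: unital_bounded_hom_def dsum2_one)
    fix a assume a: "a \<in> ba_carrier A"
    show "ba_norm (bops p) (dsum2 (\<rho>1 a) (\<rho>2 a)) \<le> (K1 + K2) * ba_norm A a"
      using op_norm_le[OF nb_dsum2[OF nb_op_norm[OF b(1)[OF a]] nb_op_norm[OF b(2)[OF a]]]] K1[OF a] K2[OF a]
      by (simp add: distrib_right)
  qed
qed

end

section \<open>Uniform boundedness\<close>

text \<open>The algebra is a carrier in an arbitrary type, so addition, subtraction and the norm
  inequalities are derived from the stated axioms for elements of the carrier.\<close>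

locale banach_alg =
  fixes A :: "'a cbalg"
  assumes A: "unital_cbanach_algebra A"
begin

abbreviation "C \<equiv> ba_carrier A"
abbreviation "N \<equiv> ba_norm A"
abbreviation "D \<equiv> ba_diff A"

lemma axioms:
  "ba_zero A \<in> C" "ba_one A \<in> C" "\<forall>x\<in>C. \<forall>y\<in>C. ba_add A x y \<in> C \<and> ba_mult A x y \<in> C"
  "\<forall>c. \<forall>x\<in>C. ba_scale A c x \<in> C"
  "\<forall>x\<in>C. \<forall>y\<in>C. \<forall>w\<in>C. ba_add A (ba_add A x y) w = ba_add A x (ba_add A y w)"
  "\<forall>x\<in>C. \<forall>y\<in>C. ba_add A x y = ba_add A y x"
  "\<forall>x\<in>C. ba_add A (ba_zero A) x = x"
  "\<forall>x\<in>C. ba_add A x (ba_scale A (-1) x) = ba_zero A"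
  "\<forall>c. \<forall>x\<in>C. \<forall>y\<in>C. ba_scale A c (ba_add A x y) = ba_add A (ba_scale A c x) (ba_scale A c y)"
  "\<forall>c d. \<forall>x\<in>C. ba_scale A c (ba_scale A d x) = ba_scale A (c * d) x"
  "\<forall>x\<in>C. ba_scale A 1 x = x"
  "\<forall>x\<in>C. N x = 0 \<longleftrightarrow> x = ba_zero A"
  "\<forall>x\<in>C. \<forall>y\<in>C. N (ba_add A x y) \<le> N x + N y"
  "\<forall>c. \<forall>x\<in>C. N (ba_scale A c x) = cmod c * N x"
  by (insert A[unfolded unital_cbanach_algebra_def Let_def], (elim conjE, assumption)+)

lemma closed: "ba_zero A \<in> C" "ba_one A \<in> C" "x \<in> C \<Longrightarrow> y \<in> C \<Longrightarrow> ba_add A x y \<in> C"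
    "x \<in> C \<Longrightarrow> y \<in> C \<Longrightarrow> ba_mult A x y \<in> C" "x \<in> C \<Longrightarrow> ba_scale A k x \<in> C"
  using axioms(1-4) by simp_all

lemma add_assoc: "x \<in> C \<Longrightarrow> y \<in> C \<Longrightarrow> z \<in> C \<Longrightarrow> ba_add A (ba_add A x y) z = ba_add A x (ba_add A y z)"
  and add_comm: "x \<in> C \<Longrightarrow> y \<in> C \<Longrightarrow> ba_add A x y = ba_add A y x"
  and add_zero: "x \<in> C \<Longrightarrow> ba_add A (ba_zero A) x = x"
  and add_inv: "x \<in> C \<Longrightarrow> ba_add A x (ba_scale A (-1) x) = ba_zero A"
  and scale_add: "x \<in> C \<Longrightarrow> y \<in> C \<Longrightarrow> ba_scale A k (ba_add A x y) = ba_add A (ba_scale A k x) (ba_scale A k y)"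
  and scale_scale: "x \<in> C \<Longrightarrow> ba_scale A k (ba_scale A l x) = ba_scale A (k * l) x"
  and scale_one: "x \<in> C \<Longrightarrow> ba_scale A 1 x = x"
  and norm_zero_iff: "x \<in> C \<Longrightarrow> N x = 0 \<longleftrightarrow> x = ba_zero A"
  and norm_add: "x \<in> C \<Longrightarrow> y \<in> C \<Longrightarrow> N (ba_add A x y) \<le> N x + N y"
  and norm_scale: "x \<in> C \<Longrightarrow> N (ba_scale A k x) = cmod k * N x"
  by (simp only: axioms(5), rule axioms(6)[rule_format], assumption+, simp only: axioms(7), simp only: axioms(8),
      simp only: axioms(9), simp only: axioms(10), simp only: axioms(11), simp only: axioms(12),
      simp only: axioms(13), simp only: axioms(14))

lemma complete:
  assumes "\<And>n. xs n \<in> C" "\<And>e. 0 < e \<Longrightarrow> \<exists>M. \<forall>m\<ge>M. \<forall>n\<ge>M. N (D (xs m) (xs n)) < e"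
  obtains x where "x \<in> C" "(\<lambda>n. N (D (xs n) x)) \<longlonglongrightarrow> 0"
proof -
  have "\<forall>xs. (\<forall>n. xs n \<in> C) \<longrightarrow> (\<forall>\<epsilon>>0. \<exists>M. \<forall>m\<ge>M. \<forall>n\<ge>M. N (D (xs m) (xs n)) < \<epsilon>) \<longrightarrow>
      (\<exists>x\<in>C. (\<lambda>n. N (D (xs n) x)) \<longlonglongrightarrow> 0)"
    using A[unfolded unital_cbanach_algebra_def Let_def] by (elim conjE) assumption
  then have "\<exists>x\<in>C. (\<lambda>n. N (D (xs n) x)) \<longlonglongrightarrow> 0" using assms by simp
  then show ?thesis using that by blast
qed

lemma diff_closed: "x \<in> C \<Longrightarrow> y \<in> C \<Longrightarrow> D x y \<in> C"
  by (simp add: ba_diff_def closed)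

lemma norm_nonneg: assumes "x \<in> C" shows "0 \<le> N x"
proof -
  have "0 = N (ba_add A x (ba_scale A (-1) x))" using norm_zero_iff[OF closed(1)] by (simp add: add_inv[OF assms])
  also have "\<dots> \<le> N x + N x" using norm_add[OF assms closed(5)[OF assms], of "-1"] by (simp add: norm_scale[OF assms])
  finally show ?thesis by simp
qed

lemma diff_add_cancel: assumes "x \<in> C" "y \<in> C" shows "ba_add A (D x y) y = x"
proof -
  have m: "ba_scale A (-1) y \<in> C" using assms closed by simp
  have "ba_add A (D x y) y = ba_add A x (ba_add A y (ba_scale A (-1) y))"
    unfolding ba_diff_def using assms m by (simp add: add_assoc add_comm)
  also have "\<dots> = x" using assms add_zero add_comm closed(1) by (simp add: add_inv)
  finally show ?thesis .
qed

lemma diff_telescope: assumes "x \<in> C" "y \<in> C" "z \<in> C" shows "D x z = ba_add A (D x y) (D y z)"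
proof -
  have m: "ba_scale A (-1) z \<in> C" using assms closed by simp
  have "ba_add A (D x y) (D y z) = ba_add A (ba_add A (D x y) y) (ba_scale A (-1) z)"
    unfolding ba_diff_def[of A y z] using add_assoc[OF diff_closed[OF assms(1,2)] assms(2) m] by simp
  then show ?thesis unfolding diff_add_cancel[OF assms(1,2)] by (simp add: ba_diff_def)
qed

lemma norm_diff_triangle: "x \<in> C \<Longrightarrow> y \<in> C \<Longrightarrow> z \<in> C \<Longrightarrow> N (D x z) \<le> N (D x y) + N (D y z)"
  using norm_add[of "D x y" "D y z"] diff_telescope[of x y z] diff_closed by simp

lemma norm_diff_sym: assumes "x \<in> C" "y \<in> C" shows "N (D x y) = N (D y x)"
proof -
  have m: "ba_scale A (-1) y \<in> C" "ba_scale A (-1) x \<in> C" using assms closed by auto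
  have "ba_scale A (-1) (D y x) = ba_add A (ba_scale A (-1) y) (ba_scale A (-1) (ba_scale A (-1) x))"
    unfolding ba_diff_def by (rule scale_add[OF assms(2) m(2)])
  also have "\<dots> = D x y" unfolding ba_diff_def scale_scale[OF assms(1)] using assms m by (simp add: scale_one add_comm)
  finally show ?thesis using norm_scale[OF diff_closed[OF assms(2,1)], of "-1"] by simp
qed

lemma norm_le_diff: "x \<in> C \<Longrightarrow> y \<in> C \<Longrightarrow> N x \<le> N y + N (D x y)"
  using norm_add[of "D x y" y] diff_closed[of x y] diff_add_cancel[of x y] by simp

lemma diff_self: "x \<in> C \<Longrightarrow> D x x = ba_zero A"
  by (simp add: ba_diff_def add_inv)

lemma diff_of_add: assumes "x \<in> C" "y \<in> C" shows "D (ba_add A x y) x = y"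
proof -
  have m: "ba_scale A (-1) x \<in> C" using assms closed by simp
  have "D (ba_add A x y) x = ba_add A y (ba_add A x (ba_scale A (-1) x))"
    unfolding ba_diff_def using add_assoc[OF assms(2,1) m] by (simp add: add_comm[OF assms])
  then show ?thesis using assms add_zero add_comm closed(1) by (simp add: add_inv)
qed

end

text \<open>The seminorms \<open>s i\<close> stand for \<open>x \<mapsto> norm (T i x)\<close>; the contradiction comes from a point common to nested
  balls on which \<open>s i\<close> exceeds larger and larger bounds.\<close>

lemma (in banach_alg) uniform_boundedness:
  fixes s :: "'i \<Rightarrow> 'a \<Rightarrow> real"
  assumes nn: "\<And>i x. i \<in> I \<Longrightarrow> x \<in> C \<Longrightarrow> 0 \<le> s i x"
    and sub: "\<And>i x y. i \<in> I \<Longrightarrow> x \<in> C \<Longrightarrow> y \<in> C \<Longrightarrow> s i x \<le> s i y + s i (D x y)"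
    and hom: "\<And>i x k. i \<in> I \<Longrightarrow> x \<in> C \<Longrightarrow> s i (ba_scale A k x) = cmod k * s i x"
    and bdd: "\<And>i. i \<in> I \<Longrightarrow> \<exists>K. \<forall>x\<in>C. s i x \<le> K * N x"
    and pw: "\<And>x. x \<in> C \<Longrightarrow> \<exists>M. \<forall>i\<in>I. s i x \<le> M"
  shows "\<exists>K. \<forall>i\<in>I. \<forall>x\<in>C. s i x \<le> K * N x"
proof (rule ccontr)
  assume not: "\<not> ?thesis"
  have sym: "s i (D x y) = s i (D y x)" if "i \<in> I" "x \<in> C" "y \<in> C" for i x y
  proof -
    have m: "ba_scale A (-1) y \<in> C" "ba_scale A (-1) x \<in> C" using that closed by auto
    have "ba_scale A (-1) (D y x) = ba_add A (ba_scale A (-1) y) (ba_scale A (-1) (ba_scale A (-1) x))"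
      unfolding ba_diff_def by (rule scale_add[OF that(3) m(2)])
    also have "\<dots> = D x y" unfolding ba_diff_def scale_scale[OF that(2)] using that m by (simp add: scale_one add_comm)
    finally show ?thesis using hom[OF that(1) diff_closed[OF that(3,2)], of "-1"] by simp
  qed
  \<comment> \<open>If every \<open>s i\<close> stayed below M on a ball of radius r, an element
    scaled to norm r would be the difference of two points of that ball, giving the uniform constant
    2M/r.\<close>
  have far: "\<exists>y i. y \<in> C \<and> i \<in> I \<and> N (D y x) \<le> r \<and> M < s i y" if x: "x \<in> C" and r: "0 < r" for x r M
  proof (rule ccontr)
    assume "\<not> ?thesis"
    then have no: "\<And>y i. y \<in> C \<Longrightarrow> i \<in> I \<Longrightarrow> N (D y x) \<le> r \<Longrightarrow> s i y \<le> M" by (meson not_le)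
    have "s i z \<le> (2 * M / r) * N z" if i: "i \<in> I" and z: "z \<in> C" for i z
    proof (cases "N z = 0")
      case True
      obtain K where "\<forall>x\<in>C. s i x \<le> K * N x" using bdd[OF i] by blast
      then show ?thesis using z True by auto
    next
      case False
      then have nz: "0 < N z" using norm_nonneg[OF z] by simp
      define k where "k = complex_of_real (r / N z)"
      have kk: "cmod k = r / N z" using r nz by (simp add: k_def norm_divide)
      define w where "w = ba_scale A k z"
      have w: "w \<in> C" "N w = r" using z nz by (auto simp: w_def closed norm_scale kk)
      define y where "y = ba_add A x w"
      have y: "y \<in> C" "D y x = w" using x w by (auto simp: y_def closed diff_of_add)
      have "s i y \<le> M" by (rule no[OF y(1) i]) (simp add: y(2) w(2))
      moreover have "N (D x x) = 0" unfolding diff_self[OF x] using norm_zero_iff[OF closed(1)] by simp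
      then have "s i x \<le> M" using r by (intro no[OF x i]) simp
      moreover have "s i (D y x) \<le> s i y + s i x"
      proof -
        have "ba_add A w x = y" using x w by (simp add: y_def add_comm)
        have "s i w \<le> s i y + s i (D w y)" by (rule sub[OF i w(1) y(1)])
        also have "s i (D w y) = s i (D y w)" by (rule sym[OF i w(1) y(1)])
        also have "D y w = x" using diff_of_add[OF w(1) x] \<open>ba_add A w x = y\<close> by simp
        finally show ?thesis unfolding y(2) .
      qed
      ultimately have "s i w \<le> 2 * M" unfolding y(2) by linarith
      then have "r / N z * s i z \<le> 2 * M" unfolding w_def hom[OF i z] kk .
      then show ?thesis using nz r by (simp add: field_simps)
    qed
    then have "\<forall>i\<in>I. \<forall>z\<in>C. s i z \<le> (2 * M / r) * N z" by (intro ballI)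
    then show False using not by (simp only: not_ex)
  qed
  \<comment> \<open>At y the seminorm exceeds M + 1, and on a ball of radius at most 1/(|K| + 1) it
    loses at most 1.\<close>
  have step: "\<exists>y r' i. y \<in> C \<and> i \<in> I \<and> 0 < r' \<and> r' \<le> r / 2 \<and> N (D y x) \<le> r / 2 \<and> (\<forall>z\<in>C. N (D z y) \<le> r' \<longrightarrow> M < s i z)"
    if x: "x \<in> C" and r: "0 < r" for x r M
  proof -
    obtain y i where y: "y \<in> C" "i \<in> I" "N (D y x) \<le> r / 2" "M + 1 < s i y"
      using far[OF x half_gt_zero[OF r], of "M + 1"] by (elim exE conjE) (rule that)
    obtain K where K: "\<forall>x\<in>C. s i x \<le> K * N x" using bdd[OF y(2)] by blast
    define r' where "r' = min (r / 2) (1 / (\<bar>K\<bar> + 1))"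
    have r': "0 < r'" "r' \<le> r / 2" "r' \<le> 1 / (\<bar>K\<bar> + 1)" using r by (auto simp: r'_def)
    have "M < s i z" if z: "z \<in> C" "N (D z y) \<le> r'" for z
    proof -
      have d: "0 \<le> N (D z y)" using norm_nonneg[OF diff_closed[OF z(1) y(1)]] .
      have "s i y \<le> s i z + s i (D y z)" by (rule sub[OF y(2,1) z(1)])
      also have "s i (D y z) = s i (D z y)" by (rule sym[OF y(2,1) z(1)])
      also have "\<dots> \<le> K * N (D z y)" using K diff_closed[OF z(1) y(1)] by blast
      also have "\<dots> \<le> (\<bar>K\<bar> + 1) * (1 / (\<bar>K\<bar> + 1))" using z(2) r'(3) d by (intro mult_mono) auto
      also have "\<dots> = 1" by simp
      finally show ?thesis using y(4) by simp
    qed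
    then show ?thesis using y(1-3) r'(1,2) by (intro exI[of _ y] exI[of _ r'] exI[of _ i]) simp
  qed
  have "\<exists>f. \<forall>n. (fst (f n) \<in> C \<and> 0 < snd (f n)) \<and>
      (snd (f (Suc n)) \<le> snd (f n) / 2 \<and> N (D (fst (f (Suc n))) (fst (f n))) \<le> snd (f n) / 2 \<and>
        (\<exists>i\<in>I. \<forall>z\<in>C. N (D z (fst (f (Suc n)))) \<le> snd (f (Suc n)) \<longrightarrow> real n < s i z))"
  proof (rule dependent_nat_choice[where P = "\<lambda>n g. fst g \<in> C \<and> 0 < snd g"
        and Q = "\<lambda>n g g'. snd g' \<le> snd g / 2 \<and> N (D (fst g') (fst g)) \<le> snd g / 2 \<and>
        (\<exists>i\<in>I. \<forall>z\<in>C. N (D z (fst g')) \<le> snd g' \<longrightarrow> real n < s i z)"])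
    show "\<exists>g. fst g \<in> C \<and> 0 < (snd g :: real)" using closed(1) by (intro exI[of _ "(ba_zero A, 1)"]) simp
    fix g :: "'a \<times> real" and n :: nat
    assume g: "fst g \<in> C \<and> 0 < snd g"
    obtain y r' i where "y \<in> C" "i \<in> I" "0 < r'" "r' \<le> snd g / 2" "N (D y (fst g)) \<le> snd g / 2" "\<forall>z\<in>C. N (D z y) \<le> r' \<longrightarrow> real n < s i z"
      using step[OF conjunct1[OF g] conjunct2[OF g], of "real n"] by (elim exE conjE) (rule that)
    then show "\<exists>g'. (fst g' \<in> C \<and> 0 < snd g') \<and> snd g' \<le> snd g / 2 \<and> N (D (fst g') (fst g)) \<le> snd g / 2 \<and>
        (\<exists>i\<in>I. \<forall>z\<in>C. N (D z (fst g')) \<le> snd g' \<longrightarrow> real n < s i z)"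
      by (intro exI[of _ "(y, r')"]) auto
  qed
  then obtain f where fa: "\<forall>n. (fst (f n) \<in> C \<and> 0 < snd (f n)) \<and>
      (snd (f (Suc n)) \<le> snd (f n) / 2 \<and> N (D (fst (f (Suc n))) (fst (f n))) \<le> snd (f n) / 2 \<and>
        (\<exists>i\<in>I. \<forall>z\<in>C. N (D z (fst (f (Suc n)))) \<le> snd (f (Suc n)) \<longrightarrow> real n < s i z))" ..
  have f: "\<And>n. fst (f n) \<in> C" "\<And>n. 0 < snd (f n)" "\<And>n. snd (f (Suc n)) \<le> snd (f n) / 2"
      "\<And>n. N (D (fst (f (Suc n))) (fst (f n))) \<le> snd (f n) / 2"
      "\<And>n. \<exists>i\<in>I. \<forall>z\<in>C. N (D z (fst (f (Suc n)))) \<le> snd (f (Suc n)) \<longrightarrow> real n < s i z"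
    by (simp_all only: spec[OF fa])
  define x r where "x n = fst (f n)" and "r n = snd (f n)" for n
  have xC: "x n \<in> C" for n using f by (simp add: x_def)
  have rp: "0 < r n" "r (Suc n) \<le> r n / 2" "N (D (x (Suc n)) (x n)) \<le> r n / 2" for n using f by (auto simp: x_def r_def)
  \<comment> \<open>Each move is at most half the current radius and the new radius is at most half
    the old one, so the balls are nested.\<close>
  have near: "N (D (x (n + k)) (x n)) \<le> r n - r (n + k)" for n k
  proof (induction k)
    case 0 show ?case using norm_zero_iff[OF closed(1)] by (simp add: diff_self[OF xC])
  next
    case (Suc k)
    have "N (D (x (n + Suc k)) (x n)) \<le> N (D (x (Suc (n + k))) (x (n + k))) + N (D (x (n + k)) (x n))"
      using norm_diff_triangle[OF xC xC xC] by simp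
    then show ?case using Suc rp(3)[of "n + k"] rp(2)[of "n + k"] by simp
  qed
  have near': "N (D (x m) (x n)) \<le> r n" if "n \<le> m" for m n
    using near[of n "m - n"] rp(1)[of m] that by simp
  have rlim: "r n \<le> r 0 * (1/2) ^ n" for n
  proof (induction n)
    case (Suc n)
    then show ?case using rp(2)[of n] by simp
  qed simp
  have "(\<lambda>n. r 0 * (1/2) ^ n) \<longlonglongrightarrow> r 0 * 0" by (intro tendsto_intros LIMSEQ_power_zero) simp
  then have r0: "r \<longlonglongrightarrow> 0" using rlim rp(1) by (intro tendsto_sandwich[OF _ _ tendsto_const[of 0], of r _ "\<lambda>n. r 0 * (1/2) ^ n"]) (auto intro!: always_eventually less_imp_le)
  obtain y where y: "y \<in> C" "(\<lambda>n. N (D (x n) y)) \<longlonglongrightarrow> 0"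
  proof (rule complete[of x])
    fix e :: real assume "0 < e"
    then have "\<forall>\<^sub>F n in sequentially. r n < e" using r0 by (intro order_tendstoD)
    then obtain n0 where n0: "\<And>n. n0 \<le> n \<Longrightarrow> r n < e" by (auto simp: eventually_sequentially)
    have "N (D (x m) (x n)) < e" if "n0 \<le> m" "n0 \<le> n" for m n
    proof (cases "n \<le> m")
      case True then show ?thesis using near'[OF True] n0[of n] that by simp
    next
      case False then show ?thesis using near'[of m n] n0[of m] that norm_diff_sym[OF xC xC, of m n] by simp
    qed
    then show "\<exists>M. \<forall>m\<ge>M. \<forall>n\<ge>M. N (D (x m) (x n)) < e" by blast
  qed (auto simp: xC)
  have yn: "N (D y (x n)) \<le> r n" for n
  proof (rule LIMSEQ_le_const)
    show "(\<lambda>m. N (D (x m) y) + r n) \<longlonglongrightarrow> r n" using tendsto_add[OF y(2) tendsto_const[of "r n"]] by simp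
    have "N (D y (x n)) \<le> N (D (x m) y) + r n" if "n \<le> m" for m
      using norm_diff_triangle[OF y(1) xC[of m] xC[of n]] near'[OF that] norm_diff_sym[OF y(1) xC[of m]] by simp
    then show "\<exists>M. \<forall>m\<ge>M. N (D y (x n)) \<le> N (D (x m) y) + r n" by blast
  qed
  obtain M where M: "\<forall>i\<in>I. s i y \<le> M" using pw[OF y(1)] by blast
  obtain n where n: "M < real n" using reals_Archimedean2 by blast
  obtain i where i: "i \<in> I" "\<forall>z\<in>C. N (D z (x (Suc n))) \<le> r (Suc n) \<longrightarrow> real n < s i z"
    using f(5)[of n, folded x_def r_def] by (elim bexE) (rule that)
  then have "i \<in> I" "real n < s i y" using yn[of "Suc n"] y(1) by simp_all
  then have "s i y \<le> M" using M by simp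
  then show False using \<open>real n < s i y\<close> n by linarith
qed

section \<open>Lifting an invertible extension\<close>

context lp_space
begin

text \<open>In a sum of the shape (\<phi> + \<psi>) + \<theta>1 the first summand occupies the
  multiples of 4.\<close>

definition g4 :: "nat \<Rightarrow> nat" where "g4 = ev \<circ> ev"

lemma inj_g4: "inj g4"
  unfolding g4_def using inj_ev by (rule inj_compose[OF inj_ev])

lemma g4_emb: "emb g4 = emb ev \<circ> emb ev" and g4_res: "res g4 = res ev \<circ> res ev"
proof -
  show "res g4 = res ev \<circ> res ev"
    using lp_comp_inj(1)[OF _ inj_ev] by (auto simp: res_def g4_def fun_eq_iff)
  show "emb g4 = emb ev \<circ> emb ev"
  proof
    fix x show "emb g4 x = (emb ev \<circ> emb ev) x"
    proof (cases "x \<in> L")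
      case True
      have e: "emb ev x \<in> L" by (rule bop_lp[OF eo_bop(1) True])
      have v: "emb ev y (ev k) = y k" "emb ev y (od k) = 0" if "y \<in> L" for y k
        using that inj_ev ev_od_ne by (auto simp: emb_def)
      have w: "emb g4 x n = (if n \<in> range g4 then x (inv g4 n) else 0)" for n using True by (simp add: emb_def)
      show ?thesis
      proof (rule eo_ext)
        fix k
        have "od k \<notin> range g4" using ev_od_ne by (auto simp: g4_def)
        then show "emb g4 x (od k) = (emb ev \<circ> emb ev) x (od k)" by (simp add: w v(2)[OF e])
        show "emb g4 x (ev k) = (emb ev \<circ> emb ev) x (ev k)"
        proof (cases rule: ev_od_cases[of k])
          case (1 l)
          then have "ev k = g4 l" by (simp add: g4_def)
          then have "emb g4 x (ev k) = x l" unfolding w using inj_g4 by simp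
          then show ?thesis by (simp add: v(1)[OF e] 1 v(1)[OF True])
        next
          case (2 l)
          then have "ev k \<notin> range g4" using inj_ev ev_od_ne by (auto simp: g4_def inj_eq)
          then show ?thesis by (simp add: v(1)[OF e] 2 v(2)[OF True] w)
        qed
      qed
    next
      case False
      then show ?thesis using bop_off[OF eo_bop(1) False] bop_off[OF emb_res_bop(1)[OF inj_g4] False] bop_zero[OF eo_bop(1)] by simp
    qed
  qed
qed

definition P4 :: lpop where "P4 = mulop (indicator (range g4))"

lemma P4_dsum2: "P4 = dsum2 (dsum2 (op_one p) 0) 0"
proof -
  have z: "emb od \<circ> 0 \<circ> res od = 0" using bop_zero[OF eo_bop(3)] by (auto simp: fun_eq_iff)
  have "P4 = emb g4 \<circ> res g4"
    unfolding emb_res[OF inj_g4] P4_def by (rule arg_cong[of _ _ mulop]) (auto simp: indicator_def)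
  also have "\<dots> = emb ev \<circ> (emb ev \<circ> op_one p \<circ> res ev) \<circ> res ev"
    unfolding g4_emb g4_res using one_comp[OF eo_bop(1)] by (simp add: comp_assoc)
  finally show ?thesis by (simp add: dsum2_def z)
qed

text \<open>Invertibility makes (\<phi> + \<psi>) + \<theta>1 conjugate to a sum of two trivial
  extensions, which lifts to a representation \<mu>. Conjugating \<mu> back gives \<rho>. Modulo
  compacts \<rho> b is diagonal with blocks lifting \<phi> b, \<psi> b and \<theta>1 b, which yields
  both the commutator with \<open>P4\<close> and the compression.\<close>

lemma invertible_extension_lift:
  assumes \<phi>: "iso_ext p A \<phi>" and inv: "red_invertible p A \<phi>"
  obtains \<rho> where "unital_bounded_hom A (bops p) \<rho>"
    "\<And>b. b \<in> ba_carrier A \<Longrightarrow> (P4 \<circ> \<rho> b) - (\<rho> b \<circ> P4) \<in> kop p"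
    "\<And>b. b \<in> ba_carrier A \<Longrightarrow> \<phi> b = q (res g4 \<circ> \<rho> b \<circ> emb g4)"
proof -
  have lift: "\<exists>T\<in>bop p. \<psi> b = q T" if "iso_ext p A \<psi>" "b \<in> ba_carrier A" for \<psi> b
  proof -
    have "ba_hom A (calkin p) \<psi>" using that(1) unfolding iso_ext_def unital_iso_into_def iso_into_def bounded_hom_def by (elim conjE)
    then have "\<psi> b \<in> ba_carrier (calkin p)" using that(2) by (simp add: ba_hom_def)
    then show ?thesis by (auto simp: calkin_def)
  qed
  obtain \<psi> \<theta> \<theta>1 \<theta>2 S S' where \<psi>: "iso_ext p A \<psi>" and \<theta>: "trivial_ext p A \<theta>" "trivial_ext p A \<theta>1" "trivial_ext p A \<theta>2"
    and S: "S \<in> bop p" "S' \<in> bop p" "S \<circ> S' = op_one p" "S' \<circ> S = op_one p"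
    and eq: "\<And>a. a \<in> ba_carrier A \<Longrightarrow> ext_sum p \<theta> \<theta>2 a =
       ba_mult (calkin p) (ba_mult (calkin p) (q S) (ext_sum p (ext_sum p \<phi> \<psi>) \<theta>1 a)) (q S')"
    using inv unfolding red_invertible_def red_equiv_def ext_equiv_def by metis
  obtain \<rho>0 where \<rho>0: "unital_iso_into A (bops p) \<rho>0" "\<And>a. a \<in> ba_carrier A \<Longrightarrow> \<theta> a = q (\<rho>0 a)"
    using \<theta>(1) unfolding trivial_ext_def by metis
  obtain \<rho>2 where \<rho>2: "unital_iso_into A (bops p) \<rho>2" "\<And>a. a \<in> ba_carrier A \<Longrightarrow> \<theta>2 a = q (\<rho>2 a)"
    using \<theta>(3) unfolding trivial_ext_def by metis
  define \<mu> where "\<mu> b = dsum2 (\<rho>0 b) (\<rho>2 b)" for b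
  have \<mu>: "unital_bounded_hom A (bops p) \<mu>"
    unfolding \<mu>_def by (rule dsum2_hom) (use \<rho>0(1) \<rho>2(1) in \<open>auto simp: unital_iso_into_def iso_into_def unital_bounded_hom_def\<close>)
  have rb: "\<rho>0 b \<in> bop p" "\<rho>2 b \<in> bop p" if "b \<in> ba_carrier A" for b
    using \<rho>0(1) \<rho>2(1) that by (auto simp: unital_iso_into_def iso_into_def bounded_hom_def ba_hom_def)
  have \<mu>b: "\<mu> b \<in> bop p" if "b \<in> ba_carrier A" for b using rb[OF that] by (simp add: \<mu>_def)
  define \<rho> where "\<rho> b = S' \<circ> \<mu> b \<circ> S" for b
  have \<rho>b: "\<rho> b \<in> bop p" if "b \<in> ba_carrier A" for b using \<mu>b[OF that] S by (simp add: \<rho>_def)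
  have key: "\<exists>T R Q. T \<in> bop p \<and> R \<in> bop p \<and> Q \<in> bop p \<and> \<phi> b = q T \<and> \<rho> b - dsum2 (dsum2 T R) Q \<in> kop p"
    if b: "b \<in> ba_carrier A" for b
  proof -
    obtain T R Q where T: "T \<in> bop p" "\<phi> b = q T" "R \<in> bop p" "\<psi> b = q R" "Q \<in> bop p" "\<theta>1 b = q Q"
      using lift[OF \<phi> b] lift[OF \<psi> b] lift[of \<theta>1, OF _ b] \<theta>(2) unfolding trivial_ext_def by metis
    define Y where "Y = dsum2 (dsum2 T R) Q"
    have Y: "Y \<in> bop p" using T by (simp add: Y_def)
    have "q (\<mu> b) = ext_sum p \<theta> \<theta>2 b"
      unfolding \<mu>_def using ext_sum_eq[of \<theta> b _ \<theta>2, OF \<rho>0(2)[OF b] \<rho>2(2)[OF b] rb[OF b]] by simp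
    also have "ext_sum p (ext_sum p \<phi> \<psi>) \<theta>1 b = q Y"
      unfolding Y_def using T by (intro ext_sum_eq) auto
    then have "ext_sum p \<theta> \<theta>2 b = q (S \<circ> Y \<circ> S')"
      unfolding eq[OF b] using S Y by (simp add: calkin_ops)
    finally have "\<mu> b - (S \<circ> Y \<circ> S') \<in> kop p" by (rule calk_pi_eqD[OF _ \<mu>b[OF b]])
    from kop_comp_right[OF kop_comp_left[OF this S(2)] S(1)]
    have "(S' \<circ> \<mu> b \<circ> S) - (S' \<circ> (S \<circ> Y \<circ> S') \<circ> S) \<in> kop p"
      using \<mu>b[OF b] S Y by (simp add: comp_add_right comp_add_left)
    moreover have "S' \<circ> (S \<circ> Y \<circ> S') \<circ> S = (S' \<circ> S) \<circ> Y \<circ> (S' \<circ> S)" by (simp add: comp_assoc)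
    then have "S' \<circ> (S \<circ> Y \<circ> S') \<circ> S = Y" unfolding S(4) one_comp(1)[OF Y] one_comp(2)[OF Y] .
    ultimately have "\<rho> b - Y \<in> kop p" by (simp add: \<rho>_def)
    then show ?thesis using T unfolding Y_def by blast
  qed
  show ?thesis
  proof (rule that)
    show "unital_bounded_hom A (bops p) \<rho>"
      unfolding unital_bounded_hom_def bounded_hom_def
    proof (intro conjI)
      have c3: "S' \<circ> X \<circ> S \<circ> (S' \<circ> Y \<circ> S) = S' \<circ> (X \<circ> Y) \<circ> S" if "Y \<in> bop p" for X Y
      proof -
        have "S' \<circ> X \<circ> S \<circ> (S' \<circ> Y \<circ> S) = S' \<circ> X \<circ> ((S \<circ> S') \<circ> Y) \<circ> S" by (simp add: comp_assoc)
        then show ?thesis unfolding S(3) one_comp(1)[OF that] by (simp add: comp_assoc)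
      qed
      show "ba_hom A (bops p) \<rho>"
        using \<mu> \<rho>b \<mu>b S unfolding ba_hom_def unital_bounded_hom_def bounded_hom_def
        by (simp add: \<rho>_def comp_add_left comp_add_right comp_scale_left comp_scale_right c3)
      show "\<rho> (ba_one A) = ba_one (bops p)"
        using \<mu> S by (simp add: unital_bounded_hom_def \<rho>_def one_comp[OF S(2)])
      obtain K where K: "\<And>b. b \<in> ba_carrier A \<Longrightarrow> op_norm p (\<mu> b) \<le> K * ba_norm A b"
        using \<mu> by (auto simp: unital_bounded_hom_def bounded_hom_def)
      obtain s1 s2 where s: "nb S s1" "0 < s1" "nb S' s2" "0 < s2" using bop_nb[OF S(1)] bop_nb[OF S(2)] by metis
      have "op_norm p (\<rho> b) \<le> (s2 * K * s1) * ba_norm A b" if b: "b \<in> ba_carrier A" for b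
      proof -
        have "op_norm p (\<rho> b) \<le> s2 * op_norm p (\<mu> b) * s1"
          unfolding \<rho>_def by (intro op_norm_le nb_comp s nb_op_norm \<mu>b b)
        also have "\<dots> \<le> s2 * (K * ba_norm A b) * s1" using s K[OF b] by (intro mult_right_mono mult_left_mono) auto
        finally show ?thesis by (simp add: mult_ac)
      qed
      then show "\<exists>K. \<forall>x\<in>ba_carrier A. ba_norm (bops p) (\<rho> x) \<le> K * ba_norm A x" by auto
    qed
    fix b assume b: "b \<in> ba_carrier A"
    obtain T R Q where T: "T \<in> bop p" "R \<in> bop p" "Q \<in> bop p" "\<phi> b = q T" "\<rho> b - dsum2 (dsum2 T R) Q \<in> kop p"
      using key[OF b] by blast
    define Y where "Y = dsum2 (dsum2 T R) Q"
    have Y: "Y \<in> bop p" "\<rho> b - Y \<in> kop p" using T by (auto simp: Y_def)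
    have P4b: "P4 \<in> bop p" unfolding P4_dsum2 using one_bop by simp
    have z1: "0 \<circ> W = 0" for W :: lpop by (auto simp: fun_eq_iff)
    have z2: "W \<circ> 0 = 0" if "W \<in> bop p" for W using bop_zero[OF that] by (auto simp: fun_eq_iff)
    have PY: "P4 \<circ> Y = Y \<circ> P4"
      unfolding P4_dsum2 Y_def using T one_bop by (simp add: dsum2_comp one_comp z1 z2)
    have "(P4 \<circ> \<rho> b) - (\<rho> b \<circ> P4) = (P4 \<circ> (\<rho> b - Y)) - ((\<rho> b - Y) \<circ> P4)"
      unfolding comp_add_right(2)[OF P4b \<rho>b[OF b] Y(1)] comp_add_left PY by simp
    also have "\<dots> \<in> kop p" by (intro kop_diff kop_comp_left kop_comp_right Y P4b)
    finally show "(P4 \<circ> \<rho> b) - (\<rho> b \<circ> P4) \<in> kop p" .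
    have rY: "res g4 \<circ> Y \<circ> emb g4 = T"
    proof -
      have "res g4 \<circ> Y \<circ> emb g4 = res ev \<circ> (res ev \<circ> Y \<circ> emb ev) \<circ> emb ev" unfolding g4_emb g4_res by (simp add: comp_assoc)
      then show ?thesis unfolding Y_def using res_dsum2_emb(1) T by simp
    qed
    have "(res g4 \<circ> \<rho> b \<circ> emb g4) - T = res g4 \<circ> (\<rho> b - Y) \<circ> emb g4"
      unfolding comp_add_right(2)[OF emb_res_bop(2)[OF inj_g4] \<rho>b[OF b] Y(1)] comp_add_left rY ..
    also have "\<dots> \<in> kop p" by (intro kop_comp_left kop_comp_right Y emb_res_bop inj_g4)
    finally show "\<phi> b = q (res g4 \<circ> \<rho> b \<circ> emb g4)" unfolding T(4) by (rule calk_pi_eqI[symmetric])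
  qed
qed

section \<open>Exchanging summands in a sum of four\<close>

lemma dsum4_apply:
  assumes "a \<in> bop p" "b \<in> bop p" "c \<in> bop p" "d \<in> bop p" "x \<in> L"
  shows "dsum2 (dsum2 a b) (dsum2 c d) x (ev (ev k)) = a (x \<circ> ev \<circ> ev) k"
    "dsum2 (dsum2 a b) (dsum2 c d) x (ev (od k)) = b (x \<circ> ev \<circ> od) k"
    "dsum2 (dsum2 a b) (dsum2 c d) x (od (ev k)) = c (x \<circ> od \<circ> ev) k"
    "dsum2 (dsum2 a b) (dsum2 c d) x (od (od k)) = d (x \<circ> od \<circ> od) k"
  by (simp_all only: dsum2_apply[OF dsum2_bop[OF assms(1,2)] dsum2_bop[OF assms(3,4)] assms(5)]
      dsum2_apply[OF assms(1,2) lp_comp_inj(1)[OF assms(5) inj_ev]] dsum2_apply[OF assms(3,4) lp_comp_inj(1)[OF assms(5) inj_od]])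

lemma eo4_ext:
  "(\<And>k. x (ev (ev k)) = y (ev (ev k))) \<Longrightarrow> (\<And>k. x (ev (od k)) = y (ev (od k))) \<Longrightarrow>
   (\<And>k. x (od (ev k)) = y (od (ev k))) \<Longrightarrow> (\<And>k. x (od (od k)) = y (od (od k))) \<Longrightarrow> x = y"
  by (rule eo_ext) (metis ev_od_cases)+

text \<open>The four summands of a sum of two sums occupy the residues 0, 2, 1, 3 modulo 4, in this
  order. So \<open>sw1\<close> exchanges the second and the fourth, and \<open>sw2\<close> the
  second and the third.\<close>

definition sw1 :: "nat \<Rightarrow> nat" where
  "sw1 n = (if n mod 4 = 2 then n + 1 else if n mod 4 = 3 then n - 1 else n)"

definition sw2 :: "nat \<Rightarrow> nat" where
  "sw2 n = (if n mod 4 = 1 then n + 1 else if n mod 4 = 2 then n - 1 else n)"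

lemma sw1_simps: "sw1 (ev (ev k)) = ev (ev k)" "sw1 (ev (od k)) = od (od k)" "sw1 (od (ev k)) = od (ev k)" "sw1 (od (od k)) = ev (od k)"
  and sw2_simps: "sw2 (ev (ev k)) = ev (ev k)" "sw2 (ev (od k)) = od (ev k)" "sw2 (od (ev k)) = ev (od k)" "sw2 (od (od k)) = od (od k)"
  unfolding sw1_def sw2_def ev_def od_def by presburger+

lemma eo4_cases: obtains k where "n = ev (ev k)" | k where "n = ev (od k)" | k where "n = od (ev k)" | k where "n = od (od k)"
  by (metis ev_od_cases)

lemma sw_invol: "sw1 (sw1 n) = n" "sw2 (sw2 n) = n"
  by (cases n rule: eo4_cases; simp only: sw1_simps sw2_simps)+

lemma inj_sw: "inj sw1" "inj sw2"
  by (rule inj_on_inverseI[of _ sw1], rule sw_invol, rule inj_on_inverseI[of _ sw2], rule sw_invol)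

lemma res_sw_invol: "res sw1 \<circ> res sw1 = op_one p" "res sw2 \<circ> res sw2 = op_one p"
proof -
  have *: "res s \<circ> res s = op_one p" if s: "inj s" "\<And>n. s (s n) = n" for s
  proof
    fix x show "(res s \<circ> res s) x = op_one p x"
      by (cases "x \<in> L") (simp_all add: res_def op_one_def lp_comp_inj(1)[OF _ s(1)] fun_eq_iff s(2))
  qed
  show "res sw1 \<circ> res sw1 = op_one p" "res sw2 \<circ> res sw2 = op_one p" by (rule *[OF inj_sw(1) sw_invol(1)], rule *[OF inj_sw(2) sw_invol(2)])
qed

lemma sw_intertwine:
  assumes "a \<in> bop p" "b \<in> bop p" "c \<in> bop p" "d \<in> bop p"
  shows "res sw1 \<circ> dsum2 (dsum2 a b) (dsum2 c d) = dsum2 (dsum2 a d) (dsum2 c b) \<circ> res sw1"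
    "res sw2 \<circ> dsum2 (dsum2 a b) (dsum2 c d) = dsum2 (dsum2 a c) (dsum2 b d) \<circ> res sw2"
proof -
  note rb = emb_res_bop(2)[OF inj_sw(1)] emb_res_bop(2)[OF inj_sw(2)]
  have D: "dsum2 (dsum2 a b) (dsum2 c d) \<in> bop p" using assms by simp
  show "res sw1 \<circ> dsum2 (dsum2 a b) (dsum2 c d) = dsum2 (dsum2 a d) (dsum2 c b) \<circ> res sw1"
  proof (rule bop_ext)
    fix x assume x: "x \<in> L"
    have y: "x \<circ> sw1 \<in> L" by (rule lp_comp_inj(1)[OF x inj_sw(1)])
    have e: "x \<circ> sw1 \<circ> ev \<circ> ev = x \<circ> ev \<circ> ev" "x \<circ> sw1 \<circ> ev \<circ> od = x \<circ> od \<circ> od"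
      "x \<circ> sw1 \<circ> od \<circ> ev = x \<circ> od \<circ> ev" "x \<circ> sw1 \<circ> od \<circ> od = x \<circ> ev \<circ> od"
      by (auto simp: fun_eq_iff sw1_simps)
    have 1: "(res sw1 \<circ> dsum2 (dsum2 a b) (dsum2 c d)) x = dsum2 (dsum2 a b) (dsum2 c d) x \<circ> sw1"
      using bop_lp[OF D x] by (simp add: res_def)
    have 2: "(dsum2 (dsum2 a d) (dsum2 c b) \<circ> res sw1) x = dsum2 (dsum2 a d) (dsum2 c b) (x \<circ> sw1)"
      using x by (simp add: res_def)
    show "(res sw1 \<circ> dsum2 (dsum2 a b) (dsum2 c d)) x = (dsum2 (dsum2 a d) (dsum2 c b) \<circ> res sw1) x"
      unfolding 1 2
      by (rule eo4_ext; subst comp_apply; subst sw1_simps; subst dsum4_apply[OF assms x]; subst dsum4_apply[OF assms(1,4,3,2) y]; subst e; rule refl)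
  qed (use assms rb in simp_all)
  show "res sw2 \<circ> dsum2 (dsum2 a b) (dsum2 c d) = dsum2 (dsum2 a c) (dsum2 b d) \<circ> res sw2"
  proof (rule bop_ext)
    fix x assume x: "x \<in> L"
    have y: "x \<circ> sw2 \<in> L" by (rule lp_comp_inj(1)[OF x inj_sw(2)])
    have e: "x \<circ> sw2 \<circ> ev \<circ> ev = x \<circ> ev \<circ> ev" "x \<circ> sw2 \<circ> ev \<circ> od = x \<circ> od \<circ> ev"
      "x \<circ> sw2 \<circ> od \<circ> ev = x \<circ> ev \<circ> od" "x \<circ> sw2 \<circ> od \<circ> od = x \<circ> od \<circ> od"
      by (auto simp: fun_eq_iff sw2_simps)
    have 1: "(res sw2 \<circ> dsum2 (dsum2 a b) (dsum2 c d)) x = dsum2 (dsum2 a b) (dsum2 c d) x \<circ> sw2"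
      using bop_lp[OF D x] by (simp add: res_def)
    have 2: "(dsum2 (dsum2 a c) (dsum2 b d) \<circ> res sw2) x = dsum2 (dsum2 a c) (dsum2 b d) (x \<circ> sw2)"
      using x by (simp add: res_def)
    show "(res sw2 \<circ> dsum2 (dsum2 a b) (dsum2 c d)) x = (dsum2 (dsum2 a c) (dsum2 b d) \<circ> res sw2) x"
      unfolding 1 2
      by (rule eo4_ext; subst comp_apply; subst sw2_simps; subst dsum4_apply[OF assms x]; subst dsum4_apply[OF assms(1,3,2,4) y]; subst e; rule refl)
  qed (use assms rb in simp_all)
qed


section \<open>Intertwining the ends of a path\<close>

text \<open>The windows are chosen one after the other. Each G j serves two levels, because the
  weight of level j + 1 is the difference of G (j + 1) and G j. The weight of level j + 2 starts at
  N (j + 1), so from there on the commutators of P with the operators of level j + 2 have to be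
  small.\<close>

lemma twist_cutoffs:
  assumes F: "\<And>j. finite (F j)" "\<And>j. F j \<subseteq> bop p"
    and Pk: "\<And>j T. T \<in> F j \<Longrightarrow> (P \<circ> T) - (T \<circ> P) \<in> kop p"
    and \<delta>: "\<And>j. 0 < \<delta> j"
  obtains N :: "nat \<Rightarrow> nat" and G :: "nat \<Rightarrow> nat \<Rightarrow> complex" where "N 0 = 0" "strict_mono N"
    "\<And>j l. l < N j \<Longrightarrow> G j l = 1" "\<And>j l. N (Suc j) \<le> l \<Longrightarrow> G j l = 0"
    "\<And>j l. \<exists>t. 0 \<le> t \<and> t \<le> 1 \<and> G j l = detour t"
    "\<And>j T. T \<in> F j \<union> F (Suc j) \<Longrightarrow> nb ((mulop (G j) \<circ> T) - (T \<circ> mulop (G j))) (\<delta> j)"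
    "\<And>j T. T \<in> F (Suc (Suc j)) \<Longrightarrow> nb (((P \<circ> T) - (T \<circ> P)) \<circ> tailop (N (Suc j))) (\<delta> j)"
proof -
  define good where "good j n n' \<gamma> \<longleftrightarrow> n < n' \<and> (\<forall>l<n. \<gamma> l = 1) \<and> (\<forall>l\<ge>n'. \<gamma> l = 0) \<and> (\<forall>l. \<exists>t. 0 \<le> t \<and> t \<le> 1 \<and> \<gamma> l = detour t) \<and>
      (\<forall>T\<in>F j \<union> F (Suc j). nb ((mulop \<gamma> \<circ> T) - (T \<circ> mulop \<gamma>)) (\<delta> j)) \<and>
      (\<forall>T\<in>F (Suc (Suc j)). nb (((P \<circ> T) - (T \<circ> P)) \<circ> tailop n') (\<delta> j))" for j n n' \<gamma>
  have step: "\<exists>n' \<gamma>. good j n n' \<gamma>" for j n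
  proof -
    obtain n1 \<gamma> where n1: "n < n1" "\<And>l. l < n \<Longrightarrow> \<gamma> l = 1" "\<And>l. n1 \<le> l \<Longrightarrow> \<gamma> l = 0"
      "\<And>l. \<exists>t. 0 \<le> t \<and> t \<le> 1 \<and> \<gamma> l = detour t"
      "\<And>T. T \<in> F j \<union> F (Suc j) \<Longrightarrow> nb ((mulop \<gamma> \<circ> T) - (T \<circ> mulop \<gamma>)) (\<delta> j)"
      by (rule quasicentral_cutoff[of "F j \<union> F (Suc j)" "\<delta> j" n]) (use F \<delta> in auto)
    have "\<forall>\<^sub>F n' in sequentially. \<forall>T\<in>F (Suc (Suc j)). nb (((P \<circ> T) - (T \<circ> P)) \<circ> tailop n') (\<delta> j)"
    proof (rule eventually_ball_finite[OF F(1)], rule ballI)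
      fix T assume "T \<in> F (Suc (Suc j))"
      from kop_tail_right[OF Pk[OF this] \<delta>[of j]]
      obtain M where M: "nb (((P \<circ> T) - (T \<circ> P)) \<circ> tailop M) (\<delta> j)" ..
      show "\<forall>\<^sub>F n' in sequentially. nb (((P \<circ> T) - (T \<circ> P)) \<circ> tailop n') (\<delta> j)"
        unfolding eventually_sequentially by (intro exI[of _ M] allI impI nb_tail_right_mono[OF M])
    qed
    then obtain n2 where n2: "\<forall>n'\<ge>n2. \<forall>T\<in>F (Suc (Suc j)). nb (((P \<circ> T) - (T \<circ> P)) \<circ> tailop n') (\<delta> j)"
      unfolding eventually_sequentially ..
    \<comment> \<open>Both demands persist when the end of the window is moved further out.\<close>
    have "good j n (max n1 n2) \<gamma>"
      unfolding good_def using n1(1) n1(2,3,4,5) mp[OF spec[OF n2] max.cobounded2[of n2 n1]] by (simp add: less_max_iff_disj)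
    then show ?thesis by (intro exI)
  qed
  then obtain nx Gx where good: "\<And>j n. good j n (nx j n) (Gx j n)" by metis
  have nx: "\<And>j n. n < nx j n" "\<And>j n l. l < n \<Longrightarrow> Gx j n l = 1" "\<And>j n l. nx j n \<le> l \<Longrightarrow> Gx j n l = 0"
      "\<And>j n l. \<exists>t. 0 \<le> t \<and> t \<le> 1 \<and> Gx j n l = detour t"
      "\<And>j n T. T \<in> F j \<union> F (Suc j) \<Longrightarrow> nb ((mulop (Gx j n) \<circ> T) - (T \<circ> mulop (Gx j n))) (\<delta> j)"
      "\<And>j n T. T \<in> F (Suc (Suc j)) \<Longrightarrow> nb (((P \<circ> T) - (T \<circ> P)) \<circ> tailop (nx j n)) (\<delta> j)"
    using good unfolding good_def by (simp_all only: Ball_def simp_thms)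
  define N where "N = rec_nat 0 nx"
  have N: "N 0 = 0" "N (Suc j) = nx j (N j)" for j by (auto simp: N_def)
  show ?thesis
  proof (rule that[of N "\<lambda>j. Gx j (N j)"])
    show "strict_mono N" by (rule strict_mono_Suc_iff[THEN iffD2]) (simp add: N nx(1))
  qed (simp_all only: N nx)
qed

text \<open>Turns estimates over the finite sets R j into one null sequence, the form in which the
  error of a move is required.\<close>

lemma op_norm_Max_tendsto:
  assumes fin: "\<And>j. finite (R j)" and ne: "\<And>j. R j \<noteq> {}" and b: "\<And>j i. X j i \<in> bop p"
    and lim: "\<And>\<epsilon>. 0 < \<epsilon> \<Longrightarrow> \<exists>J. \<forall>j\<ge>J. \<forall>i\<in>R j. nb (X j i) \<epsilon>"
  shows "(\<lambda>j. Max ((\<lambda>i. op_norm p (X j i)) ` R j)) \<longlonglongrightarrow> 0"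
proof (rule LIMSEQ_I)
  fix e :: real assume e: "0 < e"
  then obtain J where J: "\<And>j i. J \<le> j \<Longrightarrow> i \<in> R j \<Longrightarrow> nb (X j i) (e / 2)" using lim[of "e/2"] by auto
  have "norm (Max ((\<lambda>i. op_norm p (X j i)) ` R j) - 0) < e" if "J \<le> j" for j
  proof -
    have "Max ((\<lambda>i. op_norm p (X j i)) ` R j) \<le> e / 2"
      using fin ne op_norm_le[OF J[OF that]] by (subst Max_le_iff) auto
    moreover have "0 \<le> Max ((\<lambda>i. op_norm p (X j i)) ` R j)"
      using fin ne[of j] op_norm_nonneg[OF b] by (subst Max_ge_iff) auto
    ultimately show ?thesis using e by simp
  qed
  then show "\<exists>J. \<forall>j\<ge>J. norm (Max ((\<lambda>i. op_norm p (X j i)) ` R j) - 0) < e" by blast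
qed

text \<open>Level j of the twist controls the first j + 1 terms of the dense sequence at finitely
  many parameters. A fixed term is controlled from some level on, which is enough since the earlier
  pieces are compact. The commutation with the projection on the coordinates other than the
  complement of E in copy 0 allows this complement to be discarded later.\<close>

lemma path_intertwiner:
  fixes A :: "'a cbalg" and E :: "nat set" and T :: "real \<Rightarrow> 'a \<Rightarrow> lpop" and ds :: "nat \<Rightarrow> 'a"
  defines "P \<equiv> mulop (indicator E)"
  assumes Tb: "\<And>t a. t \<in> {0..1} \<Longrightarrow> a \<in> ba_carrier A \<Longrightarrow> nb (T t a) (K * ba_norm A a)"
    and Td: "\<And>t a b. t \<in> {0..1} \<Longrightarrow> a \<in> ba_carrier A \<Longrightarrow> b \<in> ba_carrier A \<Longrightarrow> T t a - T t b = T t (ba_diff A a b)"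
    and Dc: "\<And>a b. a \<in> ba_carrier A \<Longrightarrow> b \<in> ba_carrier A \<Longrightarrow> ba_diff A a b \<in> ba_carrier A"
    and cont: "\<And>a \<epsilon>. a \<in> ba_carrier A \<Longrightarrow> 0 < \<epsilon> \<Longrightarrow>
        \<exists>\<delta>>0. \<forall>s\<in>{0..1}. \<forall>t\<in>{0..1}. \<bar>s - t\<bar> < \<delta> \<longrightarrow> nb (T s a - T t a) \<epsilon>"
    and Pk: "\<And>t a. t \<in> {0..1} \<Longrightarrow> a \<in> ba_carrier A \<Longrightarrow> (P \<circ> T t a) - (T t a \<circ> P) \<in> kop p"
    and K: "0 < K"
    and ds: "\<And>m. ds m \<in> ba_carrier A" "\<And>a \<epsilon>. a \<in> ba_carrier A \<Longrightarrow> 0 < \<epsilon> \<Longrightarrow> \<exists>m. ba_norm A (ba_diff A a (ds m)) < \<epsilon>"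
  obtains U Ui s where "U \<in> bop p" "Ui \<in> bop p" "U \<circ> Ui = op_one p" "Ui \<circ> U = op_one p" "\<forall>i. s i \<in> {0..1 :: real}"
    "U \<circ> mulop (indicator {n. \<forall>i l. n = ray i l \<longrightarrow> i \<noteq> 0 \<or> l \<in> E}) = mulop (indicator {n. \<forall>i l. n = ray i l \<longrightarrow> i \<noteq> 0 \<or> l \<in> E}) \<circ> U"
    "Ui \<circ> mulop (indicator {n. \<forall>i l. n = ray i l \<longrightarrow> i \<noteq> 0 \<or> l \<in> E}) = mulop (indicator {n. \<forall>i l. n = ray i l \<longrightarrow> i \<noteq> 0 \<or> l \<in> E}) \<circ> Ui"
    "\<forall>a\<in>ba_carrier A.
       (U \<circ> dsm (\<lambda>i. if i = 0 then P \<circ> T 0 a \<circ> P else T (s i) a)) - (dsm (\<lambda>i. if i = 0 then P \<circ> T 1 a \<circ> P else T (s i) a) \<circ> U) \<in> kop p"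
proof -
  obtain s :: "nat \<Rightarrow> real" and c \<sigma> :: "nat \<Rightarrow> nat \<Rightarrow> nat" where s0: "s 0 = 0" and s01: "\<And>i. 0 \<le> s i \<and> s i \<le> (1 :: real)" and c: "\<And>j. bij (c j)" "\<And>j. finite {i. c j i \<noteq> i}"
    "\<And>j. c (Suc j) = c j \<circ> \<sigma> j" "\<And>j i. \<sigma> j (\<sigma> j i) = i"
    and close: "\<And>j i. \<bar>s i - (s(0 := 1)) (c j i)\<bar> \<le> 1 / 2 ^ j"
  proof (rule dyadic_rays)
    fix s :: "nat \<Rightarrow> real" and c \<sigma> :: "nat \<Rightarrow> nat \<Rightarrow> nat"
    assume "s 0 = 0" "\<And>i. 0 \<le> s i \<and> s i \<le> 1" "\<And>j. bij (c j)" "\<And>j. finite {i. c j i \<noteq> i}"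
      "\<And>j. c (Suc j) = c j \<circ> \<sigma> j" "\<And>j i. \<sigma> j (\<sigma> j i) = i" "\<And>j i. \<bar>s i - (s(0 := 1)) (c j i)\<bar> \<le> 1 / 2 ^ j"
    then show thesis by (rule that[of s c \<sigma>])
  qed
  define R where "R j = insert 0 {i. c j i \<noteq> i}" for j
  have finR: "finite (R j)" for j using c(2) by (simp add: R_def)
  \<comment> \<open>The parameter 1 is added for copy 0 of the target representation.\<close>
  define F where "F j = (\<lambda>(t, m). T t (ds m)) ` ((s ` R j \<union> {1}) \<times> {..j})" for j
  have sI: "s i \<in> {0..1}" for i using s01 by simp
  have FT: "\<exists>t m. X = T t (ds m) \<and> t \<in> {0..1}" if "X \<in> F j" for X j
    using that sI by (auto simp: F_def)
  have Fb: "F j \<subseteq> bop p" for j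
  proof
    fix X assume "X \<in> F j"
    from FT[OF this] obtain t m where "X = T t (ds m)" "t \<in> {0..1}" by (elim exE conjE) (rule that)
    then show "X \<in> bop p" using nbD(1)[OF Tb[OF _ ds(1)], of t m] by simp
  qed
  have FP: "(P \<circ> X) - (X \<circ> P) \<in> kop p" if "X \<in> F j" for X j
  proof -
    from FT[OF that] obtain t m where "X = T t (ds m)" "t \<in> {0..1}" by (elim exE conjE) (rule that)
    then show ?thesis using Pk[OF _ ds(1), of t m] by simp
  qed
  have finF: "finite (F j)" for j using finR by (simp add: F_def)
  obtain N :: "nat \<Rightarrow> nat" and G :: "nat \<Rightarrow> nat \<Rightarrow> complex" where N: "N 0 = 0" "strict_mono N"
    and G: "\<And>j l. l < N j \<Longrightarrow> G j l = 1" "\<And>j l. N (Suc j) \<le> l \<Longrightarrow> G j l = 0"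
      "\<And>j l. \<exists>t. 0 \<le> t \<and> t \<le> 1 \<and> G j l = detour t"
    and Gc: "\<And>j X. X \<in> F j \<union> F (Suc j) \<Longrightarrow> nb ((mulop (G j) \<circ> X) - (X \<circ> mulop (G j))) ((1/2) ^ j)"
    and Pt: "\<And>j X. X \<in> F (Suc (Suc j)) \<Longrightarrow> nb (((P \<circ> X) - (X \<circ> P)) \<circ> tailop (N (Suc j))) ((1/2) ^ j)"
    by (rule twist_cutoffs[of F P "\<lambda>j. (1/2) ^ j", OF finF Fb FP]) auto
  \<comment> \<open>The cutoffs are glued into one function that equals G j in window j.
    \<open>st\<close> repeats the definition of \<open>stage\<close>, which becomes available only
    after the interpretation.\<close>
  define st where "st l = (GREATEST j. N j \<le> l)" for l
  interpret rt: ray_twist p E c \<sigma> N "\<lambda>l. G (st l) l"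
    by unfold_locales (use c N G in auto)
  have st: "rt.stage = st" by (auto simp: rt.stage_def st_def)
  have RR: "rt.R j = R j" for j by (simp add: rt.R_def R_def)
  have PP: "rt.P = P" by (simp add: rt.P_def P_def)
  note nP = rt.nb_P[unfolded PP]
  have Pb: "P \<in> bop p" by (rule nbD(1)[OF nP])
  \<comment> \<open>Each cutoff is 1 before its window and 0 after it, so every weight from level 1
    on is a difference of two consecutive cutoffs and inherits their small commutators.\<close>
  have fG: "rt.f (Suc j) l = G (Suc j) l - G j l" for j l
  proof -
    have "N (st l) \<le> l" "l < N (Suc (st l))" using rt.stage_le[of l] rt.stage_gt[of l] by (auto simp: st)
    then have 1: "G i l = 0" if "i < st l" for i using that G(2)[of i l] strict_mono_less_eq[OF N(2), of "Suc i" "st l"] by simp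
    have 2: "G i l = 1" if "st l < i" for i
      using that G(1)[of l i] strict_mono_less_eq[OF N(2), of "Suc (st l)" i] \<open>l < N (Suc (st l))\<close> by simp
    consider "st l = Suc j" | "st l = j" | "st l < j" | "Suc j < st l" by linarith
    then show ?thesis by cases (simp_all add: rt.f_def st 1 2)
  qed
  have Gb: "mulop (G j) \<in> bop p" for j
  proof -
    have "cmod (G j l) \<le> 3" for l using G(3)[of j l] detour_norm by metis
    then show ?thesis by (rule nbD(1)[OF nb_mulop])
  qed
  have fb: "nb (mulop (rt.f j)) 4" for j by (rule nb_mulop) (rule rt.f_bound)
  have hPf: "rt.h j = P \<circ> mulop (rt.f j)" for j
    unfolding rt.h_def P_def by (rule mulop_comp[where c = 4, symmetric]) (rule rt.f_bound)
  have hP: "rt.h j \<circ> P = rt.h j" "P \<circ> rt.h j = rt.h j" for j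
  proof -
    show "rt.h j \<circ> P = rt.h j" unfolding rt.h_def P_def
      by (subst mulop_comp[where c=1]) (auto simp: indicator_def intro!: arg_cong[of _ _ mulop])
    have "P \<circ> P = P" unfolding P_def
      by (subst mulop_comp[where c=1]) (auto simp: indicator_def intro!: arg_cong[of _ _ mulop])
    then show "P \<circ> rt.h j = rt.h j" unfolding hPf by (simp add: comp_assoc[symmetric])
  qed
  have Pch: "P \<circ> rt.ch j = rt.ch j" for j
    unfolding rt.ch_def P_def by (subst mulop_comp[where c=1]) (auto simp: indicator_def intro!: arg_cong[of _ _ mulop])
  \<comment> \<open>The estimate below gives 1 + 2 + 16 = 19 times \<open>(1/2) ^ j\<close>: two
    cutoff commutators, and a commutator with P from two levels earlier, multiplied by the bound 4
    of the weight.\<close>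
  define e where "e j = 32 * (1/2 :: real) ^ j" for j
  \<comment> \<open>As h is P g for the weight g, its commutator with X is P [g, X] + [P, X] g. The
    second term is small because [P, X] is compact and g starts far out.\<close>
  have hc: "nb (rt.commutator (rt.h j) X) (e j)" if j: "2 \<le> j" and X: "X \<in> F j" for j X
  proof -
    obtain i where i: "j = Suc (Suc i)" using j by (metis add_2_eq_Suc le_Suc_ex)
    have Xb: "X \<in> bop p" using X Fb by blast
    define g where "g = mulop (rt.f j)"
    have gb: "g \<in> bop p" "nb g 4" using fb nbD by (auto simp: g_def)
    have gG: "g = mulop (G j) - mulop (G (Suc i))"
      unfolding g_def mulop_add by (rule arg_cong[of _ _ mulop]) (auto simp: i fG)
    have gt: "tailop (N (Suc i)) \<circ> g = g"
    proof -
      have z: "rt.f j l = 0" if "l < N (Suc i)" for l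
        using that G(1)[of l "Suc i"] G(1)[of l j] strict_mono_less[OF N(2), of "Suc i" j] by (simp add: i fG)
      show ?thesis unfolding g_def tailop_def
        by (subst mulop_comp[where c=4]) (use rt.f_bound z in \<open>auto intro!: arg_cong[of _ _ mulop]\<close>)
    qed
    have "nb ((g \<circ> X) - (X \<circ> g)) ((1/2) ^ j + (1/2) ^ Suc i)"
    proof -
      have "(g \<circ> X) - (X \<circ> g) = ((mulop (G j) \<circ> X) - (X \<circ> mulop (G j))) - ((mulop (G (Suc i)) \<circ> X) - (X \<circ> mulop (G (Suc i))))"
        unfolding gG comp_add_left comp_add_right(2)[OF Xb Gb Gb] by (simp add: algebra_simps)
      then show ?thesis using nb_diff[OF Gc[of X j] Gc[of X "Suc i"]] X i by simp
    qed
    from nb_comp[OF nP this] have 1: "nb (P \<circ> ((g \<circ> X) - (X \<circ> g))) (1 * ((1/2) ^ j + (1/2) ^ Suc i))" .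
    have "((P \<circ> X) - (X \<circ> P)) \<circ> g = ((P \<circ> X) - (X \<circ> P)) \<circ> tailop (N (Suc i)) \<circ> g"
      unfolding comp_assoc gt ..
    then have 2: "nb (((P \<circ> X) - (X \<circ> P)) \<circ> g) ((1/2) ^ i * 4)"
      using nb_comp[OF Pt[of X i] gb(2)] X i by simp
    have "rt.commutator (rt.h j) X = (P \<circ> ((g \<circ> X) - (X \<circ> g))) + (((P \<circ> X) - (X \<circ> P)) \<circ> g)"
      unfolding rt.commutator_def hPf g_def[symmetric] using Pb gb Xb
      by (simp add: comp_add_right comp_add_left comp_assoc)
    then have "nb (rt.commutator (rt.h j) X) (1 * ((1/2) ^ j + (1/2) ^ Suc i) + (1/2) ^ i * 4)" using nb_add[OF 1 2] by simp
    then show ?thesis by (rule nb_mono) (simp add: e_def i)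
  qed
  \<comment> \<open>Copy 0 carries the compression to the range of P only; the two values of u
    differ nowhere else.\<close>
  define M where "M u a i = (if i = 0 then P \<circ> T u a \<circ> P else T (s i) a)" for u a and i :: nat
  have Mnb: "nb (M u a i) (K * ba_norm A a)" if "u \<in> {0..1}" "a \<in> ba_carrier A" for u a i
    using nb_comp[OF nb_comp[OF nP Tb[OF that]] nP] Tb[OF sI that(2), of i] by (simp add: M_def)
  have dense: "(rt.U \<circ> dsm (M 0 a)) - (dsm (M 1 a) \<circ> rt.U) \<in> kop p" if a: "a = ds m" for a m
  proof -
    have aC: "a \<in> ba_carrier A" using a ds by simp
    define s' where "s' = s(0 := 1)"
    have s'I: "s' i \<in> {0..1}" for i using sI by (simp add: s'_def)
    have inF: "T (s i) a \<in> F j" "T 1 a \<in> F j" if "i \<in> R j" "m \<le> j" for i j using that a by (auto simp: F_def)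
    have cPP: "rt.commutator (rt.h j) (P \<circ> X \<circ> P) = P \<circ> rt.commutator (rt.h j) X \<circ> P" if "X \<in> bop p" for X j
    proof -
      have hb: "rt.h j \<in> bop p" by (rule nbD(1)[OF rt.nb_h])
      have "rt.h j \<circ> (P \<circ> X \<circ> P) = P \<circ> (rt.h j \<circ> X) \<circ> P"
        using hP[of j] by (simp add: comp_assoc[symmetric])
      moreover have "P \<circ> X \<circ> P \<circ> rt.h j = P \<circ> (X \<circ> rt.h j) \<circ> P"
        using hP[of j] by (simp add: comp_assoc)
      ultimately show ?thesis unfolding rt.commutator_def
        using Pb hb that by (simp add: comp_add_right comp_add_left)
    qed
    \<comment> \<open>Between the cutoffs, both supported in E, the compression by P is invisible.
      Since \<open>s 0 = 0\<close>, only the difference of T at two neighbouring parameters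
      remains.\<close>
    have hT: "rt.h j \<circ> (M 0 a i - M 1 a (c j i)) \<circ> rt.ch j = rt.h j \<circ> (T (s i) a - T (s' (c j i)) a) \<circ> rt.ch j" for i j
    proof -
      have hb: "rt.h j \<in> bop p" by (rule nbD(1)[OF rt.nb_h])
      have tb: "T t a \<in> bop p" if "t \<in> {0..1}" for t by (rule nbD(1)[OF Tb[OF that aC]])
      have Mb: "M u a k \<in> bop p" if "u \<in> {0..1}" for u k by (rule nbD(1)[OF Mnb[OF that aC]])
      have PX: "rt.h j \<circ> (P \<circ> X \<circ> P) \<circ> rt.ch j = rt.h j \<circ> X \<circ> rt.ch j" for X
      proof -
        have "rt.h j \<circ> (P \<circ> X \<circ> P) \<circ> rt.ch j = (rt.h j \<circ> P) \<circ> X \<circ> (P \<circ> rt.ch j)" by (simp add: comp_assoc)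
        then show ?thesis unfolding hP Pch .
      qed
      have 1: "rt.h j \<circ> M 0 a i \<circ> rt.ch j = rt.h j \<circ> T (s i) a \<circ> rt.ch j"
        using PX[of "T 0 a"] s0 by (simp add: M_def)
      have 2: "rt.h j \<circ> M 1 a k \<circ> rt.ch j = rt.h j \<circ> T (s' k) a \<circ> rt.ch j" for k
        using PX[of "T 1 a"] by (simp add: M_def s'_def)
      have z: "(0::real) \<in> {0..1}" "(1::real) \<in> {0..1}" by auto
      show ?thesis
        unfolding comp_add_right(2)[OF hb Mb[OF z(1)] Mb[OF z(2)]] comp_add_right(2)[OF hb tb[OF sI] tb[OF s'I]] comp_add_left 1 2 ..
    qed
    define Y where "Y j i = rt.h j \<circ> (M 0 a i - M 1 a (c j i)) \<circ> rt.ch j" for j i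
    have Yb: "Y j i \<in> bop p" for j i
      unfolding Y_def hT by (intro bop_closed nbD(1)[OF rt.nb_h] nbD(1)[OF rt.nb_ch] nbD(1)[OF Tb[OF sI aC]] nbD(1)[OF Tb[OF s'I aC]])
    show ?thesis
    proof (rule rt.twist_intertwines[where C = "K * ba_norm A a" and ?j0.0 = "max 2 m" and e = e and \<eta> = "\<lambda>j. Max ((\<lambda>i. op_norm p (Y j i)) ` R j)"])
      show "nb (M 0 a i) (K * ba_norm A a)" "nb (M 1 a i) (K * ba_norm A a)" for i
        by (rule Mnb; use aC in simp)+
      show "M 1 a i = M 0 a i" if "i \<noteq> 0" for i using that by (simp add: M_def)
      have idem: "P \<circ> P = P" unfolding P_def
        by (subst mulop_comp[where c=1]) (auto simp: indicator_def intro!: arg_cong[of _ _ mulop])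
      show "rt.P \<circ> M 0 a 0 = M 0 a 0" unfolding PP M_def using idem by (simp add: comp_assoc[symmetric])
      show "M 1 a 0 \<circ> rt.P = M 1 a 0" unfolding PP M_def using idem by (simp add: comp_assoc)
      show "nb (rt.commutator (rt.h j) (M 0 a i)) (e j) \<and> nb (rt.commutator (rt.h j) (M 1 a i)) (e j)" if j: "max 2 m \<le> j" and i: "i \<in> rt.R j" for j i
      proof -
        have i': "i \<in> R j" using i RR by simp
        have m: "m \<le> j" "2 \<le> j" using j by auto
        have n1: "nb (rt.commutator (rt.h j) (P \<circ> X \<circ> P)) (e j)" if "X \<in> F j" for X
        proof -
          have "X \<in> bop p" using that Fb by blast
          from nb_comp[OF nb_comp[OF nP hc[OF m(2) that]] nP] show ?thesis unfolding cPP[OF \<open>X \<in> bop p\<close>] by simp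
        qed
        have "0 \<in> R j" by (simp add: R_def)
        then have "T 0 a \<in> F j" using inF(1)[of 0 j] m s0 by simp
        show ?thesis
          using n1[OF \<open>T 0 a \<in> F j\<close>] n1[OF inF(2)[OF i' m(1)]] hc[OF m(2) inF(1)[OF i' m(1)]] by (simp add: M_def)
      qed
      show "nb (rt.h j \<circ> (M 0 a i - M 1 a (c j i)) \<circ> rt.ch j) (Max ((\<lambda>i. op_norm p (Y j i)) ` R j))" if i: "i \<in> rt.R j" for j i
        unfolding Y_def[symmetric]
        by (rule nb_mono[OF nb_op_norm[OF Yb]], rule Max_ge) (use i finR RR in simp_all)
      show "summable e" unfolding e_def by (intro summable_mult summable_geometric) simp
      show "(\<lambda>j. Max ((\<lambda>i. op_norm p (Y j i)) ` R j)) \<longlonglongrightarrow> 0"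
      proof (rule op_norm_Max_tendsto[OF finR _ Yb])
        show "R j \<noteq> {}" for j by (simp add: R_def)
        fix \<epsilon> :: real assume "0 < \<epsilon>"
        then obtain \<delta> where \<delta>: "0 < \<delta>" "\<And>s t. s \<in> {0..1} \<Longrightarrow> t \<in> {0..1} \<Longrightarrow> \<bar>s - t\<bar> < \<delta> \<Longrightarrow> nb (T s a - T t a) (\<epsilon> / 4)"
          using cont[OF aC, of "\<epsilon>/4"] by auto
        obtain J where J: "(1/2 :: real) ^ J < \<delta>" using real_arch_pow_inv[OF \<delta>(1), of "1/2"] by auto
        have "nb (Y j i) \<epsilon>" if "J \<le> j" for j i
        proof -
          have "\<bar>s i - s' (c j i)\<bar> \<le> (1/2) ^ j" using close[of i j] by (simp add: s'_def power_one_over)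
          also have "\<dots> \<le> (1/2) ^ J" using that by (intro power_decreasing) auto
          also note J
          finally have "nb (T (s i) a - T (s' (c j i)) a) (\<epsilon> / 4)" by (rule \<delta>(2)[OF sI s'I])
          from nb_comp[OF nb_comp[OF rt.nb_h[of j] this] rt.nb_ch[of j]] show ?thesis unfolding Y_def hT by simp
        qed
        then show "\<exists>J. \<forall>j\<ge>J. \<forall>i\<in>R j. nb (Y j i) \<epsilon>" by blast
      qed
    qed
  qed
  have all: "(rt.U \<circ> dsm (M 0 a)) - (dsm (M 1 a) \<circ> rt.U) \<in> kop p" if a: "a \<in> ba_carrier A" for a
  proof (rule kop_closed)
    have z: "(0::real) \<in> {0..1}" "(1::real) \<in> {0..1}" by auto
    have Bb: "dsm (M u b) \<in> bop p" if "u \<in> {0..1}" "b \<in> ba_carrier A" for u b by (rule nbD(1)[OF nb_dsm[OF Mnb[OF that]]])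
    show "(rt.U \<circ> dsm (M 0 a)) - (dsm (M 1 a) \<circ> rt.U) \<in> bop p" using rt.U_bop Bb[OF z(1) a] Bb[OF z(2) a] by simp
    obtain u where u: "nb rt.U u" "0 < u" using bop_nb[OF rt.U_bop] .
    fix \<epsilon> :: real assume \<epsilon>: "0 < \<epsilon>"
    then have "0 < \<epsilon> / (2 * u * K)" using u K by simp
    \<comment> \<open>The defects of a and of its approximation differ by at most 2 u K times their
      distance, uniformly over all copies.\<close>
    then obtain m where m: "ba_norm A (ba_diff A a (ds m)) < \<epsilon> / (2 * u * K)" using ds(2)[OF a] by blast
    define b where "b = ds m"
    have b: "b \<in> ba_carrier A" using ds by (simp add: b_def)
    define \<delta> where "\<delta> = K * ba_norm A (ba_diff A a b)"
    have d: "nb (M w a i - M w b i) \<delta>" if w: "w \<in> {0..1}" for w i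
    proof -
      note tb = nbD(1)[OF Tb[OF w a]] nbD(1)[OF Tb[OF w b]]
      have n: "nb (T t a - T t b) \<delta>" if "t \<in> {0..1}" for t
        unfolding Td[OF that a b] \<delta>_def by (rule Tb[OF that Dc[OF a b]])
      have "(P \<circ> T w a \<circ> P) - (P \<circ> T w b \<circ> P) = P \<circ> (T w a - T w b) \<circ> P"
        unfolding comp_add_right(2)[OF Pb tb] comp_add_left ..
      then show ?thesis using nb_comp[OF nb_comp[OF nP n[OF w]] nP] n[OF sI] by (simp add: M_def)
    qed
    have eq: "((rt.U \<circ> dsm (M 0 a)) - (dsm (M 1 a) \<circ> rt.U)) - ((rt.U \<circ> dsm (M 0 b)) - (dsm (M 1 b) \<circ> rt.U))
        = (rt.U \<circ> dsm (\<lambda>i. M 0 a i - M 0 b i)) - (dsm (\<lambda>i. M 1 a i - M 1 b i) \<circ> rt.U)"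
      unfolding dsm_add(2)[symmetric] comp_add_right(2)[OF rt.U_bop Bb[OF z(1) a] Bb[OF z(1) b]] comp_add_left by (simp add: algebra_simps)
    have le: "u * \<delta> + \<delta> * u \<le> \<epsilon>"
    proof -
      have "2 * u * K * ba_norm A (ba_diff A a b) \<le> 2 * u * K * (\<epsilon> / (2 * u * K))"
        using m u K unfolding b_def by (intro mult_left_mono) auto
      also have "\<dots> = \<epsilon>" using u K by simp
      finally show ?thesis by (simp add: \<delta>_def algebra_simps)
    qed
    have "nb (((rt.U \<circ> dsm (M 0 a)) - (dsm (M 1 a) \<circ> rt.U)) - ((rt.U \<circ> dsm (M 0 b)) - (dsm (M 1 b) \<circ> rt.U))) \<epsilon>"
      unfolding eq by (rule nb_mono[OF _ le]) (intro nb_diff nb_comp u nb_dsm d z)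
    then show "\<exists>Q\<in>kop p. nb (((rt.U \<circ> dsm (M 0 a)) - (dsm (M 1 a) \<circ> rt.U)) - Q) \<epsilon>"
      by (rule bexI[OF _ dense[OF b_def]])
  qed
  then have allB: "\<forall>a\<in>ba_carrier A. (rt.U \<circ> dsm (M 0 a)) - (dsm (M 1 a) \<circ> rt.U) \<in> kop p" by (intro ballI)
  have sB: "\<forall>i. s i \<in> {0..1}" by (intro allI sI)
  \<comment> \<open>The twist preserves the inner coordinate l: for l in E every copy belongs to
    \<open>Gd\<close>, and for other l the twist is the identity. Hence it commutes with this
    projection.\<close>
  define Gd where "Gd = {n. \<forall>i l. n = ray i l \<longrightarrow> i \<noteq> 0 \<or> l \<in> E}"
  have Gd: "ray i l \<in> Gd \<longleftrightarrow> i \<noteq> 0 \<or> l \<in> E" for i l by (auto simp: Gd_def ray_eq_iff)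
  have Qb: "mulop (indicator Gd) \<in> bop p" by (rule nbD(1)[OF nb_mulop[of _ 1]]) (auto simp: indicator_def)
  have QL: "mulop (indicator Gd) x \<in> L" if "x \<in> L" for x by (rule bop_lp[OF Qb that])
  have mQ: "mulop (indicator Gd) x n = (if n \<in> Gd then x n else 0)" if "x \<in> L" for x n using that by (simp add: mulop_def)
  have UQ: "rt.U \<circ> mulop (indicator Gd) = mulop (indicator Gd) \<circ> rt.U"
  proof (rule bop_ext)
    fix x assume x: "x \<in> L"
    show "(rt.U \<circ> mulop (indicator Gd)) x = (mulop (indicator Gd) \<circ> rt.U) x"
      by (rule ray_ext) (simp add: rt.U_ray[OF QL[OF x]] rt.U_ray[OF x] mQ[OF x] mQ[OF bop_lp[OF rt.U_bop x]] Gd)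
  qed (use rt.U_bop Qb in simp_all)
  have UiQ: "rt.Ui \<circ> mulop (indicator Gd) = mulop (indicator Gd) \<circ> rt.Ui"
  proof (rule bop_ext)
    fix x assume x: "x \<in> L"
    show "(rt.Ui \<circ> mulop (indicator Gd)) x = (mulop (indicator Gd) \<circ> rt.Ui) x"
      by (rule ray_ext) (simp add: rt.Ui_ray[OF QL[OF x]] rt.Ui_ray[OF x] mQ[OF x] mQ[OF bop_lp[OF rt.Ui_bop x]] Gd)
  qed (use rt.Ui_bop Qb in simp_all)
  show ?thesis
    by (rule that[OF rt.U_bop rt.Ui_bop rt.U_Ui rt.Ui_U sB UQ[unfolded Gd_def] UiQ[unfolded Gd_def] allB[unfolded M_def]])
qed


section \<open>Reduction to an intertwiner\<close>

text \<open>An enumeration of the coordinates that are kept. The range of \<open>g4\<close> in copy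
  0 goes to the even ones and all other copies to the odd ones, so that compression along
  \<open>rg\<close> produces a \<open>dsum2\<close>.\<close>

definition rg :: "nat \<Rightarrow> nat" where
  "rg n = (if even n then ray 0 (g4 (n div 2)) else case prod_decode (n div 2) of (i, l) \<Rightarrow> ray (Suc i) l)"

lemma rg_simps: "rg (ev k) = ray 0 (g4 k)" "rg (od (ray i l)) = ray (Suc i) l"
  by (simp_all add: rg_def ev_def od_def, simp add: ray_def)

lemma ev_ray_cases: obtains k where "n = ev k" | i l where "n = od (ray i l)"
  by (metis ev_od_cases ray_cases)

lemma inj_rg: "inj rg"
proof (rule injI)
  fix x y assume "rg x = rg y"
  then show "x = y" using inj_g4
    by (cases x rule: ev_ray_cases; cases y rule: ev_ray_cases) (auto simp: rg_simps ray_eq_iff inj_eq)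
qed

lemma range_rg: "range rg = {n. \<forall>i l. n = ray i l \<longrightarrow> i \<noteq> 0 \<or> l \<in> range g4}"
proof (intro equalityI subsetI)
  fix n assume "n \<in> range rg"
  then obtain m where m: "n = rg m" by auto
  show "n \<in> {n. \<forall>i l. n = ray i l \<longrightarrow> i \<noteq> 0 \<or> l \<in> range g4}"
    by (cases m rule: ev_ray_cases) (auto simp: m rg_simps ray_eq_iff)
next
  fix n assume n: "n \<in> {n. \<forall>i l. n = ray i l \<longrightarrow> i \<noteq> 0 \<or> l \<in> range g4}"
  obtain i l where il: "n = ray i l" by (rule ray_cases)
  show "n \<in> range rg"
  proof (cases i)
    case 0
    then obtain k where "l = g4 k" using n il by auto
    then have "n = rg (ev k)" using 0 il by (simp add: rg_simps)
    then show ?thesis by simp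
  next
    case (Suc j)
    then have "n = rg (od (ray j l))" using il by (simp add: rg_simps)
    then show ?thesis by simp
  qed
qed

lemma compress_dsm:
  assumes M: "\<And>i. nb (M i) c" and T: "T \<in> bop p" and M0: "M 0 = P4 \<circ> T \<circ> P4"
  shows "res rg \<circ> dsm M \<circ> emb rg = dsum2 (res g4 \<circ> T \<circ> emb g4) (dsm (\<lambda>i. M (Suc i)))"
proof (rule bop_ext)
  note g4b = emb_res_bop[OF inj_g4] and rgb = emb_res_bop[OF inj_rg]
  have D: "dsm M \<in> bop p" "dsm (\<lambda>i. M (Suc i)) \<in> bop p" by (rule nbD(1)[OF nb_dsm[OF M]])+
  have C: "res g4 \<circ> T \<circ> emb g4 \<in> bop p" using T g4b by simp
  show "res rg \<circ> dsm M \<circ> emb rg \<in> bop p" "dsum2 (res g4 \<circ> T \<circ> emb g4) (dsm (\<lambda>i. M (Suc i))) \<in> bop p"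
    using D C rgb by simp_all
  fix x assume x: "x \<in> L"
  define y where "y = emb rg x"
  have y: "y \<in> L" unfolding y_def by (rule bop_lp[OF rgb(1) x])
  have yr: "y (rg n) = x n" for n using x inj_rg by (simp add: y_def emb_def)
  have l: "(res rg \<circ> dsm M \<circ> emb rg) x n = dsm M y (rg n)" for n
    using bop_lp[OF D(1) y] by (simp add: res_def y_def)
  have xe: "x \<circ> ev \<in> L" and xo: "x \<circ> od \<in> L" by (rule lp_comp_inj(1)[OF x inj_ev], rule lp_comp_inj(1)[OF x inj_od])
  have yray: "y \<circ> ray 0 \<in> L" by (rule comp_ray_lp[OF y])
  have Py: "P4 (y \<circ> ray 0) = emb g4 (x \<circ> ev)"
  proof
    fix l
    show "P4 (y \<circ> ray 0) l = emb g4 (x \<circ> ev) l"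
    proof (cases "l \<in> range g4")
      case True
      then obtain k where k: "l = g4 k" by auto
      have "y (ray 0 l) = x (ev k)" using yr[of "ev k"] by (simp add: rg_simps k)
      then show ?thesis using yray xe inj_g4 by (simp add: P4_def mulop_def emb_def k)
    next
      case False
      then show ?thesis using yray xe by (simp add: P4_def mulop_def emb_def)
    qed
  qed
  have eL: "emb g4 (x \<circ> ev) \<in> L" by (rule bop_lp[OF g4b(1) xe])
  show "(res rg \<circ> dsm M \<circ> emb rg) x = dsum2 (res g4 \<circ> T \<circ> emb g4) (dsm (\<lambda>i. M (Suc i))) x"
  proof
    fix n
    show "(res rg \<circ> dsm M \<circ> emb rg) x n = dsum2 (res g4 \<circ> T \<circ> emb g4) (dsm (\<lambda>i. M (Suc i))) x n"
    proof (cases n rule: ev_ray_cases)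
      case (1 k)
      have "dsm M y (rg (ev k)) = P4 (T (P4 (y \<circ> ray 0))) (g4 k)"
        by (simp add: rg_simps dsm_ray[OF y] M0)
      also have "\<dots> = T (emb g4 (x \<circ> ev)) (g4 k)"
        unfolding Py using bop_lp[OF T eL] by (simp add: P4_def mulop_def)
      also have "\<dots> = (res g4 \<circ> T \<circ> emb g4) (x \<circ> ev) k"
        using bop_lp[OF T eL] by (simp add: res_def)
      finally show ?thesis unfolding l 1 dsum2_apply(1)[OF C D(2) x] .
    next
      case (2 i m)
      have "y \<circ> ray (Suc i) = (x \<circ> od) \<circ> ray i"
      proof
        fix k show "(y \<circ> ray (Suc i)) k = ((x \<circ> od) \<circ> ray i) k" using yr[of "od (ray i k)"] by (simp add: rg_simps)
      qed
      then have "dsm M y (rg n) = dsm (\<lambda>i. M (Suc i)) (x \<circ> od) (ray i m)"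
        unfolding 2 by (simp only: rg_simps dsm_ray[OF y] dsm_ray[OF xo])
      then show ?thesis unfolding l 2 dsum2_apply(2)[OF C D(2) x] .
    qed
  qed
qed

lemma dsm_one: "dsm (\<lambda>i. op_one p) = op_one p"
  unfolding mulop_one[symmetric] dsm_mulop by (rule arg_cong[of _ _ mulop]) (auto split: prod.splits)

lemma dsm_scale: "dsm (\<lambda>i. op_scale a (M i)) = op_scale a (dsm M)"
  by (auto simp: dsm_def op_scale_def vscale_def fun_eq_iff split: prod.splits)

lemma dsm_hom:
  assumes h: "\<And>i. unital_bounded_hom A (bops p) (\<rho> i)"
    and b: "\<And>i a. a \<in> ba_carrier A \<Longrightarrow> nb (\<rho> i a) (K * ba_norm A a)"
  shows "unital_bounded_hom A (bops p) (\<lambda>a. dsm (\<lambda>i. \<rho> i a))"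
proof -
  have hom: "\<And>i. ba_hom A (bops p) (\<rho> i)" "\<And>i. \<rho> i (ba_one A) = op_one p"
    using h by (simp_all add: unital_bounded_hom_def bounded_hom_def)
  have "ba_hom A (bops p) (\<lambda>a. dsm (\<lambda>i. \<rho> i a))"
    unfolding ba_hom_def
  proof (intro conjI ballI allI)
    fix x assume x: "x \<in> ba_carrier A"
    show "dsm (\<lambda>i. \<rho> i x) \<in> ba_carrier (bops p)" using nbD(1)[OF nb_dsm[OF b[OF x]]] by simp
    show "dsm (\<lambda>i. \<rho> i (ba_scale A c x)) = ba_scale (bops p) c (dsm (\<lambda>i. \<rho> i x))" for c
      using hom(1) x by (simp add: ba_hom_def dsm_scale)
    fix y assume y: "y \<in> ba_carrier A"
    show "dsm (\<lambda>i. \<rho> i (ba_add A x y)) = ba_add (bops p) (dsm (\<lambda>i. \<rho> i x)) (dsm (\<lambda>i. \<rho> i y))"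
      using hom(1) x y by (simp add: ba_hom_def dsm_add)
    show "dsm (\<lambda>i. \<rho> i (ba_mult A x y)) = ba_mult (bops p) (dsm (\<lambda>i. \<rho> i x)) (dsm (\<lambda>i. \<rho> i y))"
      using hom(1) x y by (simp add: ba_hom_def dsm_comp[OF b[OF x] b[OF y]])
  qed
  moreover have "op_norm p (dsm (\<lambda>i. \<rho> i a)) \<le> K * ba_norm A a" if "a \<in> ba_carrier A" for a
    by (rule op_norm_le[OF nb_dsm[OF b[OF that]]])
  ultimately show ?thesis
    unfolding unital_bounded_hom_def bounded_hom_def by (auto simp: hom(2) dsm_one)
qed

lemma unital_bounded_hom_bop: "unital_bounded_hom A (bops p) \<rho> \<Longrightarrow> a \<in> ba_carrier A \<Longrightarrow> \<rho> a \<in> bop p"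
  by (simp add: unital_bounded_hom_def bounded_hom_def ba_hom_def)

text \<open>Rearranging summands reduces the theorem to intertwining \<open>L0 \<oplus> B\<close> and \<open>L1 \<oplus> B\<close> modulo compacts, with a
  representation \<open>B\<close> by bounded operators.\<close>

lemma red_equiv_of_intertwiner:
  assumes \<theta>0: "trivial_ext p A \<theta>0" and \<theta>1: "trivial_ext p A \<theta>1" and B: "unital_bounded_hom A (bops p) B"
    and Lb: "\<And>a. a \<in> ba_carrier A \<Longrightarrow> L0 a \<in> bop p \<and> L1 a \<in> bop p"
    and \<psi>: "\<And>a. a \<in> ba_carrier A \<Longrightarrow> \<psi>0 a = q (L0 a) \<and> \<psi>1 a = q (L1 a)"
    and V: "V \<in> bop p" "Vi \<in> bop p" "V \<circ> Vi = op_one p" "Vi \<circ> V = op_one p"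
    and int: "\<And>a. a \<in> ba_carrier A \<Longrightarrow> (V \<circ> dsum2 (L0 a) (B a)) - (dsum2 (L1 a) (B a) \<circ> V) \<in> kop p"
  shows "red_equiv p A (ext_sum p \<psi>0 \<theta>0) (ext_sum p \<psi>1 \<theta>1)"
proof -
  obtain \<rho>0 where \<rho>0: "unital_iso_into A (bops p) \<rho>0" "\<And>a. a \<in> ba_carrier A \<Longrightarrow> \<theta>0 a = q (\<rho>0 a)"
    using \<theta>0 unfolding trivial_ext_def by metis
  obtain \<rho>1 where \<rho>1: "unital_iso_into A (bops p) \<rho>1" "\<And>a. a \<in> ba_carrier A \<Longrightarrow> \<theta>1 a = q (\<rho>1 a)"
    using \<theta>1 unfolding trivial_ext_def by metis
  have h: "unital_bounded_hom A (bops p) \<rho>0" "unital_bounded_hom A (bops p) \<rho>1"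
    using \<rho>0(1) \<rho>1(1) by (simp_all add: unital_iso_into_def iso_into_def unital_bounded_hom_def)
  have b: "\<rho>0 a \<in> bop p" "\<rho>1 a \<in> bop p" "B a \<in> bop p" "L0 a \<in> bop p" "L1 a \<in> bop p" if "a \<in> ba_carrier A" for a
    using unital_bounded_hom_bop[OF h(1) that] unital_bounded_hom_bop[OF h(2) that] unital_bounded_hom_bop[OF B that] Lb[OF that] by auto
  \<comment> \<open>Both sides receive the missing summands, so that each contains L, B, \<rho>0 and
    \<rho>1. Pairing B with \<rho>1 or \<rho>0 provides the lower bound that B itself may
    lack.\<close>
  define \<Theta>1 where "\<Theta>1 a = q (dsum2 (\<rho>1 a) (B a))" for a
  define \<Theta>2 where "\<Theta>2 a = q (dsum2 (B a) (\<rho>0 a))" for a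
  have t1: "trivial_ext p A \<Theta>1"
    unfolding \<Theta>1_def
    by (rule trivial_dilation[OF _ \<rho>1 dsum2_hom[OF h(2) B] inj_ev]) (use \<theta>1 b res_dsum2_emb in \<open>auto simp: trivial_ext_def\<close>)
  have t2: "trivial_ext p A \<Theta>2"
    unfolding \<Theta>2_def
    by (rule trivial_dilation[OF _ \<rho>0 dsum2_hom[OF B h(1)] inj_od]) (use \<theta>0 b res_dsum2_emb in \<open>auto simp: trivial_ext_def\<close>)
  note sb = emb_res_bop(2)[OF inj_sw(1)] emb_res_bop(2)[OF inj_sw(2)]
  \<comment> \<open>\<open>sw1\<close> brings B next to L0, V acts on this pair, and
    \<open>sw2\<close> puts the summands in the order required on the other side.\<close>
  define W Wi where "W = res sw2 \<circ> dsum2 V (op_one p) \<circ> res sw1" and "Wi = res sw1 \<circ> dsum2 Vi (op_one p) \<circ> res sw2"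
  have Wb: "W \<in> bop p" "Wi \<in> bop p" using sb V one_bop by (simp_all add: W_def Wi_def)
  have d: "dsum2 V (op_one p) \<circ> dsum2 Vi (op_one p) = op_one p" "dsum2 Vi (op_one p) \<circ> dsum2 V (op_one p) = op_one p"
    using V one_bop by (simp_all add: dsum2_comp one_comp dsum2_one)
  have 1: "W \<circ> Wi = op_one p"
  proof -
    have "W \<circ> Wi = res sw2 \<circ> (dsum2 V (op_one p) \<circ> ((res sw1 \<circ> res sw1) \<circ> dsum2 Vi (op_one p))) \<circ> res sw2"
      by (simp add: W_def Wi_def comp_assoc)
    also have "\<dots> = res sw2 \<circ> res sw2" using V one_bop sb by (simp add: res_sw_invol one_comp d)
    finally show ?thesis by (simp add: res_sw_invol)
  qed
  have 2: "Wi \<circ> W = op_one p"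
  proof -
    have "Wi \<circ> W = res sw1 \<circ> (dsum2 Vi (op_one p) \<circ> ((res sw2 \<circ> res sw2) \<circ> dsum2 V (op_one p))) \<circ> res sw1"
      by (simp add: W_def Wi_def comp_assoc)
    also have "\<dots> = res sw1 \<circ> res sw1" using V one_bop sb by (simp add: res_sw_invol one_comp d)
    finally show ?thesis by (simp add: res_sw_invol)
  qed
  have "ext_equiv p A (ext_sum p (ext_sum p \<psi>0 \<theta>0) \<Theta>1) (ext_sum p (ext_sum p \<psi>1 \<theta>1) \<Theta>2)"
  proof (rule ext_equivI[OF Wb 1 2])
    fix a assume a: "a \<in> ba_carrier A"
    note b = b[OF a]
    let ?X = "dsum2 (dsum2 (L0 a) (\<rho>0 a)) (dsum2 (\<rho>1 a) (B a))"
    let ?Y = "dsum2 (dsum2 (L1 a) (\<rho>1 a)) (dsum2 (B a) (\<rho>0 a))"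
    let ?C = "dsum2 (\<rho>1 a) (\<rho>0 a)"
    let ?Z0 = "dsum2 (dsum2 (L0 a) (B a)) ?C" and ?Z1 = "dsum2 (dsum2 (L1 a) (B a)) ?C"
    let ?V = "dsum2 V (op_one p)"
    have X: "ext_sum p (ext_sum p \<psi>0 \<theta>0) \<Theta>1 a = q ?X"
      using \<psi>[OF a] \<rho>0(2)[OF a] b by (intro ext_sum_eq) (auto simp: \<Theta>1_def)
    have Y: "ext_sum p (ext_sum p \<psi>1 \<theta>1) \<Theta>2 a = q ?Y"
      using \<psi>[OF a] \<rho>1(2)[OF a] b by (intro ext_sum_eq) (auto simp: \<Theta>2_def)
    have sX: "res sw1 \<circ> ?X = ?Z0 \<circ> res sw1" by (rule sw_intertwine(1)[OF b(4,1,2,3)])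
    have sY: "res sw2 \<circ> ?Z1 = ?Y \<circ> res sw2" by (rule sw_intertwine(2)[OF b(5,3,2,1)])
    have Vb: "?V \<in> bop p" "?Z0 \<in> bop p" "?Z1 \<in> bop p" using V b one_bop by simp_all
    have "(W \<circ> ?X) - (?Y \<circ> W) = res sw2 \<circ> ((?V \<circ> ?Z0) - (?Z1 \<circ> ?V)) \<circ> res sw1"
    proof -
      have "W \<circ> ?X = res sw2 \<circ> (?V \<circ> ?Z0) \<circ> res sw1" unfolding W_def by (simp only: comp_assoc sX)
      moreover have "?Y \<circ> W = (?Y \<circ> res sw2) \<circ> ?V \<circ> res sw1" unfolding W_def by (simp only: comp_assoc)
      then have "?Y \<circ> W = res sw2 \<circ> (?Z1 \<circ> ?V) \<circ> res sw1" unfolding sY[symmetric] by (simp only: comp_assoc)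
      ultimately show ?thesis using sb Vb by (simp add: comp_add_right comp_add_left)
    qed
    also have "(?V \<circ> ?Z0) - (?Z1 \<circ> ?V) = dsum2 ((V \<circ> dsum2 (L0 a) (B a)) - (dsum2 (L1 a) (B a) \<circ> V)) 0"
      using V b one_bop by (simp add: dsum2_comp dsum2_add one_comp)
    finally have "(W \<circ> ?X) - (?Y \<circ> W) \<in> kop p"
      using kop_comp_right[OF kop_comp_left[OF dsum2_kop[OF int[OF a] kop_zero] sb(2)] sb(1)] by (simp only:)
    then show "\<exists>T T'. T \<in> bop p \<and> T' \<in> bop p \<and> ext_sum p (ext_sum p \<psi>0 \<theta>0) \<Theta>1 a = q T \<and>
        ext_sum p (ext_sum p \<psi>1 \<theta>1) \<Theta>2 a = q T' \<and> (W \<circ> T) - (T' \<circ> W) \<in> kop p"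
      using X Y b by (intro exI[of _ ?X] exI[of _ ?Y]) simp
  qed
  then show ?thesis unfolding red_equiv_def using t1 t2 by blast
qed

end

context banach_alg
begin

section \<open>Homotopies\<close>

text \<open>Sequential compactness of [0, 1] with continuity at the limit l. The conclusion covers
  every sequence tending to l, since uniform continuity compares two sequences with a common
  limit.\<close>

lemma path_subsequence:
  assumes f: "\<And>t. t \<in> {0..1::real} \<Longrightarrow> f t \<in> C"
    and cont: "\<And>t e. t \<in> {0..1} \<Longrightarrow> 0 < e \<Longrightarrow> \<exists>d>0. \<forall>s\<in>{0..1}. \<bar>s - t\<bar> < d \<longrightarrow> N (D (f s) (f t)) < e"
    and S: "\<And>n. S n \<in> {0..1}"
  obtains l r where "l \<in> {0..1}" "strict_mono (r :: nat \<Rightarrow> nat)" "(\<lambda>n. S (r n)) \<longlonglongrightarrow> l"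
    "\<forall>T e. (\<forall>n. T n \<in> {0..1}) \<longrightarrow> T \<longlonglongrightarrow> l \<longrightarrow> 0 < e \<longrightarrow> (\<forall>\<^sub>F n in sequentially. N (D (f (T n)) (f l)) < e)"
proof -
  obtain l r where lr: "l \<in> {0..1}" "strict_mono (r :: nat \<Rightarrow> nat)" "(S \<circ> r) \<longlonglongrightarrow> l"
    using compact_Icc[of 0 "1::real"] S unfolding compact_def by metis
  show ?thesis
  proof (rule that[OF lr(1,2)], goal_cases)
    case 1
    show ?case using lr(3) by (simp add: comp_def)
  next
    case 2
    show ?case
    proof (intro allI impI)
      fix T :: "nat \<Rightarrow> real" and e :: real
      assume "\<forall>n. T n \<in> {0..1}" and T2: "T \<longlonglongrightarrow> l" and e: "0 < e"
      then have T: "\<And>n. T n \<in> {0..1}" by simp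
      obtain d where d: "0 < d" "\<And>s. s \<in> {0..1} \<Longrightarrow> \<bar>s - l\<bar> < d \<Longrightarrow> N (D (f s) (f l)) < e" using cont[OF lr(1) e] by auto
      have "\<forall>\<^sub>F n in sequentially. dist (T n) l < d" by (rule tendstoD[OF T2 d(1)])
      then show "\<forall>\<^sub>F n in sequentially. N (D (f (T n)) (f l)) < e"
        by (rule eventually_mono) (use d(2)[OF T] in \<open>simp add: dist_real_def\<close>)
    qed
  qed
qed

lemma path_bounded:
  assumes f: "\<And>t. t \<in> {0..1::real} \<Longrightarrow> f t \<in> C"
    and cont: "\<And>t e. t \<in> {0..1} \<Longrightarrow> 0 < e \<Longrightarrow> \<exists>d>0. \<forall>s\<in>{0..1}. \<bar>s - t\<bar> < d \<longrightarrow> N (D (f s) (f t)) < e"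
  shows "\<exists>M. \<forall>t\<in>{0..1}. N (f t) \<le> M"
proof (rule ccontr)
  assume "\<not> ?thesis"
  then have "\<forall>n. \<exists>t. t \<in> {0..1} \<and> real n < N (f t)" by (meson not_le)
  then obtain S where S: "\<And>n. S n \<in> {0..1}" "\<And>n. real n < N (f (S n))" by metis
  obtain l r where lr: "l \<in> {0..1}" "strict_mono (r :: nat \<Rightarrow> nat)" "(\<lambda>n. S (r n)) \<longlonglongrightarrow> l"
    and ev: "\<forall>T e. (\<forall>n. T n \<in> {0..1}) \<longrightarrow> T \<longlonglongrightarrow> l \<longrightarrow> 0 < e \<longrightarrow> (\<forall>\<^sub>F n in sequentially. N (D (f (T n)) (f l)) < e)"
    by (rule path_subsequence[where f = f and S = S, OF f cont S(1)]) (assumption | rule that)+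
  obtain n0 where n0: "\<And>n. n0 \<le> n \<Longrightarrow> N (D (f (S (r n))) (f l)) < 1"
    using ev[rule_format, of "\<lambda>n. S (r n)" 1] S(1) lr(3) by (auto simp: eventually_sequentially)
  obtain k where k: "N (f l) + 1 < real k" using reals_Archimedean2 by blast
  let ?n = "max n0 k"
  have "real ?n \<le> real (r ?n)" using strict_mono_imp_increasing[OF lr(2), of ?n] by simp
  also have "\<dots> < N (f (S (r ?n)))" by (rule S(2))
  also have "\<dots> \<le> N (f l) + N (D (f (S (r ?n))) (f l))" by (rule norm_le_diff[OF f[OF S(1)] f[OF lr(1)]])
  finally show False using n0[of ?n] k by simp
qed

lemma path_uniformly_continuous:
  assumes f: "\<And>t. t \<in> {0..1::real} \<Longrightarrow> f t \<in> C"
    and cont: "\<And>t e. t \<in> {0..1} \<Longrightarrow> 0 < e \<Longrightarrow> \<exists>d>0. \<forall>s\<in>{0..1}. \<bar>s - t\<bar> < d \<longrightarrow> N (D (f s) (f t)) < e"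
    and e: "0 < e"
  shows "\<exists>d>0. \<forall>s\<in>{0..1}. \<forall>t\<in>{0..1}. \<bar>s - t\<bar> < d \<longrightarrow> N (D (f s) (f t)) < e"
proof (rule ccontr)
  assume neg: "\<not> ?thesis"
  have "\<forall>n. \<exists>s t. s \<in> {0..1} \<and> t \<in> {0..1} \<and> \<bar>s - t\<bar> < 1 / real (Suc n) \<and> e \<le> N (D (f s) (f t))"
  proof
    fix n
    have "(0::real) < 1 / real (Suc n)" by simp
    then show "\<exists>s t. s \<in> {0..1} \<and> t \<in> {0..1} \<and> \<bar>s - t\<bar> < 1 / real (Suc n) \<and> e \<le> N (D (f s) (f t))"
      using neg by (meson not_le)
  qed
  then obtain S T where ST: "\<And>n. S n \<in> {0..1}" "\<And>n. T n \<in> {0..1}" "\<And>n. \<bar>S n - T n\<bar> < 1 / real (Suc n)" "\<And>n. e \<le> N (D (f (S n)) (f (T n)))"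
    by metis
  obtain l r where lr: "l \<in> {0..1}" "strict_mono (r :: nat \<Rightarrow> nat)" "(\<lambda>n. S (r n)) \<longlonglongrightarrow> l"
    and ev: "\<forall>T e. (\<forall>n. T n \<in> {0..1}) \<longrightarrow> T \<longlonglongrightarrow> l \<longrightarrow> 0 < e \<longrightarrow> (\<forall>\<^sub>F n in sequentially. N (D (f (T n)) (f l)) < e)"
    by (rule path_subsequence[where f = f and S = S, OF f cont ST(1)]) (assumption | rule that)+
  have "(\<lambda>n. S n - T n) \<longlonglongrightarrow> 0"
    by (rule Lim_null_comparison[OF _ LIMSEQ_inverse_real_of_nat]) (use ST(3) in \<open>auto intro!: always_eventually less_imp_le simp: inverse_eq_divide\<close>)
  from LIMSEQ_subseq_LIMSEQ[OF this lr(2)] have "(\<lambda>n. S (r n) - T (r n)) \<longlonglongrightarrow> 0" by (simp add: comp_def)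
  from tendsto_diff[OF lr(3) this] have Tl: "(\<lambda>n. T (r n)) \<longlonglongrightarrow> l" by simp
  have "\<forall>\<^sub>F n in sequentially. N (D (f (S (r n))) (f l)) < e / 2 \<and> N (D (f (T (r n))) (f l)) < e / 2"
    using ev[rule_format, of "\<lambda>n. S (r n)" "e/2"] ev[rule_format, of "\<lambda>n. T (r n)" "e/2"] ST(1,2) lr(3) Tl e by (intro eventually_conj) auto
  then obtain n where n: "N (D (f (S (r n))) (f l)) < e / 2" "N (D (f (T (r n))) (f l)) < e / 2" by (auto simp: eventually_sequentially)
  have "N (D (f (S (r n))) (f (T (r n)))) \<le> N (D (f (S (r n))) (f l)) + N (D (f l) (f (T (r n))))"
    by (rule norm_diff_triangle[OF f[OF ST(1)] f[OF lr(1)] f[OF ST(2)]])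
  also have "N (D (f l) (f (T (r n)))) = N (D (f (T (r n))) (f l))" by (rule norm_diff_sym[OF f[OF lr(1)] f[OF ST(2)]])
  finally show False using ST(4)[of "r n"] n by simp
qed

end

lemma ba_hom_diff:
  assumes "ba_hom A B f" "unital_cbanach_algebra A" "x \<in> ba_carrier A" "y \<in> ba_carrier A"
  shows "f (ba_diff A x y) = ba_diff B (f x) (f y)"
proof -
  interpret banach_alg A by unfold_locales (rule assms(2))
  show ?thesis using assms closed(5)[OF assms(4), of "-1"] by (simp add: ba_diff_def ba_hom_def)
qed

text \<open>Continuous paths over [0, 1] are bounded, so the family is pointwise bounded and
  Banach-Steinhaus applies. A bound independent of t is what allows a direct sum over infinitely
  many parameters.\<close>

lemma homotopy_uniform_bound:
  fixes \<tau> :: "real \<Rightarrow> 'a \<Rightarrow> 'b"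
  assumes A1: "unital_cbanach_algebra A1" and A2: "unital_cbanach_algebra A2"
    and \<tau>: "\<forall>t\<in>{0..1}. unital_bounded_hom A1 A2 (\<tau> t)"
    and cont: "\<forall>a\<in>ba_carrier A1. \<forall>t\<in>{0..1}. \<forall>\<epsilon>>0. \<exists>\<delta>>0. \<forall>s\<in>{0..1}.
           \<bar>s - t\<bar> < \<delta> \<longrightarrow> ba_norm A2 (ba_diff A2 (\<tau> s a) (\<tau> t a)) < (\<epsilon>::real)"
  shows "\<exists>K. \<forall>t\<in>{0..1}. \<forall>a\<in>ba_carrier A1. ba_norm A2 (\<tau> t a) \<le> K * ba_norm A1 a"
proof -
  interpret B1: banach_alg A1 by unfold_locales (rule A1)
  interpret B2: banach_alg A2 by unfold_locales (rule A2)
  have h: "ba_hom A1 A2 (\<tau> t)" if "t \<in> {0..1}" for t using \<tau> that by (simp add: unital_bounded_hom_def bounded_hom_def)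
  have c: "\<tau> t a \<in> ba_carrier A2" if "t \<in> {0..1}" "a \<in> ba_carrier A1" for t a using h[OF that(1)] that(2) by (simp add: ba_hom_def)
  show ?thesis
  proof (rule B1.uniform_boundedness)
    fix t :: real and a assume t: "t \<in> {0..1}" and a: "a \<in> ba_carrier A1"
    show "0 \<le> ba_norm A2 (\<tau> t a)" by (rule B2.norm_nonneg[OF c[OF t a]])
    show "ba_norm A2 (\<tau> t a) \<le> ba_norm A2 (\<tau> t b) + ba_norm A2 (\<tau> t (ba_diff A1 a b))" if b: "b \<in> ba_carrier A1" for b
      unfolding ba_hom_diff[OF h[OF t] A1 a b] by (rule B2.norm_le_diff[OF c[OF t a] c[OF t b]])
    show "ba_norm A2 (\<tau> t (ba_scale A1 k a)) = cmod k * ba_norm A2 (\<tau> t a)" for k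
      using h[OF t] a B2.norm_scale[OF c[OF t a]] by (simp add: ba_hom_def)
  next
    fix t :: real assume "t \<in> {0..1}"
    then show "\<exists>K. \<forall>x\<in>ba_carrier A1. ba_norm A2 (\<tau> t x) \<le> K * ba_norm A1 x"
      using \<tau> by (simp add: unital_bounded_hom_def bounded_hom_def)
  next
    fix a assume a: "a \<in> ba_carrier A1"
    show "\<exists>M. \<forall>t\<in>{0..1}. ba_norm A2 (\<tau> t a) \<le> M"
      by (rule B2.path_bounded) (use c[OF _ a] cont a in simp_all)
  qed
qed

theorem theorem7p19:
  fixes p :: real
    and A1 :: "'a cbalg" and A2 :: "'b cbalg"
    and \<phi> :: "'b \<Rightarrow> lpop set"
    and \<tau> :: "real \<Rightarrow> 'a \<Rightarrow> 'b"
  assumes "1 < p"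
    and "unital_cbanach_algebra A1" and "ba_separable A1"
    and "unital_cbanach_algebra A2" and "ba_separable A2"
    and "\<exists>\<rho>. iso_into A1 (bops p) \<rho>"
    and "\<exists>\<rho>. iso_into A2 (bops p) \<rho>"
    and "iso_ext p A2 \<phi>"
    and "\<forall>t\<in>{0..1}. unital_bounded_hom A1 A2 (\<tau> t)"
    and "red_invertible p A2 \<phi>"
    and "\<forall>a\<in>ba_carrier A1. \<forall>t\<in>{0..1}. \<forall>\<epsilon>>0. \<exists>\<delta>>0. \<forall>s\<in>{0..1}.
           \<bar>s - t\<bar> < \<delta> \<longrightarrow> ba_norm A2 (ba_diff A2 (\<tau> s a) (\<tau> t a)) < \<epsilon>"
  shows "\<forall>\<omega>0 \<omega>1. pushforward_rep p A1 (\<tau> 0) \<phi> \<omega>0 \<longrightarrow> pushforward_rep p A1 (\<tau> 1) \<phi> \<omega>1 \<longrightarrow>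
           red_equiv p A1 \<omega>0 \<omega>1"
proof (intro allI impI)
  fix \<omega>0 \<omega>1
  assume \<omega>0: "pushforward_rep p A1 (\<tau> 0) \<phi> \<omega>0" and \<omega>1: "pushforward_rep p A1 (\<tau> 1) \<phi> \<omega>1"
  note p = assms(1) and A1 = assms(2) and sep = assms(3) and A2 = assms(4) and \<phi> = assms(8) and \<tau> = assms(9)
    and inv = assms(10) and cont = assms(11)
  interpret lp_space p by unfold_locales (rule p)
  interpret B1: banach_alg A1 by unfold_locales (rule A1)
  interpret B2: banach_alg A2 by unfold_locales (rule A2)
  obtain \<theta>0 \<theta>1 where \<theta>: "trivial_ext p A1 \<theta>0" "\<omega>0 = ext_sum p (\<phi> \<circ> \<tau> 0) \<theta>0" "trivial_ext p A1 \<theta>1" "\<omega>1 = ext_sum p (\<phi> \<circ> \<tau> 1) \<theta>1"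
    using \<omega>0 \<omega>1 unfolding pushforward_rep_def by (elim exE conjE) (rule that)
  obtain \<rho> where \<rho>: "unital_bounded_hom A2 (bops p) \<rho>"
    and \<rho>P: "\<And>b. b \<in> ba_carrier A2 \<Longrightarrow> (P4 \<circ> \<rho> b) - (\<rho> b \<circ> P4) \<in> kop p"
    and \<rho>\<phi>: "\<And>b. b \<in> ba_carrier A2 \<Longrightarrow> \<phi> b = q (res g4 \<circ> \<rho> b \<circ> emb g4)"
    by (rule invertible_extension_lift[OF \<phi> inv]) (rule that)
  have \<rho>h: "ba_hom A2 (bops p) \<rho>" "\<rho> (ba_one A2) = op_one p" using \<rho> by (simp_all add: unital_bounded_hom_def bounded_hom_def)
  obtain K\<rho> where K\<rho>: "0 \<le> K\<rho>" "\<And>b. b \<in> ba_carrier A2 \<Longrightarrow> 0 \<le> ba_norm A2 b \<Longrightarrow> nb (\<rho> b) (K\<rho> * ba_norm A2 b)"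
    using bounded_hom_nb[of A2 \<rho>] \<rho> unfolding unital_bounded_hom_def by metis
  have \<tau>h: "ba_hom A1 A2 (\<tau> t)" "\<tau> t (ba_one A1) = ba_one A2" if "t \<in> {0..1}" for t
    using \<tau> that by (simp_all add: unital_bounded_hom_def bounded_hom_def)
  have \<tau>c: "\<tau> t a \<in> ba_carrier A2" if "t \<in> {0..1}" "a \<in> ba_carrier A1" for t a
    using \<tau>h(1)[OF that(1)] that(2) by (simp add: ba_hom_def)
  obtain K\<tau> where K\<tau>: "\<forall>t\<in>{0..1}. \<forall>a\<in>ba_carrier A1. ba_norm A2 (\<tau> t a) \<le> K\<tau> * ba_norm A1 a"
    using homotopy_uniform_bound[OF A1 A2 \<tau> cont] ..
  \<comment> \<open>The summand 1 makes K strictly positive, because \<open>path_intertwiner\<close>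
    divides by it.\<close>
  define K where "K = K\<rho> * \<bar>K\<tau>\<bar> + 1"
  have K: "0 < K" using K\<rho>(1) by (simp add: K_def add_nonneg_pos)
  define T where "T t a = \<rho> (\<tau> t a)" for t a
  have Tnb: "nb (T t a) (K * ba_norm A1 a)" if t: "t \<in> {0..1}" and a: "a \<in> ba_carrier A1" for t a
  proof -
    have n: "0 \<le> ba_norm A1 a" by (rule B1.norm_nonneg[OF a])
    have "ba_norm A2 (\<tau> t a) \<le> K\<tau> * ba_norm A1 a" using K\<tau> t a by simp
    also have "\<dots> \<le> \<bar>K\<tau>\<bar> * ba_norm A1 a" using n by (intro mult_right_mono) auto
    finally have "K\<rho> * ba_norm A2 (\<tau> t a) \<le> K\<rho> * (\<bar>K\<tau>\<bar> * ba_norm A1 a)" using K\<rho>(1) by (rule mult_left_mono)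
    also have "\<dots> \<le> K * ba_norm A1 a" using n by (simp add: K_def algebra_simps)
    finally show ?thesis unfolding T_def
      by (rule nb_mono[OF K\<rho>(2)[OF \<tau>c[OF t a] B2.norm_nonneg[OF \<tau>c[OF t a]]]])
  qed
  have Thom: "unital_bounded_hom A1 (bops p) (T t)" if t: "t \<in> {0..1}" for t
  proof -
    have "ba_hom A1 (bops p) (T t)" using \<rho>h(1) \<tau>h(1)[OF t] unfolding ba_hom_def T_def by simp
    moreover have "\<forall>x\<in>ba_carrier A1. op_norm p (T t x) \<le> K * ba_norm A1 x" using op_norm_le[OF Tnb[OF t]] by simp
    moreover have "T t (ba_one A1) = op_one p" by (simp add: T_def \<tau>h(2)[OF t] \<rho>h(2))
    ultimately show ?thesis unfolding unital_bounded_hom_def bounded_hom_def by auto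
  qed
  have \<rho>d: "\<rho> x - \<rho> y = \<rho> (ba_diff A2 x y)" if "x \<in> ba_carrier A2" "y \<in> ba_carrier A2" for x y
    unfolding ba_hom_diff[OF \<rho>h(1) A2 that] by (simp add: ba_diff_def op_scale_minus_one)
  have Td: "T t a - T t b = T t (ba_diff A1 a b)" if "t \<in> {0..1}" "a \<in> ba_carrier A1" "b \<in> ba_carrier A1" for t a b
    unfolding T_def ba_hom_diff[OF \<tau>h(1)[OF that(1)] A1 that(2,3)] by (rule \<rho>d[OF \<tau>c[OF that(1,2)] \<tau>c[OF that(1,3)]])
  have Tc: "\<exists>\<delta>>0. \<forall>s\<in>{0..1}. \<forall>t\<in>{0..1}. \<bar>s - t\<bar> < \<delta> \<longrightarrow> nb (T s a - T t a) \<epsilon>"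
    if a: "a \<in> ba_carrier A1" and \<epsilon>: "0 < \<epsilon>" for a \<epsilon>
  proof -
    have "\<exists>\<delta>>0. \<forall>s\<in>{0..1}. \<forall>t\<in>{0..1}. \<bar>s - t\<bar> < \<delta> \<longrightarrow> ba_norm A2 (ba_diff A2 (\<tau> s a) (\<tau> t a)) < \<epsilon> / (K\<rho> + 1)"
      by (rule B2.path_uniformly_continuous[where f = "\<lambda>t. \<tau> t a"]) (use \<tau>c[OF _ a] cont a \<epsilon> K\<rho>(1) in simp_all)
    then obtain \<delta> where \<delta>: "0 < \<delta>" "\<And>s t. s \<in> {0..1} \<Longrightarrow> t \<in> {0..1} \<Longrightarrow> \<bar>s - t\<bar> < \<delta> \<Longrightarrow> ba_norm A2 (ba_diff A2 (\<tau> s a) (\<tau> t a)) < \<epsilon> / (K\<rho> + 1)"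
      by auto
    have "nb (T s a - T t a) \<epsilon>" if s: "s \<in> {0..1}" and t: "t \<in> {0..1}" and st: "\<bar>s - t\<bar> < \<delta>" for s t
    proof -
      let ?d = "ba_diff A2 (\<tau> s a) (\<tau> t a)"
      have d: "?d \<in> ba_carrier A2" by (rule B2.diff_closed[OF \<tau>c[OF s a] \<tau>c[OF t a]])
      have "K\<rho> * ba_norm A2 ?d \<le> (K\<rho> + 1) * (\<epsilon> / (K\<rho> + 1))"
        using K\<rho>(1) \<delta>(2)[OF s t st] B2.norm_nonneg[OF d] by (intro mult_mono) auto
      also have "\<dots> = \<epsilon>" using K\<rho>(1) by simp
      finally show ?thesis unfolding T_def \<rho>d[OF \<tau>c[OF s a] \<tau>c[OF t a]]
        by (rule nb_mono[OF K\<rho>(2)[OF d B2.norm_nonneg[OF d]]])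
    qed
    then show ?thesis using \<delta>(1) by auto
  qed
  have TP: "(mulop (indicator (range g4)) \<circ> T t a) - (T t a \<circ> mulop (indicator (range g4))) \<in> kop p"
    if "t \<in> {0..1}" "a \<in> ba_carrier A1" for t a
    using \<rho>P[OF \<tau>c[OF that]] unfolding P4_def T_def .
  obtain Ds where Ds: "Ds \<subseteq> ba_carrier A1" "countable Ds" "\<And>x e. x \<in> ba_carrier A1 \<Longrightarrow> 0 < e \<Longrightarrow> \<exists>d\<in>Ds. ba_norm A1 (ba_diff A1 x d) < e"
    using sep unfolding ba_separable_def by metis
  have "Ds \<noteq> {}" using Ds(3)[OF B1.closed(1), of 1] by auto
  note Dr = range_from_nat_into[OF this Ds(2)]
  have ds1: "from_nat_into Ds m \<in> ba_carrier A1" for m using Dr Ds(1) by blast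
  have ds2: "\<exists>m. ba_norm A1 (ba_diff A1 x (from_nat_into Ds m)) < e" if "x \<in> ba_carrier A1" "0 < e" for x e
    using Ds(3)[OF that] Dr by (metis rangeE)
  obtain U Ui s where U: "U \<in> bop p" "Ui \<in> bop p" "U \<circ> Ui = op_one p" "Ui \<circ> U = op_one p" and s': "\<forall>i. s i \<in> {0..1 :: real}"
    and UQ': "U \<circ> mulop (indicator {n. \<forall>i l. n = ray i l \<longrightarrow> i \<noteq> 0 \<or> l \<in> range g4}) = mulop (indicator {n. \<forall>i l. n = ray i l \<longrightarrow> i \<noteq> 0 \<or> l \<in> range g4}) \<circ> U"
      "Ui \<circ> mulop (indicator {n. \<forall>i l. n = ray i l \<longrightarrow> i \<noteq> 0 \<or> l \<in> range g4}) = mulop (indicator {n. \<forall>i l. n = ray i l \<longrightarrow> i \<noteq> 0 \<or> l \<in> range g4}) \<circ> Ui"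
    and UT': "\<forall>a\<in>ba_carrier A1.
       (U \<circ> dsm (\<lambda>i. if i = 0 then mulop (indicator (range g4)) \<circ> T 0 a \<circ> mulop (indicator (range g4)) else T (s i) a))
       - (dsm (\<lambda>i. if i = 0 then mulop (indicator (range g4)) \<circ> T 1 a \<circ> mulop (indicator (range g4)) else T (s i) a) \<circ> U) \<in> kop p"
    by (rule path_intertwiner[where A = A1 and T = T and K = K and E = "range g4" and ds = "from_nat_into Ds", OF Tnb Td B1.diff_closed Tc TP K ds1 ds2]) (assumption | rule that)+
  note UQ = UQ'[folded range_rg]
  have UT: "(U \<circ> dsm (\<lambda>i. if i = 0 then P4 \<circ> T 0 a \<circ> P4 else T (s i) a)) - (dsm (\<lambda>i. if i = 0 then P4 \<circ> T 1 a \<circ> P4 else T (s i) a) \<circ> U) \<in> kop p"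
    if "a \<in> ba_carrier A1" for a
    using bspec[OF UT' that] unfolding P4_def .
  have s: "s i \<in> {0..1}" for i using s' ..
  note rb = emb_res_bop[OF inj_rg]
  let ?Q = "mulop (indicator (range rg))"
  have ER: "emb rg \<circ> res rg = ?Q"
    unfolding emb_res[OF inj_rg] by (rule arg_cong[of _ _ mulop]) (auto simp: indicator_def)
  have RQ: "res rg \<circ> ?Q = res rg" "?Q \<circ> emb rg = emb rg"
  proof -
    have "res rg \<circ> ?Q = (res rg \<circ> emb rg) \<circ> res rg" unfolding ER[symmetric] by (simp only: comp_assoc)
    then show "res rg \<circ> ?Q = res rg" unfolding res_emb[OF inj_rg] one_comp(1)[OF rb(2)] .
    have "?Q \<circ> emb rg = emb rg \<circ> (res rg \<circ> emb rg)" unfolding ER[symmetric] by (simp only: comp_assoc)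
    then show "?Q \<circ> emb rg = emb rg" unfolding res_emb[OF inj_rg] one_comp(2)[OF rb(1)] .
  qed
  \<comment> \<open>Compression along \<open>rg\<close> inserts the projection \<open>?Q\<close>
    between two factors; it can be moved outwards and absorbed as soon as one factor commutes with
    it. \<open>U\<close> and \<open>Ui\<close> do, so invertibility and the intertwining relation
    survive compression.\<close>
  have cc: "(res rg \<circ> Y \<circ> emb rg) \<circ> (res rg \<circ> X \<circ> emb rg) = res rg \<circ> (Y \<circ> X) \<circ> emb rg" if "X \<circ> ?Q = ?Q \<circ> X \<or> Y \<circ> ?Q = ?Q \<circ> Y" for X Y
  proof -
    have e: "(res rg \<circ> Y \<circ> emb rg) \<circ> (res rg \<circ> X \<circ> emb rg) = res rg \<circ> Y \<circ> ?Q \<circ> X \<circ> emb rg"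
      unfolding ER[symmetric] by (simp only: comp_assoc)
    from that show ?thesis
    proof
      assume h: "X \<circ> ?Q = ?Q \<circ> X"
      have "res rg \<circ> Y \<circ> ?Q \<circ> X \<circ> emb rg = res rg \<circ> Y \<circ> (?Q \<circ> X) \<circ> emb rg" by (simp only: comp_assoc)
      also have "\<dots> = res rg \<circ> (Y \<circ> X) \<circ> (?Q \<circ> emb rg)" unfolding h[symmetric] by (simp only: comp_assoc)
      finally show ?thesis unfolding e RQ .
    next
      assume h: "Y \<circ> ?Q = ?Q \<circ> Y"
      have "res rg \<circ> Y \<circ> ?Q \<circ> X \<circ> emb rg = res rg \<circ> (Y \<circ> ?Q) \<circ> X \<circ> emb rg" by (simp only: comp_assoc)
      also have "\<dots> = (res rg \<circ> ?Q) \<circ> (Y \<circ> X) \<circ> emb rg" unfolding h by (simp only: comp_assoc)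
      finally show ?thesis unfolding e RQ .
    qed
  qed
  define V Vi where "V = res rg \<circ> U \<circ> emb rg" and "Vi = res rg \<circ> Ui \<circ> emb rg"
  have Vb: "V \<in> bop p" "Vi \<in> bop p" using U rb by (simp_all add: V_def Vi_def)
  have V1: "V \<circ> Vi = op_one p" "Vi \<circ> V = op_one p"
    unfolding V_def Vi_def using cc[of Ui U] cc[of U Ui] UQ U(3,4) res_emb[OF inj_rg] one_comp(2)[OF rb(2)] by simp_all
  define L where "L t a = res g4 \<circ> T t a \<circ> emb g4" for t a
  define BB where "BB a = dsm (\<lambda>i. T (s (Suc i)) a)" for a
  have Tb: "T t a \<in> bop p" if "t \<in> {0..1}" "a \<in> ba_carrier A1" for t a by (rule nbD(1)[OF Tnb[OF that]])
  have P4n: "nb P4 1" unfolding P4_def by (rule nb_mulop) (auto simp: indicator_def)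
  have comp: "res rg \<circ> dsm (\<lambda>i. if i = 0 then P4 \<circ> T u a \<circ> P4 else T (s i) a) \<circ> emb rg = dsum2 (L u a) (BB a)"
    and dsb: "dsm (\<lambda>i. if i = 0 then P4 \<circ> T u a \<circ> P4 else T (s i) a) \<in> bop p"
    if u: "u \<in> {0..1}" and a: "a \<in> ba_carrier A1" for u a
  proof -
    have n: "nb (if i = 0 then P4 \<circ> T u a \<circ> P4 else T (s i) a) (K * ba_norm A1 a)" for i :: nat
      using nb_comp[OF nb_comp[OF P4n Tnb[OF u a]] P4n] Tnb[OF s a] by simp
    show "dsm (\<lambda>i. if i = 0 then P4 \<circ> T u a \<circ> P4 else T (s i) a) \<in> bop p" by (rule nbD(1)[OF nb_dsm[OF n]])
    show "res rg \<circ> dsm (\<lambda>i. if i = 0 then P4 \<circ> T u a \<circ> P4 else T (s i) a) \<circ> emb rg = dsum2 (L u a) (BB a)"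
      using compress_dsm[OF n Tb[OF u a]] by (simp add: L_def BB_def)
  qed
  have z: "(0::real) \<in> {0..1}" "(1::real) \<in> {0..1}" by auto
  show "red_equiv p A1 \<omega>0 \<omega>1"
    unfolding \<theta>(2,4)
  proof (rule red_equiv_of_intertwiner[where B = BB and ?L0.0 = "L 0" and ?L1.0 = "L 1", OF \<theta>(1,3) _ _ _ Vb V1])
    show "unital_bounded_hom A1 (bops p) BB"
      unfolding BB_def by (rule dsm_hom[OF Thom[OF s] Tnb[OF s]])
    fix a assume a: "a \<in> ba_carrier A1"
    show "L 0 a \<in> bop p \<and> L 1 a \<in> bop p"
      using Tb[OF z(1) a] Tb[OF z(2) a] emb_res_bop[OF inj_g4] by (simp add: L_def)
    show "(\<phi> \<circ> \<tau> 0) a = q (L 0 a) \<and> (\<phi> \<circ> \<tau> 1) a = q (L 1 a)"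
      using \<rho>\<phi>[OF \<tau>c[OF z(1) a]] \<rho>\<phi>[OF \<tau>c[OF z(2) a]] by (simp add: L_def T_def)
    let ?B0 = "dsm (\<lambda>i. if i = 0 then P4 \<circ> T 0 a \<circ> P4 else T (s i) a)"
    let ?B1 = "dsm (\<lambda>i. if i = 0 then P4 \<circ> T 1 a \<circ> P4 else T (s i) a)"
    have "(V \<circ> dsum2 (L 0 a) (BB a)) - (dsum2 (L 1 a) (BB a) \<circ> V)
        = ((res rg \<circ> U \<circ> emb rg) \<circ> (res rg \<circ> ?B0 \<circ> emb rg)) - ((res rg \<circ> ?B1 \<circ> emb rg) \<circ> (res rg \<circ> U \<circ> emb rg))"
      unfolding V_def comp[OF z(1) a] comp[OF z(2) a] ..
    also have "\<dots> = (res rg \<circ> (U \<circ> ?B0) \<circ> emb rg) - (res rg \<circ> (?B1 \<circ> U) \<circ> emb rg)"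
      unfolding cc[of ?B0 U, OF disjI2, OF UQ(1)] cc[of U ?B1, OF disjI1, OF UQ(1)] ..
    also have "\<dots> = res rg \<circ> ((U \<circ> ?B0) - (?B1 \<circ> U)) \<circ> emb rg"
      using comp_add_right(2)[OF rb(2), of "U \<circ> ?B0" "?B1 \<circ> U"] U(1) dsb[OF z(1) a] dsb[OF z(2) a] by (simp only: comp_add_left bop_closed)
    also have "\<dots> \<in> kop p" by (intro kop_comp_left kop_comp_right UT a rb)
    finally show "(V \<circ> dsum2 (L 0 a) (BB a)) - (dsum2 (L 1 a) (BB a) \<circ> V) \<in> kop p" .
  qed
qed

end
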